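(* Let $X$ be a real Lévy process with $X\in\mathcal D_{\alpha,\rho}$, and let $\overline X_1=\sup_{s\in[0,1]}X_s$. If $X$ is not a subordinator, then there exist functions $f,g\in\mathrm{RV}_{\alpha\rho}$ such that $$f(x)\le\mathbb P(\overline X_1\le x)\le g(x)$$ for all sufficiently small $x>0$. If $X$ is a subordinator, then $\mathbb P(\overline X_1\le x)$ decreases faster than any power as $x\downarrow0$, i.e. $\mathbb P(\overline X_1\le x)=\mathrm o(x^k)$ as $x\downarrow 0$ for every $k>0$.
   Context: $X\in\mathcal D_{\alpha,\rho}$ means: there are a function $a_\varepsilon>0$ and a random variable $\widehat X_1$, not identically $0$, with $X_\varepsilon/a_\varepsilon\to\widehat X_1$ in distribution as $\varepsilon\downarrow0$. Then $\widehat X_1$ is the time-1 value of a Lévy process $\widehat X$ which is necessarily $1/\alpha$-self-similar for some $\alpha\in(0,2]$ (a driftless Brownian motion with $\alpha=2$, a non-zero linear drift with $\alpha=1$, or a strictly $\alpha$-stable process with $\alpha\in(0,2)$); $\alpha$ is this index and $\rho=\mathbb P(\widehat X_1>0)$. $\mathrm{RV}_r$ is the class of functions regularly varying at $0$ with index $r$. A subordinator is a non-decreasing Lévy process. *)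

theory Defs
  imports "HOL-Probability.Probability" "HOL-Library.Landau_Symbols"
begin

definition cadlag :: "(real \<Rightarrow> real) \<Rightarrow> bool" where
  "cadlag p \<longleftrightarrow>
     (\<forall>t\<ge>0. continuous (at_right t) p) \<and> (\<forall>t>0. \<exists>l. (p \<longlongrightarrow> l) (at_left t))"

(* Only the values X t with t \<ge> 0 are constrained. *)
locale levy_process = prob_space M for M :: "'a measure" +
  fixes X :: "real \<Rightarrow> 'a \<Rightarrow> real"
  assumes measurable_X: "\<And>t. 0 \<le> t \<Longrightarrow> X t \<in> borel_measurable M"
    and start_zero: "AE \<omega> in M. X 0 \<omega> = 0"
    and indep_increments:
      "\<And>(n :: nat) (t :: nat \<Rightarrow> real). \<lbrakk>0 \<le> t 0; \<And>i. i < n \<Longrightarrow> t i \<le> t (Suc i)\<rbrakk> \<Longrightarrow>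
         indep_vars (\<lambda>_. borel) (\<lambda>i \<omega>. X (t (Suc i)) \<omega> - X (t i) \<omega>) {..<n}"
    and stationary_increments:
      "\<And>s t. \<lbrakk>0 \<le> s; s \<le> t\<rbrakk> \<Longrightarrow>
         distr M borel (\<lambda>\<omega>. X t \<omega> - X s \<omega>) = distr M borel (X (t - s))"
    and cadlag_paths: "AE \<omega> in M. cadlag (\<lambda>t. X t \<omega>)"

definition subordinator :: "'a measure \<Rightarrow> (real \<Rightarrow> 'a \<Rightarrow> real) \<Rightarrow> bool" where
  "subordinator M X \<longleftrightarrow>
     levy_process M X \<and> (AE \<omega> in M. mono_on {0..} (\<lambda>t. X t \<omega>))"

(* Equality of laws on the product sigma-algebra, that is, of all finite-dimensional
   distributions. *)
definition self_similar :: "'a measure \<Rightarrow> (real \<Rightarrow> 'a \<Rightarrow> real) \<Rightarrow> real \<Rightarrow> bool" where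
  "self_similar M X H \<longleftrightarrow>
     (\<forall>c>0. distr M (\<Pi>\<^sub>M t\<in>{0..}. borel) (\<lambda>\<omega>. \<lambda>t\<in>{0..}. X (c * t) \<omega>) =
            distr M (\<Pi>\<^sub>M t\<in>{0..}. borel) (\<lambda>\<omega>. \<lambda>t\<in>{0..}. c powr H * X t \<omega>))"

(* X \<in> D_{\<alpha>,\<rho>}.  The limit process Y is realised on a space of functions real \<Rightarrow> real,
   which loses no generality: the law of any Levy process lives on its paths.
   Weak convergence as \<epsilon> \<down> 0 is weak convergence along every sequence \<epsilon> \<down> 0. *)
definition in_domain_of_attraction_at_0 ::
    "'a measure \<Rightarrow> (real \<Rightarrow> 'a \<Rightarrow> real) \<Rightarrow> real \<Rightarrow> real \<Rightarrow> bool" where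
  "in_domain_of_attraction_at_0 M X \<alpha> \<rho> \<longleftrightarrow>
     (\<exists>(a :: real \<Rightarrow> real) (N :: (real \<Rightarrow> real) measure) (Y :: real \<Rightarrow> (real \<Rightarrow> real) \<Rightarrow> real).
        (\<forall>\<epsilon>>0. a \<epsilon> > 0) \<and>
        levy_process N Y \<and>
        \<not> (AE \<omega> in N. Y 1 \<omega> = 0) \<and>
        (\<forall>e. filterlim e (at_right 0) sequentially \<longrightarrow>
           weak_conv_m (\<lambda>n. distr M borel (\<lambda>\<omega>. X (e n) \<omega> / a (e n))) (distr N borel (Y 1))) \<and>
        0 < \<alpha> \<and> \<alpha> \<le> 2 \<and> self_similar N Y (1 / \<alpha>) \<and>
        \<rho> = measure N {\<omega> \<in> space N. Y 1 \<omega> > 0})"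

definition regularly_varying_at_0 :: "real \<Rightarrow> (real \<Rightarrow> real) set" where
  "regularly_varying_at_0 r =
     {f. (\<exists>\<delta>>0. f \<in> borel_measurable (restrict_space borel {0<..<\<delta>}) \<and>
                (\<forall>x\<in>{0<..<\<delta>}. f x > 0)) \<and>
         (\<forall>c>0. ((\<lambda>x. f (c * x) / f x) \<longlongrightarrow> c powr r) (at_right 0))}"

definition running_sup :: "(real \<Rightarrow> 'a \<Rightarrow> real) \<Rightarrow> real \<Rightarrow> 'a \<Rightarrow> real" where
  "running_sup X t \<omega> = (SUP s\<in>{0..t}. X s \<omega>)"

(* Paths are cadlag only almost surely, so the event need not lie in sets M when M is
   not complete; it always lies in the completion of M. *)
definition prob_running_sup_le :: "'a measure \<Rightarrow> (real \<Rightarrow> 'a \<Rightarrow> real) \<Rightarrow> real \<Rightarrow> real \<Rightarrow> real" where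
  "prob_running_sup_le M X t x = measure (completion M) {\<omega> \<in> space M. running_sup X t \<omega> \<le> x}"

end

theory Submission
  imports Defs "HOL-Real_Asymp.Real_Asymp"
begin

text \<open>A slowly varying factor may absorb any \<open>x\<^sup>o\<^sup>(\<^sup>1\<^sup>)\<close>, so it suffices to show that the supremum is at
  most \<open>x\<close> with probability \<open>x\<^sup>\<alpha>\<^sup>\<rho>\<^sup>+\<^sup>o\<^sup>(\<^sup>1\<^sup>)\<close>. On a grid of mesh \<open>1 / N\<close> the process is a random walk \<open>S\<close>, and
  Spitzer's identity amounts to the recursion \<open>n a\<^sub>n = (\<Sum>k=1..n. c\<^sub>k a\<^bsub>n-k\<^esub>)\<close> for the Laplace transforms
  \<open>a\<^sub>n\<close> and \<open>c\<^sub>k\<close> at \<open>\<theta>\<close> of \<open>max {0, S\<^sub>1, \<dots>, S\<^sub>n}\<close> and \<open>max 0 S\<^sub>k\<close>. For \<open>\<theta> \<approx> 1 / x\<close> and times between \<open>x\<^sup>\<alpha>\<close> and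
  a constant \<open>c\<^sub>k\<close> is close to \<open>1 - \<rho>\<close>; hence over this range \<open>a\<^sub>n\<close> decays like the power \<open>-\<rho>\<close> of time,
  uniformly in \<open>N\<close>, which yields \<open>x\<^sup>\<alpha>\<^sup>\<rho>\<close>. For \<open>\<rho> = 1\<close> the lower bound comes from another strategy: the
  process stays below \<open>x\<close> up to a time \<open>t \<approx> x\<^sup>\<alpha>\<close> and then is at a level \<open>-t\<^sup>\<delta>\<close>. Unless \<open>X\<close> is a subordinator
  that level is reached with probability of order \<open>t\<close> at least, as otherwise the downward steps of the
  walk would be too small for it to descend at all.\<close>

section \<open>Random walks as iterated transfer operators\<close>

text \<open>The recursion closes only for weights that are multiplicative on the half-line, so
  exponentials replace the indicator of staying below \<open>x\<close>. The upper bound takes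
  \<open>\<theta> = 1 / x\<close> and loses a constant factor. The lower bound takes
  \<open>\<theta> = x powr - (1 + \<delta>)\<close>: the error of the comparison is then smaller
  than every power of \<open>x\<close>, at the price of a small change of the exponent. Attraction
  controls the law of \<open>X t\<close> for small \<open>t\<close> only, so the recursion is run up
  to a fixed time \<open>1 / m\<close>. For the upper bound the remaining time is dropped. For the
  lower bound the process is required to be below a fixed level at time \<open>1 / m\<close>; this
  event and a low maximum are positively correlated, so only a constant is lost. If \<rho> = 1, the
  lower bound for \<open>c\<^sub>k\<close> degenerates to 0. The other strategy then bounds the
  probability \<open>p x\<close> from below by \<open>x powr \<beta> * p (x powr \<eta>)\<close>
  with \<beta> > \<alpha>; upon iteration the exponents add up to
  \<open>\<beta> / (1 - \<eta>)\<close>, which can be made arbitrarily close to \<alpha>.\<close>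

definition test_functions :: "(real \<Rightarrow> real) set" where
  "test_functions = {g. g \<in> borel_measurable borel \<and> (\<forall>x. 0 \<le> g x \<and> g x \<le> 1)}"

lemma test_functionsD:
  assumes "g \<in> test_functions"
  shows "g \<in> borel_measurable borel" "0 \<le> g x" "g x \<le> 1" "\<bar>g x\<bar> \<le> 1"
  using assms by (auto simp: test_functions_def abs_le_iff order_trans[of "- 1" 0])

lemma shift_test_functions: "g \<in> test_functions \<Longrightarrow> (\<lambda>u. g (s + u)) \<in> test_functions"
  by (auto simp: test_functions_def)

lemma mult_test_functions:
  "f \<in> test_functions \<Longrightarrow> g \<in> test_functions \<Longrightarrow> (\<lambda>u. f u * g u) \<in> test_functions"
  by (auto simp: test_functions_def intro!: borel_measurable_times mult_le_one)

lemma const_test_functions [simp]: "0 \<le> c \<Longrightarrow> c \<le> 1 \<Longrightarrow> (\<lambda>_. c) \<in> test_functions"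
  by (simp add: test_functions_def)

lemma indicator_test_functions [simp]:
  "A \<in> sets borel \<Longrightarrow> indicat_real A \<in> test_functions"
  by (simp add: test_functions_def indicator_def)

lemma antimono_indicator_atMost [simp]: "antimono (indicat_real {..a::real})"
  by (auto simp: antimono_def indicator_def)

lemma antimono_const [simp]: "antimono (\<lambda>_. c)"
  by (auto simp: antimono_def)

lemma (in prob_space) integrable_unit_bounded:
  fixes f :: "'a \<Rightarrow> real"
  assumes "f \<in> borel_measurable M" "\<And>x. 0 \<le> f x" "\<And>x. f x \<le> 1"
  shows "integrable M f"
  by (rule integrable_const_bound[where B = 1]) (use assms in auto)

lemma (in prob_space) integral_unit_bounded:
  fixes f :: "'a \<Rightarrow> real"
  assumes "f \<in> borel_measurable M" "\<And>x. 0 \<le> f x" "\<And>x. f x \<le> 1"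
  shows "0 \<le> integral\<^sup>L M f" "integral\<^sup>L M f \<le> 1"
proof -
  show "0 \<le> integral\<^sup>L M f" by (intro integral_nonneg_AE AE_I2 assms)
  have "integral\<^sup>L M f \<le> (\<integral>x. 1 \<partial>M)"
    by (rule integral_mono) (auto intro: integrable_unit_bounded assms)
  then show "integral\<^sup>L M f \<le> 1" by (simp add: prob_space)
qed

text \<open>Chebyshev's association inequality: integrate
  \<open>(f x - f y) * (g x - g y) \<ge> 0\<close> over two independent copies.\<close>

lemma antimono_association:
  assumes "prob_space F" "sets F = sets borel"
    and f: "f \<in> test_functions" "antimono f" and g: "g \<in> test_functions" "antimono g"
  shows "(\<integral>x. f x \<partial>F) * (\<integral>x. g x \<partial>F) \<le> (\<integral>x. f x * g x \<partial>F)"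
proof -
  interpret prob_space F by fact
  note [measurable_cong] = assms(2)
  note [measurable] = f(1) g(1)
  have int: "integrable F f" "integrable F g" "integrable F (\<lambda>x. f x * g x)"
    by (rule integrable_unit_bounded; use test_functionsD[OF f(1)] test_functionsD[OF g(1)] in
      \<open>auto intro: mult_le_one\<close>)+
  have nn: "0 \<le> (f x - f y) * (g x - g y)" for x y
    using f(2) g(2) by (cases "x \<le> y") (auto simp: antimono_def mult_nonneg_nonneg mult_nonpos_nonpos)
  have "0 \<le> (\<integral>y. (\<integral>x. (f x - f y) * (g x - g y) \<partial>F) \<partial>F)"
    by (intro integral_nonneg_AE AE_I2 nn)
  also have "\<dots> = (\<integral>y. (\<integral>x. f x * g x \<partial>F) - g y * (\<integral>x. f x \<partial>F) - f y * (\<integral>x. g x \<partial>F) + f y * g y \<partial>F)"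
  proof (rule Bochner_Integration.integral_cong[OF refl])
    fix y
    have "(\<integral>x. (f x - f y) * (g x - g y) \<partial>F) =
        (\<integral>x. f x * g x - g y * f x - f y * g x + f y * g y \<partial>F)"
      by (simp add: algebra_simps)
    also have "\<dots> = (\<integral>x. f x * g x \<partial>F) - g y * (\<integral>x. f x \<partial>F) - f y * (\<integral>x. g x \<partial>F) + f y * g y"
      using int by (simp add: prob_space)
    finally show "(\<integral>x. (f x - f y) * (g x - g y) \<partial>F) = \<dots>" .
  qed
  also have "\<dots> = 2 * (\<integral>x. f x * g x \<partial>F) - 2 * ((\<integral>x. f x \<partial>F) * (\<integral>x. g x \<partial>F))"
    using int by (simp add: prob_space)
  finally show ?thesis by simp
qed

lemma swap_integrals:
  fixes f :: "'a \<Rightarrow> 'b \<Rightarrow> real"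
  assumes "prob_space A" "prob_space B"
    and m: "case_prod f \<in> borel_measurable (A \<Otimes>\<^sub>M B)"
    and b: "\<And>x y. 0 \<le> f x y" "\<And>x y. f x y \<le> 1"
  shows "(\<integral>x. (\<integral>y. f x y \<partial>B) \<partial>A) = (\<integral>y. (\<integral>x. f x y \<partial>A) \<partial>B)"
proof -
  interpret A: prob_space A by fact
  interpret B: prob_space B by fact
  interpret P: pair_prob_space A B ..
  show ?thesis
    by (rule P.Fubini_integral[symmetric], rule P.integrable_unit_bounded[OF m])
      (use b in \<open>auto simp: case_prod_beta\<close>)
qed

text \<open>A Feynman-Kac operator: \<open>(transfer F w ^^ n) g s\<close> is the expectation of the
  product of \<open>w (s + S\<^sub>1)\<close>, ..., \<open>w (s + S\<^sub>n)\<close> and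
  \<open>g (s + S\<^sub>n)\<close> for the walk with step law \<open>F\<close>. The weight is read
  off after the step, so the starting point itself is not weighted.\<close>

definition transfer :: "real measure \<Rightarrow> (real \<Rightarrow> real) \<Rightarrow> (real \<Rightarrow> real) \<Rightarrow> real \<Rightarrow> real" where
  "transfer F w g s = (\<integral>u. w (s + u) * g (s + u) \<partial>F)"

locale step_law = prob_space F for F :: "real measure" +
  assumes sets_F [measurable_cong, simp]: "sets F = sets borel"
begin

lemma space_F [simp]: "space F = UNIV"
  using sets_eq_imp_space_eq[OF sets_F] by simp

lemma prob_UNIV [simp]: "prob UNIV = 1"
  using prob_space by simp

lemma integrable_test_function: "g \<in> test_functions \<Longrightarrow> integrable F g"
  using sets_F by (intro integrable_unit_bounded)
    (auto simp: test_functions_def cong: measurable_cong_sets)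

lemma integrable_test:
  assumes "w \<in> test_functions" "g \<in> test_functions"
  shows "integrable F (\<lambda>u. w (s + u) * g (s + u))" "integrable F (\<lambda>u. g (s + u))"
  using integrable_test_function[OF mult_test_functions[OF shift_test_functions[OF assms(1)] shift_test_functions[OF assms(2)]]]
    integrable_test_function[OF shift_test_functions[OF assms(2)]] by auto

lemma transfer_test:
  assumes "w \<in> test_functions" "g \<in> test_functions"
  shows "transfer F w g \<in> test_functions"
proof -
  note [measurable] = test_functionsD(1)[OF assms(1)] test_functionsD(1)[OF assms(2)]
  have "0 \<le> transfer F w g s \<and> transfer F w g s \<le> 1" for s
    using mult_test_functions[OF shift_test_functions[OF assms(1)] shift_test_functions[OF assms(2)], of s s]
    unfolding transfer_def
    by (intro conjI integral_unit_bounded; simp add: test_functions_def)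
  moreover have "(\<lambda>s. \<integral>u. w (s + u) * g (s + u) \<partial>F) \<in> borel_measurable borel"
    by measurable
  then have "transfer F w g \<in> borel_measurable borel"
    by (simp add: transfer_def[abs_def])
  ultimately show ?thesis by (simp add: test_functions_def)
qed

lemma transfer_pow_test:
  assumes "w \<in> test_functions" "g \<in> test_functions"
  shows "(transfer F w ^^ n) g \<in> test_functions"
  by (induction n) (use assms in \<open>auto intro: transfer_test\<close>)

lemma transfer_mono:
  assumes "w \<in> test_functions" "w' \<in> test_functions" "g \<in> test_functions" "g' \<in> test_functions"
    and "\<And>u. w (s + u) * g (s + u) \<le> w' (t + u) * g' (t + u)"
  shows "transfer F w g s \<le> transfer F w' g' t"
  unfolding transfer_def using assms by (intro integral_mono integrable_test) auto

lemma transfer_pow_mono: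
  assumes "w \<in> test_functions" "g \<in> test_functions" "g' \<in> test_functions"
    and "\<And>s. g s \<le> g' s"
  shows "(transfer F w ^^ n) g s \<le> (transfer F w ^^ n) g' s"
proof (induction n arbitrary: s)
  case (Suc n)
  then show ?case
    using assms by (simp, intro transfer_mono transfer_pow_test) (auto intro: mult_left_mono test_functionsD)
qed (use assms in auto)

lemma transfer_pow_weight_mono:
  assumes "w \<in> test_functions" "w' \<in> test_functions" "g \<in> test_functions"
    and "\<And>s. w s \<le> w' s"
  shows "(transfer F w ^^ n) g s \<le> (transfer F w' ^^ n) g s"
proof (induction n arbitrary: s)
  case (Suc n)
  then show ?case
    using assms test_functionsD[OF transfer_pow_test[OF assms(1,3)]]
    by (simp, intro transfer_mono transfer_pow_test)
      (auto intro!: mult_mono intro: test_functionsD)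
qed (use assms in auto)

lemma antimono_mult_test:
  assumes "w \<in> test_functions" "g \<in> test_functions" "antimono w" "antimono g"
  shows "(\<lambda>u. w (s + u) * g (s + u)) \<in> test_functions" "antimono (\<lambda>u. w (s + u) * g (s + u))"
proof -
  show "(\<lambda>u. w (s + u) * g (s + u)) \<in> test_functions"
    by (rule mult_test_functions[OF shift_test_functions[OF assms(1)] shift_test_functions[OF assms(2)]])
  show "antimono (\<lambda>u. w (s + u) * g (s + u))"
    using test_functionsD[OF assms(1)] test_functionsD[OF assms(2)] assms(3,4)
    by (auto simp: antimono_def intro!: mult_mono)
qed

lemma transfer_antimono:
  assumes "w \<in> test_functions" "g \<in> test_functions" "antimono w" "antimono g"
  shows "antimono (transfer F w g)"
proof (rule antimonoI)
  fix s t :: real assume "s \<le> t"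
  then show "transfer F w g t \<le> transfer F w g s"
    unfolding transfer_def using assms test_functionsD[OF assms(1)] test_functionsD[OF assms(2)]
    by (intro integral_mono integrable_test) (auto simp: antimono_def intro!: mult_mono)
qed

lemma transfer_pow_antimono:
  assumes "w \<in> test_functions" "g \<in> test_functions" "antimono w" "antimono g"
  shows "antimono ((transfer F w ^^ n) g)"
  by (induction n) (use assms in \<open>auto intro!: transfer_antimono transfer_pow_test\<close>)

lemma transfer_pow_antimono_step:
  assumes "w \<in> test_functions" "g \<in> test_functions" "\<And>s. transfer F w g s \<le> g s"
  shows "antimono (\<lambda>n. (transfer F w ^^ n) g s)"
proof (rule decseq_SucI)
  fix n
  show "(transfer F w ^^ Suc n) g s \<le> (transfer F w ^^ n) g s"
    unfolding funpow_Suc_right o_apply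
    using assms by (intro transfer_pow_mono transfer_test) auto
qed

lemma transfer_pow_one_antimono:
  assumes "w \<in> test_functions"
  shows "antimono (\<lambda>n. (transfer F w ^^ n) (\<lambda>_. 1) s)"
  using assms test_functionsD(3)[OF transfer_test[OF assms const_test_functions]]
  by (intro transfer_pow_antimono_step) auto

text \<open>For decreasing \<open>w\<close> and \<open>g\<close> both the weight and the final value
  decrease in every step of the walk, so they are positively correlated; the association inequality
  is applied to one step at a time. It separates the constraint on the path from the position at its
  end.\<close>

lemma harris_inequality:
  assumes "w \<in> test_functions" "g \<in> test_functions" "antimono w" "antimono g"
  shows "(transfer F w ^^ n) (\<lambda>_. 1) s * (transfer F (\<lambda>_. 1) ^^ n) g s \<le> (transfer F w ^^ n) g s"
proof (induction n arbitrary: s)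
  case (Suc n)
  define a b where "a = (transfer F w ^^ n) (\<lambda>_. 1)" and "b = (transfer F (\<lambda>_. 1) ^^ n) g"
  have ab: "a \<in> test_functions" "antimono a" "b \<in> test_functions" "antimono b"
    unfolding a_def b_def using assms by (auto intro!: transfer_pow_test transfer_pow_antimono)
  have "transfer F w a s * transfer F (\<lambda>_. 1) b s \<le>
      (\<integral>u. (w (s + u) * a (s + u)) * (1 * b (s + u)) \<partial>F)"
    unfolding transfer_def
    by (rule antimono_association) (use assms ab antimono_mult_test[of "\<lambda>_. 1" b] in
      \<open>auto intro!: antimono_mult_test prob_space_axioms\<close>)
  also have "\<dots> \<le> (\<integral>u. w (s + u) * (transfer F w ^^ n) g (s + u) \<partial>F)"
  proof (rule integral_mono)
    show "integrable F (\<lambda>u. w (s + u) * a (s + u) * (1 * b (s + u)))"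
      using assms(1) ab(1,3)
      using integrable_test_function[OF mult_test_functions[OF mult_test_functions[OF
        shift_test_functions[OF assms(1)] shift_test_functions[OF ab(1)]] shift_test_functions[OF ab(3)]]]
      by simp
    show "integrable F (\<lambda>u. w (s + u) * (transfer F w ^^ n) g (s + u))"
      using assms by (intro integrable_test transfer_pow_test)
    show "w (s + u) * a (s + u) * (1 * b (s + u)) \<le> w (s + u) * (transfer F w ^^ n) g (s + u)" for u
      using Suc.IH[of "s + u"] test_functionsD[OF assms(1)]
      by (simp add: a_def b_def mult.assoc mult_left_mono)
  qed
  also have "\<dots> = transfer F w ((transfer F w ^^ n) g) s"
    by (simp only: transfer_def)
  finally show ?case by (simp add: a_def b_def)
qed (use assms test_functionsD in auto)

text \<open>First passage above \<open>2 * x\<close>: from there the rest of the walk falls by at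
  most \<open>x\<close> with probability at least \<open>b\<close>, and then ends above
  \<open>x\<close>. The induction peels off the first step, hence the arbitrary starting point
  \<open>s\<close>.\<close>

lemma ottaviani_inequality:
  assumes b: "\<And>j. j \<le> n \<Longrightarrow> b \<le> (transfer F (\<lambda>_. 1) ^^ j) (indicat_real {-x..}) 0" and "0 \<le> b"
    and "j \<le> n"
  shows "b * (1 - (transfer F (indicat_real {..2*x}) ^^ j) (\<lambda>_. 1) s)
    \<le> (transfer F (\<lambda>_. 1) ^^ j) (indicat_real {x<..}) s"
  using \<open>j \<le> n\<close>
proof (induction j arbitrary: s)
  case 0
  then show ?case by simp
next
  case (Suc j)
  let ?A = "(transfer F (indicat_real {..2*x}) ^^ j) (\<lambda>_. 1)"
  let ?T = "(transfer F (\<lambda>_. 1) ^^ j) (indicat_real {x<..})"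
  have shift: "(transfer F (\<lambda>_. 1) ^^ j) (indicat_real {-x..}) 0 \<le> ?T s'" if "2 * x < s'" for s'
  proof -
    have "(transfer F (\<lambda>_. 1) ^^ j) (indicat_real {-x..}) r \<le> ?T (r + s')" for r
    proof (induction j arbitrary: r)
      case 0 then show ?case using that by (auto simp: indicator_def)
    next
      case (Suc j)
      have "(transfer F (\<lambda>_. 1) ^^ j) (indicat_real {-x..}) (r + u)
          \<le> (transfer F (\<lambda>_. 1) ^^ j) (indicat_real {x<..}) (r + s' + u)" for u
        using Suc[of "r + u"] by (simp add: ac_simps)
      then show ?case
        by (simp, intro transfer_mono transfer_pow_test) auto
    qed
    from this[of 0] show ?thesis by simp
  qed
  have pt: "b * (1 - indicat_real {..2*x} s' * ?A s') \<le> ?T s'" for s'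
    using shift[of s'] b[of j] Suc by (cases "s' \<le> 2 * x") auto
  have int: "integrable F (\<lambda>u. indicat_real {..2*x} (s + u) * ?A (s + u))"
    by (intro integrable_test transfer_pow_test) auto
  have "b * (1 - transfer F (indicat_real {..2*x}) ?A s) =
     (\<integral>u. b * (1 - indicat_real {..2*x} (s + u) * ?A (s + u)) \<partial>F)"
    using int by (simp add: transfer_def prob_space)
  also have "\<dots> \<le> (\<integral>u. ?T (s + u) \<partial>F)"
  proof (rule integral_mono)
    show "integrable F (\<lambda>u. ?T (s + u))"
      by (rule integrable_test(2)[where w = "\<lambda>_. 1"]) (auto intro!: transfer_pow_test)
  qed (use int pt in auto)
  also have "\<dots> = transfer F (\<lambda>_. 1) ?T s"
    by (simp add: transfer_def)
  finally show ?case by simp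
qed

end

section \<open>Spitzer's identity\<close>

text \<open>The recursion \<open>n a\<^sub>n = (\<Sum>k=1..n. c\<^sub>k a\<^bsub>n-k\<^esub>)\<close> is what Spitzer's identity says about the
  coefficients of \<open>exp (\<Sum>k. c\<^sub>k z\<^sup>k / k)\<close>; a decreasing solution behaves like \<open>n\<close> to the power
  \<open>c - 1\<close> when the \<open>c\<^sub>k\<close> are close to \<open>c\<close>.\<close>

locale spitzer_recursion =
  fixes a c :: "nat \<Rightarrow> real"
  assumes a0: "a 0 = 1" and a_nonneg: "\<And>n. 0 \<le> a n" and a_decseq: "decseq a"
    and c_le1: "\<And>k. c k \<le> 1"
    and rec: "\<And>n. real n * a n = (\<Sum>k=1..n. c k * a (n - k))"
begin

definition psum :: "nat \<Rightarrow> real" where "psum n = (\<Sum>j<n. a j)"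

lemma psum_Suc: "psum (Suc n) = psum n + a n"
  by (simp add: psum_def)

lemma a_le1: "a n \<le> 1"
  using a_decseq a0 by (metis decseqD le0)

lemma psum_nonneg: "0 \<le> psum n"
  by (simp add: psum_def sum_nonneg a_nonneg)

lemma mult_a_le_psum: "real n * a n \<le> psum n"
proof -
  have "(\<Sum>j<n. a n) \<le> psum n"
    unfolding psum_def using a_decseq by (intro sum_mono) (auto simp: decseq_def)
  then show ?thesis by simp
qed

lemma psum_le: "psum n \<le> real n"
proof -
  have "psum n \<le> (\<Sum>j<n. 1)" unfolding psum_def by (intro sum_mono a_le1)
  then show ?thesis by simp
qed

lemma sum_shift: "(\<Sum>k=1..n. a (n - k)) = psum n"
  unfolding psum_def
  by (rule sum.reindex_bij_witness[of _ "\<lambda>j. n - j" "\<lambda>k. n - k"]) auto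

text \<open>With \<open>c k \<ge> p\<close> the recursion gives
  \<open>p * psum j \<le> real j * a j\<close>, so \<open>psum\<close> gains a factor of at least
  \<open>1 + p / j\<close> at each step and grows at least like \<open>j powr p\<close>. The same
  inequality turns this back into a bound for \<open>a n\<close>; monotonicity of \<open>a\<close>
  enters through \<open>real k0 * a k0 \<le> psum k0\<close>.\<close>

lemma lower_bound:
  assumes c: "\<And>k. 1 \<le> k \<Longrightarrow> k \<le> n \<Longrightarrow> p \<le> c k" and p: "0 \<le> p" "p \<le> 1"
    and k: "1 \<le> k0" "k0 \<le> n"
  shows "p * (real k0 / real n) powr (1 - p) * a k0 \<le> a n"
proof -
  have step: "p * psum j \<le> real j * a j" if "j \<le> n" for j
  proof -
    have "p * psum j = (\<Sum>k=1..j. p * a (j - k))"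
      by (simp add: sum_distrib_left flip: sum_shift)
    also have "\<dots> \<le> (\<Sum>k=1..j. c k * a (j - k))"
      using that by (intro sum_mono mult_right_mono c a_nonneg) auto
    finally show ?thesis by (simp add: rec)
  qed
  have grow: "psum k0 * (real j / real k0) powr p \<le> psum j" if "k0 \<le> j" "j \<le> n" for j
    using that
  proof (induction j rule: dec_induct)
    case base
    then show ?case using k by simp
  next
    case (step j)
    have j: "0 < real j" using step k by simp
    have "psum k0 * (real (Suc j) / real k0) powr p
        = psum k0 * (real j / real k0) powr p * (real (Suc j) / real j) powr p"
      using j k by (simp add: powr_divide powr_mult)
    also have "\<dots> \<le> psum j * (1 + p / real j)"
    proof (rule mult_mono)
      \<comment> \<open>Bernoulli's inequality for an exponent in [0, 1], as the weighted AM-GM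
        inequality for \<open>1 + 1 / j\<close> and 1.\<close>
      have "(1 + 1 / real j) powr p \<le> 1 + p * (1 / real j)"
        using Youngs_inequality_0[of p "1 - p" "1 + 1 / real j" 1] p j
        by (simp add: algebra_simps add_pos_pos)
      then show "(real (Suc j) / real j) powr p \<le> 1 + p / real j"
        using j by (simp add: field_simps)
    qed (use step psum_nonneg in auto)
    also have "\<dots> = psum j + p * psum j / real j"
      by (simp add: algebra_simps)
    also have "\<dots> \<le> psum (Suc j)"
      using \<open>\<And>j. j \<le> n \<Longrightarrow> p * psum j \<le> real j * a j\<close>[of j] step j by (simp add: psum_Suc field_simps)
    finally show ?case .
  qed
  have n: "0 < real n" using k by simp
  have "p * (real k0 / real n) powr (1 - p) * a k0
      = p * ((real k0 * a k0) * (real n / real k0) powr p) / real n"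
    using n k by (simp add: powr_diff powr_divide field_simps)
  also have "\<dots> \<le> p * (psum k0 * (real n / real k0) powr p) / real n"
    using p n by (intro divide_right_mono mult_left_mono mult_right_mono mult_a_le_psum) auto
  also have "\<dots> \<le> p * psum n / real n"
    using grow[of n] k p n by (intro divide_right_mono mult_left_mono) auto
  also have "\<dots> \<le> a n"
    using step[of n] n by (simp add: field_simps)
  finally show ?thesis .
qed

text \<open>The bound on \<open>c k\<close> is available only from \<open>k0\<close> on. For
  \<open>j \<ge> n1\<close> the earlier terms add up to at most \<open>k0 * a (j - k0)\<close>,
  which by the choice of \<open>n1\<close> is at most
  \<open>d * (j - k0) * a (j - k0) \<le> d * psum j\<close>; they merely replace \<open>p\<close> by
  \<open>p + d\<close>. For \<open>n < n1\<close> the right-hand side exceeds 1.\<close>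

lemma upper_bound:
  assumes c: "\<And>k. k0 \<le> k \<Longrightarrow> k \<le> n \<Longrightarrow> c k \<le> p" and p: "0 \<le> p"
    and d: "0 < d" "p + d \<le> 1" and n1: "2 \<le> n1" "real k0 * (1 + 1 / d) \<le> real n1" and n: "1 \<le> n"
  shows "a n \<le> 2 * (real n1 / real n) powr (1 - (p + d))"
proof (cases "n1 \<le> n")
  case False
  then have "1 \<le> (real n1 / real n) powr (1 - (p + d))"
    using n d by (intro ge_one_powr_ge_zero) auto
  then show ?thesis using a_le1[of n] by linarith
next
  case True
  have k0n: "real k0 \<le> d * (real j - real k0)" if "n1 \<le> j" for j
  proof -
    have "real k0 * (1 + 1 / d) \<le> real j" using n1 that by linarith
    then show ?thesis using d by (simp add: field_simps)
  qed
  have step: "real j * a j \<le> (p + d) * psum j" if j: "n1 \<le> j" "j \<le> n" for j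
  proof (cases "k0 = 0")
    case True
    have "(\<Sum>k=1..j. c k * a (j - k)) \<le> (\<Sum>k=1..j. p * a (j - k))"
      using that True by (intro sum_mono mult_right_mono c a_nonneg) auto
    then have "real j * a j \<le> p * psum j"
      by (simp add: rec flip: sum_shift sum_distrib_left)
    then show ?thesis using d psum_nonneg[of j] by (simp add: distrib_right add_increasing2)
  next
    case False
    have "real k0 \<le> d * (real j - real k0)" by (rule k0n) fact
    then have kj: "k0 < j" using d False
      by (metis diff_ge_0_iff_ge diff_gt_0_iff_gt less_le_trans mult_pos_pos not_le of_nat_0_less_iff
          of_nat_less_iff neq0_conv zero_less_mult_pos)
    have "(\<Sum>k=1..j. c k * a (j - k)) \<le> (\<Sum>k=1..j. p * a (j - k) + (if k < k0 then a (j - k0) else 0))"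
    proof (rule sum_mono)
      fix k assume k: "k \<in> {1..j}"
      show "c k * a (j - k) \<le> p * a (j - k) + (if k < k0 then a (j - k0) else 0)"
      proof (cases "k < k0")
        case True
        have "c k * a (j - k) \<le> 1 * a (j - k0)"
          using True a_decseq kj by (intro mult_mono c_le1 a_nonneg) (auto simp: decseq_def a_nonneg)
        then show ?thesis using True mult_nonneg_nonneg[OF p a_nonneg[of "j - k"]] by simp
      next
        case False
        then show ?thesis using c[of k] k j a_nonneg[of "j - k"] by (auto intro: mult_right_mono)
      qed
    qed
    also have "\<dots> = p * psum j + (\<Sum>k\<in>{1..j} \<inter> {k. k < k0}. a (j - k0))"
      by (simp add: sum.distrib sum.If_cases flip: sum_shift sum_distrib_left)
    also have "(\<Sum>k\<in>{1..j} \<inter> {k. k < k0}. a (j - k0)) \<le> real k0 * a (j - k0)"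
    proof -
      have "card ({1..j} \<inter> {k. k < k0}) \<le> card {..<k0}"
        by (rule card_mono) auto
      then show ?thesis using a_nonneg[of "j - k0"] by (auto intro: mult_right_mono)
    qed
    also have "\<dots> \<le> d * (real (j - k0) * a (j - k0))"
      using k0n[of j] j kj a_nonneg[of "j - k0"]
      by (simp add: of_nat_diff mult_right_mono mult.assoc[symmetric])
    also have "\<dots> \<le> d * psum (j - k0)"
      using d mult_a_le_psum[of "j - k0"] by simp
    also have "\<dots> \<le> d * psum j"
      using d unfolding psum_def by (intro mult_left_mono sum_mono2) (auto simp: a_nonneg)
    finally show ?thesis by (simp add: rec distrib_right)
  qed
  \<comment> \<open>The shift by one makes the factors telescope: \<open>1 + (p + d) / j\<close> is
    at most \<open>(j / (j - 1)) powr (p + d)\<close>. The hypothesis \<open>2 \<le> n1\<close>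
    keeps \<open>n1 - 1\<close> positive.\<close>
  have grow: "psum j \<le> real n1 * ((real j - 1) / (real n1 - 1)) powr (p + d)" if "n1 \<le> j" "j \<le> n" for j
    using that
  proof (induction j rule: dec_induct)
    case base
    then show ?case using n1 psum_le[of n1] by simp
  next
    case (step j)
    have j: "1 < real j" using step n1 by simp
    have "psum (Suc j) \<le> psum j * (1 + (p + d) / real j)"
      using \<open>\<And>j. n1 \<le> j \<Longrightarrow> j \<le> n \<Longrightarrow> real j * a j \<le> (p + d) * psum j\<close>[of j] step j
      by (simp add: psum_Suc field_simps)
    also have "\<dots> \<le> (real n1 * ((real j - 1) / (real n1 - 1)) powr (p + d)) * (real j / (real j - 1)) powr (p + d)"
    proof (rule mult_mono)
      have "1 / real j \<le> ln (real j / (real j - 1))"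
        using ln_le_minus_one[of "(real j - 1) / real j"] j by (simp add: ln_div field_simps)
      then have "(p + d) * (1 / real j) \<le> (p + d) * ln (real j / (real j - 1))"
        using p d by (intro mult_left_mono) auto
      then have "exp ((p + d) / real j) \<le> (real j / (real j - 1)) powr (p + d)"
        using j by (simp add: powr_def)
      then show "1 + (p + d) / real j \<le> (real j / (real j - 1)) powr (p + d)"
        using exp_ge_add_one_self[of "(p + d) / real j"] by linarith
    qed (use step p d j in auto)
    also have "\<dots> = real n1 * ((real (Suc j) - 1) / (real n1 - 1)) powr (p + d)"
      using j n1 by (simp add: powr_divide)
    finally show ?case .
  qed
  have n1': "1 < real n1" "1 < real n" using n1 True by auto
  have "a n \<le> psum n / real n"
    using mult_a_le_psum[of n] n by (simp add: field_simps)
  also have "\<dots> \<le> real n1 * ((real n - 1) / (real n1 - 1)) powr (p + d) / real n"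
    using grow[of n] True by (intro divide_right_mono) auto
  \<comment> \<open>Replacing \<open>n1 - 1\<close> by \<open>n1 / 2\<close> produces the factor 2
    of the statement.\<close>
  also have "((real n - 1) / (real n1 - 1)) powr (p + d) \<le> (2 * (real n / real n1)) powr (p + d)"
  proof (rule powr_mono2)
    have "(real n - 1) / (real n1 - 1) \<le> real n / (real n1 / 2)"
      using n1 n1' by (intro frac_le) auto
    then show "(real n - 1) / (real n1 - 1) \<le> 2 * (real n / real n1)" by (simp add: mult.commute)
  qed (use p d n1' in auto)
  also have "\<dots> = 2 powr (p + d) * (real n / real n1) powr (p + d)"
    by (rule powr_mult)
  also have "\<dots> \<le> 2 powr 1 * (real n / real n1) powr (p + d)"
    using d by (intro mult_right_mono powr_mono) auto
  finally show ?thesis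
    using n1' by (simp add: powr_diff powr_divide divide_right_mono mult_left_mono field_simps)
qed

end

section \<open>Laws of the running maximum and of the sum, and Spitzer's identity for them\<close>

lemma real_measurable_cong:
  "sets M = sets borel \<Longrightarrow> borel_measurable M = borel_measurable borel"
  by (rule measurable_cong_sets) auto

lemma integral_real_unit_bounded:
  fixes g :: "real \<Rightarrow> real"
  assumes "prob_space M" "sets M = sets borel" "g \<in> test_functions"
  shows "integrable M g" "0 \<le> integral\<^sup>L M g" "integral\<^sup>L M g \<le> 1"
proof -
  interpret prob_space M by fact
  show "integrable M g" "0 \<le> integral\<^sup>L M g" "integral\<^sup>L M g \<le> 1"
    using assms(2,3) real_measurable_cong[OF assms(2)]
    by (auto simp: test_functions_def intro!: integrable_unit_bounded integral_unit_bounded)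
qed

context step_law
begin

text \<open>\<open>wmax n\<close> is the law of \<open>max {0, S\<^sub>1, \<dots>, S\<^sub>n}\<close>, which by reversal of the steps satisfies
  Lindley's recursion; \<open>wsum n\<close> is the law of \<open>S\<^sub>n\<close>.\<close>

primrec wmax :: "nat \<Rightarrow> real measure" where
  "wmax 0 = return borel 0"
| "wmax (Suc n) = distr (wmax n \<Otimes>\<^sub>M F) borel (\<lambda>(x, u). max 0 (x + u))"

primrec wsum :: "nat \<Rightarrow> real measure" where
  "wsum 0 = return borel 0"
| "wsum (Suc n) = distr (wsum n \<Otimes>\<^sub>M F) borel (\<lambda>(x, u). x + u)"

lemma sets_wmax [simp, measurable_cong]: "sets (wmax n) = sets borel"
  by (cases n) auto

lemma sets_wsum [simp, measurable_cong]: "sets (wsum n) = sets borel"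
  by (cases n) auto

lemma prob_space_wmax: "prob_space (wmax n)"
proof (induction n)
  case (Suc n)
  interpret A: prob_space "wmax n" by fact
  interpret pair_prob_space "wmax n" F ..
  show ?case unfolding wmax.simps by (rule prob_space_distr) measurable
qed (simp add: prob_space_return)

lemma prob_space_wsum: "prob_space (wsum n)"
proof (induction n)
  case (Suc n)
  interpret A: prob_space "wsum n" by fact
  interpret pair_prob_space "wsum n" F ..
  show ?case unfolding wsum.simps by (rule prob_space_distr) measurable
qed (simp add: prob_space_return)

lemma integral_wmax_Suc:
  assumes "g \<in> test_functions"
  shows "(\<integral>x. g x \<partial>wmax (Suc n)) = (\<integral>x. (\<integral>u. g (max 0 (x + u)) \<partial>F) \<partial>wmax n)"
proof -
  interpret A: prob_space "wmax n" by (rule prob_space_wmax)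
  interpret P: pair_prob_space "wmax n" F ..
  note [measurable] = test_functionsD(1)[OF assms]
  have "(\<integral>x. g x \<partial>wmax (Suc n)) = (\<integral>p. g (max 0 (fst p + snd p)) \<partial>(wmax n \<Otimes>\<^sub>M F))"
    by (simp add: integral_distr case_prod_beta)
  also have "\<dots> = (\<integral>x. (\<integral>u. g (max 0 (x + u)) \<partial>F) \<partial>wmax n)"
    by (subst P.integral_fst'[symmetric])
      (auto intro!: P.integrable_unit_bounded test_functionsD[OF assms])
  finally show ?thesis .
qed

lemma integral_wsum_Suc:
  assumes "g \<in> test_functions"
  shows "(\<integral>x. g x \<partial>wsum (Suc n)) = (\<integral>x. (\<integral>u. g (x + u) \<partial>F) \<partial>wsum n)"
proof -
  interpret A: prob_space "wsum n" by (rule prob_space_wsum)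
  interpret P: pair_prob_space "wsum n" F ..
  note [measurable] = test_functionsD(1)[OF assms]
  have "(\<integral>x. g x \<partial>wsum (Suc n)) = (\<integral>p. g (fst p + snd p) \<partial>(wsum n \<Otimes>\<^sub>M F))"
    by (simp add: integral_distr case_prod_beta)
  also have "\<dots> = (\<integral>x. (\<integral>u. g (x + u) \<partial>F) \<partial>wsum n)"
    by (subst P.integral_fst'[symmetric])
      (auto intro!: P.integrable_unit_bounded test_functionsD[OF assms])
  finally show ?thesis .
qed

lemma integral_wsum:
  assumes "g \<in> test_functions"
  shows "(\<integral>x. g x \<partial>wsum n) = (transfer F (\<lambda>_. 1) ^^ n) g 0"
  using assms
proof (induction n arbitrary: g)
  case 0
  then show ?case by (simp add: integral_return test_functionsD)
next
  case (Suc n)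
  have "transfer F (\<lambda>_. 1) g = (\<lambda>x. \<integral>u. g (x + u) \<partial>F)"
    by (rule ext) (simp add: transfer_def)
  moreover have "transfer F (\<lambda>_. 1) g \<in> test_functions"
    using Suc.prems by (intro transfer_test) auto
  ultimately show ?case
    using Suc by (simp only: integral_wsum_Suc funpow_Suc_right o_apply)
qed

text \<open>Lindley's recursion acting on functions: integrating \<open>g\<close> against
  \<open>wmax (Suc n)\<close> is integrating \<open>reflected g\<close> against
  \<open>wmax n\<close>.\<close>

definition reflected :: "(real \<Rightarrow> real) \<Rightarrow> real \<Rightarrow> real" where
  "reflected g x = (\<integral>u. g (max 0 (x + u)) \<partial>F)"

lemma comp_max_test: "g \<in> test_functions \<Longrightarrow> (\<lambda>x. g (max 0 x)) \<in> test_functions"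
  by (auto simp: test_functions_def)

lemma reflected_test: "g \<in> test_functions \<Longrightarrow> reflected g \<in> test_functions"
  using transfer_test[OF const_test_functions comp_max_test, of 1 g]
  by (simp add: transfer_def[abs_def] reflected_def[abs_def])

lemma AE_wmax_nonneg: "AE x in wmax n. 0 \<le> x"
proof (induction n)
  case 0
  show ?case unfolding wmax.simps(1) by (subst AE_return) auto
next
  case (Suc n)
  show ?case unfolding wmax.simps by (subst AE_distr_iff) auto
qed

text \<open>The maximum over a longer time is stochastically larger. In terms of Lindley's
  recursion: the case \<open>n = 0\<close> holds because the reflected walk starts at its minimum 0,
  and the operator \<open>reflected\<close> preserves decreasing functions.\<close>

lemma integral_wmax_antimono:
  assumes "g \<in> test_functions" "antimono g"
  shows "decseq (\<lambda>n. \<integral>x. g x \<partial>wmax n)"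
proof (rule decseq_SucI)
  fix n
  show "(\<integral>x. g x \<partial>wmax (Suc n)) \<le> (\<integral>x. g x \<partial>wmax n)"
    using assms
  proof (induction n arbitrary: g)
    case 0
    have "reflected g 0 \<le> (\<integral>u. g 0 \<partial>F)"
      unfolding reflected_def
      using 0 integrable_test_function[OF comp_max_test[OF 0(1)]]
      by (intro integral_mono) (auto simp: antimono_def)
    moreover have "reflected g \<in> borel_measurable borel"
      by (rule test_functionsD[OF reflected_test]) fact
    ultimately show ?case
      using 0 unfolding integral_wmax_Suc[OF 0(1)] reflected_def[symmetric] wmax.simps(1)
      by (simp add: integral_return test_functionsD)
  next
    case (Suc n)
    have "antimono (reflected g)"
      unfolding antimono_def reflected_def
    proof safe
      fix x y :: real assume "x \<le> y"
      have "integrable F (\<lambda>u. g (max 0 (r + u)))" for r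
        by (rule integrable_test(2)[OF const_test_functions[of 1] comp_max_test[OF Suc.prems(1)]]) auto
      moreover have "g (max 0 (y + u)) \<le> g (max 0 (x + u))" for u
        using \<open>x \<le> y\<close> by (intro antimonoD[OF Suc.prems(2)]) auto
      ultimately show "(\<integral>u. g (max 0 (y + u)) \<partial>F) \<le> (\<integral>u. g (max 0 (x + u)) \<partial>F)"
        by (intro integral_mono) auto
    qed
    then show ?case
      using Suc.IH[of "reflected g"] Suc.prems
      unfolding integral_wmax_Suc[OF Suc.prems(1)]
      by (simp add: reflected_test flip: reflected_def)
  qed
qed

text \<open>Spitzer's identity, in the form obtained by differentiating the generating function.
  The induction uses Baxter's identity: with \<open>z\<^sup>+ = max 0 z\<close>, the multisets
  \<open>{x\<^sup>+ + v\<^sup>+, (x + v)\<^sup>+}\<close> and \<open>{(x\<^sup>+ + v)\<^sup>+, (x + v\<^sup>+)\<^sup>+}\<close> coincide.\<close>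

definition expectation2 :: "nat \<Rightarrow> nat \<Rightarrow> (real \<Rightarrow> real \<Rightarrow> real) \<Rightarrow> real" where
  "expectation2 k j \<psi> = (\<integral>x. (\<integral>y. \<psi> x y \<partial>wmax j) \<partial>wsum k)"

lemma baxter:
  fixes x v :: real
  shows "\<phi> (max 0 x + max 0 v) + \<phi> (max 0 (x + v)) = \<phi> (max 0 (max 0 x + v)) + (\<phi> (max 0 (x + max 0 v)) :: real)"
  by (auto simp: max_def)

text \<open>Take \<open>x\<close> with law \<open>wsum k\<close>, \<open>y\<close> with law
  \<open>wmax j\<close> and a further step \<open>u\<close>, and apply Baxter's identity with
  \<open>v = y + u\<close>. The positive part of \<open>v\<close> has law
  \<open>wmax (Suc j)\<close>, while in the term with \<open>x + y + u\<close> the step is attached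
  to \<open>x\<close> instead, which gives \<open>wsum (Suc k)\<close>.\<close>

lemma expectation2_baxter:
  assumes \<phi>: "\<phi> \<in> test_functions"
  shows "expectation2 k (Suc j) (\<lambda>x y. \<phi> (max 0 x + y)) + expectation2 (Suc k) j (\<lambda>x y. \<phi> (max 0 (x + y)))
       = expectation2 k j (\<lambda>x y. reflected \<phi> (max 0 x + y)) + expectation2 k (Suc j) (\<lambda>x y. \<phi> (max 0 (x + y)))"
proof -
  interpret A: prob_space "wmax j" by (rule prob_space_wmax)
  interpret B: prob_space "wsum k" by (rule prob_space_wsum)
  interpret AF: pair_prob_space "wmax j" F ..
  interpret BAF: pair_prob_space "wsum k" "wmax j \<Otimes>\<^sub>M F" ..
  note [measurable] = test_functionsD(1)[OF \<phi>]
  note bd = test_functionsD[OF \<phi>]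
  have [simp]: "(\<lambda>y. \<phi> (f y)) \<in> test_functions" if "f \<in> borel_measurable borel" for f
    using that \<phi> by (auto simp: test_functions_def)
  let ?I = "\<lambda>\<psi>. (\<integral>x. (\<integral>y. (\<integral>u. \<psi> x (y + u) \<partial>F) \<partial>wmax j) \<partial>wsum k)"
  have 1: "expectation2 k (Suc j) (\<lambda>x y. \<phi> (max 0 x + y)) = ?I (\<lambda>x v. \<phi> (max 0 x + max 0 v))"
    unfolding expectation2_def by (subst integral_wmax_Suc) auto
  have 4: "expectation2 k (Suc j) (\<lambda>x y. \<phi> (max 0 (x + y))) = ?I (\<lambda>x v. \<phi> (max 0 (x + max 0 v)))"
    unfolding expectation2_def by (subst integral_wmax_Suc) auto
  have 2: "expectation2 (Suc k) j (\<lambda>x y. \<phi> (max 0 (x + y))) = ?I (\<lambda>x v. \<phi> (max 0 (x + v)))"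
  proof -
    have m: "(\<lambda>x. \<integral>y. \<phi> (max 0 (x + y)) \<partial>wmax j) \<in> borel_measurable borel"
      by measurable
    have t: "(\<lambda>x. \<integral>y. \<phi> (max 0 (x + y)) \<partial>wmax j) \<in> test_functions"
      using m integral_real_unit_bounded(2,3)[OF prob_space_wmax sets_wmax, of "\<lambda>y. \<phi> (max 0 (_ + y))"]
      by (auto simp: test_functions_def intro!: A.integral_unit_bounded bd)
    have "expectation2 (Suc k) j (\<lambda>x y. \<phi> (max 0 (x + y)))
        = (\<integral>x. (\<integral>u. (\<integral>y. \<phi> (max 0 (x + u + y)) \<partial>wmax j) \<partial>F) \<partial>wsum k)"
      unfolding expectation2_def by (rule integral_wsum_Suc[OF t])
    also have "\<dots> = ?I (\<lambda>x v. \<phi> (max 0 (x + v)))"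
    proof (rule Bochner_Integration.integral_cong[OF refl])
      fix x
      have "(\<integral>u. (\<integral>y. \<phi> (max 0 (x + u + y)) \<partial>wmax j) \<partial>F) = (\<integral>y. (\<integral>u. \<phi> (max 0 (x + u + y)) \<partial>F) \<partial>wmax j)"
        by (rule swap_integrals) (auto simp: bd prob_space_axioms A.prob_space_axioms)
      then show "(\<integral>u. (\<integral>y. \<phi> (max 0 (x + u + y)) \<partial>wmax j) \<partial>F) = (\<integral>y. (\<integral>u. \<phi> (max 0 (x + (y + u))) \<partial>F) \<partial>wmax j)"
        by (simp add: ac_simps)
    qed
    finally show ?thesis .
  qed
  have 3: "expectation2 k j (\<lambda>x y. reflected \<phi> (max 0 x + y)) = ?I (\<lambda>x v. \<phi> (max 0 (max 0 x + v)))"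
    by (simp add: expectation2_def reflected_def add.assoc)
  have I: "?I \<psi> = (\<integral>p. \<psi> (fst p) (fst (snd p) + snd (snd p)) \<partial>(wsum k \<Otimes>\<^sub>M (wmax j \<Otimes>\<^sub>M F)))"
    and int: "integrable (wsum k \<Otimes>\<^sub>M (wmax j \<Otimes>\<^sub>M F)) (\<lambda>p. \<psi> (fst p) (fst (snd p) + snd (snd p)))"
    if [measurable]: "case_prod \<psi> \<in> borel_measurable (borel \<Otimes>\<^sub>M borel)" and b: "\<And>x v. 0 \<le> \<psi> x v" "\<And>x v. \<psi> x v \<le> 1"
    for \<psi> :: "real \<Rightarrow> real \<Rightarrow> real"
  proof -
    have pp: "prob_space (wmax j \<Otimes>\<^sub>M F)" "prob_space (wsum k \<Otimes>\<^sub>M (wmax j \<Otimes>\<^sub>M F))"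
      by (intro prob_space_pair A.prob_space_axioms B.prob_space_axioms prob_space_axioms)+
    show int: "integrable (wsum k \<Otimes>\<^sub>M (wmax j \<Otimes>\<^sub>M F)) (\<lambda>p. \<psi> (fst p) (fst (snd p) + snd (snd p)))"
      by (rule prob_space.integrable_unit_bounded[OF pp(2)]) (auto simp: b)
    have "(\<integral>y. (\<integral>u. \<psi> x (y + u) \<partial>F) \<partial>wmax j) = (\<integral>q. \<psi> x (fst q + snd q) \<partial>(wmax j \<Otimes>\<^sub>M F))" for x
      by (subst AF.integral_fst'[symmetric])
        (auto intro!: prob_space.integrable_unit_bounded[OF pp(1)] b)
    then show "?I \<psi> = (\<integral>p. \<psi> (fst p) (fst (snd p) + snd (snd p)) \<partial>(wsum k \<Otimes>\<^sub>M (wmax j \<Otimes>\<^sub>M F)))"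
      using BAF.integral_fst'[OF int] by simp
  qed
  define G where "G \<psi> = (\<lambda>p :: real \<times> real \<times> real. \<psi> (fst p) (fst (snd p) + snd (snd p)) :: real)" for \<psi>
  let ?\<psi>1 = "\<lambda>x v. \<phi> (max 0 x + max 0 v)" and ?\<psi>2 = "\<lambda>x v. \<phi> (max 0 (x + v))"
    and ?\<psi>3 = "\<lambda>x v. \<phi> (max 0 (max 0 x + v))" and ?\<psi>4 = "\<lambda>x v. \<phi> (max 0 (x + max 0 v))"
  let ?N = "wsum k \<Otimes>\<^sub>M (wmax j \<Otimes>\<^sub>M F)"
  have m: "case_prod ?\<psi>1 \<in> borel_measurable (borel \<Otimes>\<^sub>M borel)" "case_prod ?\<psi>2 \<in> borel_measurable (borel \<Otimes>\<^sub>M borel)"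
    "case_prod ?\<psi>3 \<in> borel_measurable (borel \<Otimes>\<^sub>M borel)" "case_prod ?\<psi>4 \<in> borel_measurable (borel \<Otimes>\<^sub>M borel)"
    by measurable
  note II = I[OF m(1) bd(2) bd(3)] I[OF m(2) bd(2) bd(3)] I[OF m(3) bd(2) bd(3)] I[OF m(4) bd(2) bd(3)]
  note ii = int[OF m(1) bd(2) bd(3)] int[OF m(2) bd(2) bd(3)] int[OF m(3) bd(2) bd(3)] int[OF m(4) bd(2) bd(3)]
  have "integral\<^sup>L ?N (G ?\<psi>1) + integral\<^sup>L ?N (G ?\<psi>2) = (\<integral>p. G ?\<psi>1 p + G ?\<psi>2 p \<partial>?N)"
    using ii by (subst Bochner_Integration.integral_add) (auto simp: G_def)
  also have "\<dots> = (\<integral>p. G ?\<psi>3 p + G ?\<psi>4 p \<partial>?N)"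
    unfolding G_def by (simp only: baxter)
  also have "\<dots> = integral\<^sup>L ?N (G ?\<psi>3) + integral\<^sup>L ?N (G ?\<psi>4)"
    using ii by (subst Bochner_Integration.integral_add) (auto simp: G_def)
  finally have "?I ?\<psi>1 + ?I ?\<psi>2 = ?I ?\<psi>3 + ?I ?\<psi>4"
    by (simp only: II G_def)
  then show ?thesis by (simp only: 1 2 3 4)
qed

text \<open>Induction over all \<phi> at once, the hypothesis being used for
  \<open>reflected \<phi>\<close>. Each summand with \<open>k \<le> n\<close> is the one for
  \<open>reflected \<phi>\<close> plus a term of a telescoping sum. Of the two boundary terms,
  \<open>?C 1 n\<close> supplies the missing copy of the integral on the left, and
  \<open>?C (Suc n) 0\<close> accounts for the summand \<open>k = Suc n\<close>.\<close>

theorem spitzer_identity: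
  assumes "\<phi> \<in> test_functions"
  shows "real n * (\<integral>x. \<phi> x \<partial>wmax n) = (\<Sum>k=1..n. expectation2 k (n - k) (\<lambda>x y. \<phi> (max 0 x + y)))"
  using assms
proof (induction n arbitrary: \<phi>)
  case (Suc n)
  let ?A = "\<lambda>k j. expectation2 k j (\<lambda>x y. \<phi> (max 0 x + y))"
  let ?C = "\<lambda>k j. expectation2 k j (\<lambda>x y. \<phi> (max 0 (x + y)))"
  have AC0: "?A k 0 = ?C k 0" for k
  proof -
    note [measurable] = test_functionsD(1)[OF Suc.prems]
    show ?thesis by (simp add: expectation2_def integral_return)
  qed
  have tele: "(\<Sum>k=1..n. ?C k (Suc n - k) - ?C (Suc k) (n - k)) = ?C 1 n - ?C (Suc n) 0"
  proof -
    have "(\<Sum>k=1..m. D k - D (Suc k)) = D 1 - D (Suc m)" for D :: "nat \<Rightarrow> real" and m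
      by (induction m) auto
    from this[of "\<lambda>k. ?C k (Suc n - k)" n] show ?thesis by simp
  qed
  \<comment> \<open>One step plus the maximum of \<open>n\<close> further ones, cut off at 0, is the
    maximum of \<open>n + 1\<close> steps; exchanging the integrals lets the single step act last,
    as in Lindley's recursion.\<close>
  have last: "?C 1 n = (\<integral>x. \<phi> x \<partial>wmax (Suc n))"
  proof -
    interpret A: prob_space "wmax n" by (rule prob_space_wmax)
    note [measurable] = test_functionsD(1)[OF Suc.prems]
    have t: "(\<lambda>x. \<integral>y. \<phi> (max 0 (x + y)) \<partial>wmax n) \<in> test_functions"
      by (auto simp: test_functions_def intro!: A.integral_unit_bounded test_functionsD[OF Suc.prems])
    have "?C 1 n = (\<integral>x. (\<integral>u. (\<integral>y. \<phi> (max 0 (x + u + y)) \<partial>wmax n) \<partial>F) \<partial>return borel 0)"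
      unfolding expectation2_def using integral_wsum_Suc[OF t, of 0] by simp
    also have "\<dots> = (\<integral>u. (\<integral>y. \<phi> (max 0 (u + y)) \<partial>wmax n) \<partial>F)"
      by (subst integral_return) auto
    also have "\<dots> = (\<integral>y. (\<integral>u. \<phi> (max 0 (u + y)) \<partial>F) \<partial>wmax n)"
      by (rule swap_integrals)
        (auto simp: test_functionsD[OF Suc.prems] prob_space_axioms A.prob_space_axioms)
    finally show ?thesis
      by (simp add: integral_wmax_Suc[OF Suc.prems] add.commute del: wmax.simps)
  qed
  have "(\<Sum>k=1..n. ?A k (Suc n - k)) = (\<Sum>k=1..n. ?A k (Suc (n - k)))"
    by (intro sum.cong) (auto simp: Suc_diff_le)
  also have "\<dots> = (\<Sum>k=1..n. expectation2 k (n - k) (\<lambda>x y. reflected \<phi> (max 0 x + y)) + (?C k (Suc (n - k)) - ?C (Suc k) (n - k)))"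
    using expectation2_baxter[OF Suc.prems] by (intro sum.cong refl) (simp add: algebra_simps)
  also have "\<dots> = (\<Sum>k=1..n. expectation2 k (n - k) (\<lambda>x y. reflected \<phi> (max 0 x + y)))
      + (\<Sum>k=1..n. ?C k (Suc n - k) - ?C (Suc k) (n - k))"
    by (simp add: sum.distrib) (intro sum.cong arg_cong2[where f = "(-)"] refl, auto simp: Suc_diff_le)
  also have "\<dots> = real n * (\<integral>x. \<phi> x \<partial>wmax (Suc n)) + ((\<integral>x. \<phi> x \<partial>wmax (Suc n)) - ?A (Suc n) 0)"
    using Suc.IH[OF reflected_test[OF Suc.prems]]
    unfolding tele last AC0 integral_wmax_Suc[OF Suc.prems] by (simp flip: reflected_def)
  finally show ?case
    by (simp add: algebra_simps del: wmax.simps)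
qed simp

end

text \<open>Multiplicativity on the half-line factorises the expectation of
  \<open>\<phi> (max 0 x + y)\<close> and thereby turns Spitzer's identity into a recursion for
  numbers. The two instances are Laplace exponentials and their limit for large rates, the indicator
  of \<open>{..0}\<close>.\<close>

definition multiplicative_weight :: "(real \<Rightarrow> real) \<Rightarrow> bool" where
  "multiplicative_weight \<phi> \<longleftrightarrow> \<phi> \<in> test_functions \<and> antimono \<phi> \<and> \<phi> 0 = 1 \<and>
     (\<forall>x\<ge>0. \<forall>y\<ge>0. \<phi> (x + y) = \<phi> x * \<phi> y)"

lemma multiplicative_weight_indicator: "multiplicative_weight (indicat_real {..0})"
  by (auto simp: multiplicative_weight_def indicator_def antimono_def)

lemma multiplicative_weight_exp:
  assumes "0 \<le> \<theta>"
  shows "multiplicative_weight (\<lambda>x. exp (- (\<theta> * max 0 x)))"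
proof -
  have "\<theta> * max 0 x \<le> \<theta> * max 0 y" if "x \<le> y" for x y
    using assms that by (intro mult_left_mono) auto
  then show ?thesis
    using assms by (auto simp: multiplicative_weight_def test_functions_def antimono_def
        distrib_left exp_add[symmetric])
qed

section \<open>Comparison of the recursion with the probability of staying below a level\<close>

context step_law
begin

lemma spitzer_recursion:
  assumes \<phi>: "multiplicative_weight \<phi>"
  shows "spitzer_recursion (\<lambda>n. \<integral>x. \<phi> x \<partial>wmax n) (\<lambda>k. (transfer F (\<lambda>_. 1) ^^ k) (\<lambda>x. \<phi> (max 0 x)) 0)"
proof
  have t: "\<phi> \<in> test_functions" "antimono \<phi>" "\<phi> 0 = 1"
    and mult: "\<And>x y. 0 \<le> x \<Longrightarrow> 0 \<le> y \<Longrightarrow> \<phi> (x + y) = \<phi> x * \<phi> y"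
    using \<phi> by (auto simp: multiplicative_weight_def)
  note [measurable] = test_functionsD(1)[OF t(1)]
  show "(\<integral>x. \<phi> x \<partial>wmax 0) = 1" by (simp add: integral_return t)
  show "0 \<le> (\<integral>x. \<phi> x \<partial>wmax n)" for n
    by (rule integral_real_unit_bounded[OF prob_space_wmax sets_wmax t(1)])
  show "decseq (\<lambda>n. \<integral>x. \<phi> x \<partial>wmax n)"
    by (rule integral_wmax_antimono[OF t(1,2)])
  have c: "(transfer F (\<lambda>_. 1) ^^ k) (\<lambda>x. \<phi> (max 0 x)) \<in> test_functions" for k
    by (rule transfer_pow_test[OF const_test_functions comp_max_test[OF t(1)]]) auto
  show "(transfer F (\<lambda>_. 1) ^^ k) (\<lambda>x. \<phi> (max 0 x)) 0 \<le> 1" for k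
    using test_functionsD(3)[OF c] by auto
  have "expectation2 k j (\<lambda>x y. \<phi> (max 0 x + y)) = (\<integral>x. \<phi> (max 0 x) \<partial>wsum k) * (\<integral>x. \<phi> x \<partial>wmax j)" for k j
  proof -
    have "(\<integral>y. \<phi> (max 0 x + y) \<partial>wmax j) = (\<integral>y. \<phi> (max 0 x) * \<phi> y \<partial>wmax j)" for x
      using AE_wmax_nonneg[of j]
      by (intro integral_cong_AE) (auto simp: mult elim!: eventually_mono)
    then show ?thesis by (simp add: expectation2_def)
  qed
  then show "real n * (\<integral>x. \<phi> x \<partial>wmax n)
      = (\<Sum>k=1..n. (transfer F (\<lambda>_. 1) ^^ k) (\<lambda>x. \<phi> (max 0 x)) 0 * (\<integral>x. \<phi> x \<partial>wmax (n - k)))" for n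
    by (simp add: spitzer_identity[OF t(1)] integral_wsum[OF comp_max_test[OF t(1)]])
qed

lemma integral_wmax_atMost_neg: "y < 0 \<Longrightarrow> (\<integral>x. indicat_real {..y} x \<partial>wmax n) = 0"
  using AE_wmax_nonneg[of n]
  by (subst integral_cong_AE[where g = "\<lambda>_. 0"]) (auto elim!: eventually_mono simp: indicator_def)

text \<open>The transfer operator peels off the first step of the walk, Lindley's recursion the last one.\<close>

lemma transfer_pow_eq_wmax:
  assumes "s \<le> y"
  shows "(transfer F (indicat_real {..y}) ^^ n) (\<lambda>_. 1) s = (\<integral>x. indicat_real {..y - s} x \<partial>wmax n)"
  using assms
proof (induction n arbitrary: s)
  case 0
  have "(\<integral>x. indicat_real {..y - s} x \<partial>return borel 0) = indicat_real {..y - s} 0"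
    by (rule integral_return) auto
  then show ?case using 0 by simp
next
  case (Suc n)
  interpret A: prob_space "wmax n" by (rule prob_space_wmax)
  have "(transfer F (indicat_real {..y}) ^^ Suc n) (\<lambda>_. 1) s
      = (\<integral>u. indicat_real {..y} (s + u) * (transfer F (indicat_real {..y}) ^^ n) (\<lambda>_. 1) (s + u) \<partial>F)"
    by (simp add: transfer_def[of F "indicat_real {..y}"])
  also have "\<dots> = (\<integral>u. (\<integral>x. indicat_real {..y - (s + u)} x \<partial>wmax n) \<partial>F)"
  proof (rule Bochner_Integration.integral_cong[OF refl])
    fix u
    show "indicat_real {..y} (s + u) * (transfer F (indicat_real {..y}) ^^ n) (\<lambda>_. 1) (s + u)
        = (\<integral>x. indicat_real {..y - (s + u)} x \<partial>wmax n)"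
      by (cases "s + u \<le> y") (use Suc.IH[of "s + u"] integral_wmax_atMost_neg[of "y - (s + u)" n] in auto)
  qed
  also have "\<dots> = (\<integral>x. (\<integral>u. indicat_real {..y - (s + u)} x \<partial>F) \<partial>wmax n)"
  proof (rule swap_integrals)
    have "(\<lambda>(u, x). indicat_real {..y - (s + u)} x) = (\<lambda>p. indicat_real {p. snd p \<le> y - (s + fst p)} p)"
      by (auto simp: indicator_def)
    moreover have "{p :: real \<times> real. snd p \<le> y - (s + fst p)} \<in> sets (F \<Otimes>\<^sub>M wmax n)"
    proof -
      have "{p \<in> space (borel \<Otimes>\<^sub>M borel). snd p \<le> y - (s + fst p :: real)} \<in> sets (borel \<Otimes>\<^sub>M borel)"
        by measurable
      then show ?thesis by (simp add: space_pair_measure cong: sets_pair_measure_cong)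
    qed
    ultimately show "(\<lambda>(u, x). indicat_real {..y - (s + u)} x) \<in> borel_measurable (F \<Otimes>\<^sub>M wmax n)"
      by simp
  qed (auto simp: prob_space_axioms A.prob_space_axioms)
  also have "\<dots> = (\<integral>x. (\<integral>u. indicat_real {..y - s} (max 0 (x + u)) \<partial>F) \<partial>wmax n)"
    using Suc.prems by (intro Bochner_Integration.integral_cong refl) (auto simp: indicator_def)
  also have "\<dots> = (\<integral>x. indicat_real {..y - s} x \<partial>wmax (Suc n))"
    by (rule integral_wmax_Suc[symmetric]) simp
  finally show ?case .
qed

definition stay :: "nat \<Rightarrow> real \<Rightarrow> real" where
  "stay n y = (transfer F (indicat_real {..y}) ^^ n) (\<lambda>_. 1) 0"

lemma stay_nonneg: "0 \<le> stay n y" and stay_le1: "stay n y \<le> 1"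
  unfolding stay_def by (rule test_functionsD[OF transfer_pow_test]; simp)+

lemma stay_antimono: "m \<le> n \<Longrightarrow> stay n y \<le> stay m y"
  unfolding stay_def by (rule decseqD[OF transfer_pow_one_antimono]) simp_all

lemma stay_mono: "x \<le> y \<Longrightarrow> stay n x \<le> stay n y"
  unfolding stay_def by (rule transfer_pow_weight_mono) (auto simp: indicator_def)

lemma stay_eq_wmax: "0 \<le> y \<Longrightarrow> stay n y = (\<integral>x. indicat_real {..y} x \<partial>wmax n)"
  by (simp add: stay_def transfer_pow_eq_wmax)

definition laplace :: "real \<Rightarrow> nat \<Rightarrow> real" where
  "laplace \<theta> n = (\<integral>x. exp (- (\<theta> * max 0 x)) \<partial>wmax n)"

text \<open>Pointwise comparison of the exponential with the indicator of \<open>{..y}\<close> on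
  the half-line. No Tauberian argument is involved, since a factor that is constant in
  \<open>n\<close> and an additive \<open>exp (- (\<theta> * y))\<close> are affordable.\<close>

lemma
  assumes "0 \<le> \<theta>" "0 \<le> y"
  shows stay_le_laplace: "stay n y \<le> exp (\<theta> * y) * laplace \<theta> n"
    and laplace_le_stay: "laplace \<theta> n \<le> stay n y + exp (- (\<theta> * y))"
    and laplace_ge_stay: "exp (- (\<theta> * y)) * stay n y \<le> laplace \<theta> n"
proof -
  interpret A: prob_space "wmax n" by (rule prob_space_wmax)
  have t: "(\<lambda>x. exp (- (\<theta> * max 0 x))) \<in> test_functions"
    using multiplicative_weight_exp[OF assms(1)] by (simp add: multiplicative_weight_def)
  have int: "integrable (wmax n) (\<lambda>x. exp (- (\<theta> * max 0 x)))"
    by (rule integral_real_unit_bounded[OF prob_space_wmax sets_wmax t])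
  have int': "integrable (wmax n) (indicat_real {..y})"
    by (rule integral_real_unit_bounded[OF prob_space_wmax sets_wmax]) simp
  have le: "\<theta> * max 0 x \<le> \<theta> * y" if "x \<le> y" for x
    using assms that by (intro mult_left_mono) auto
  have ge: "\<theta> * y \<le> \<theta> * max 0 x" if "y \<le> x" for x
    using assms that by (intro mult_left_mono) auto
  have "stay n y \<le> (\<integral>x. exp (\<theta> * y) * exp (- (\<theta> * max 0 x)) \<partial>wmax n)"
    unfolding stay_eq_wmax[OF assms(2)]
    by (rule integral_mono[OF int' integrable_mult_right[OF int]])
      (use le in \<open>auto simp: indicator_def exp_add[symmetric]\<close>)
  then show "stay n y \<le> exp (\<theta> * y) * laplace \<theta> n"
    by (simp add: laplace_def)
  have "laplace \<theta> n \<le> (\<integral>x. indicat_real {..y} x + exp (- (\<theta> * y)) \<partial>wmax n)"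
    unfolding laplace_def
  proof (rule integral_mono[OF int])
    show "integrable (wmax n) (\<lambda>x. indicat_real {..y} x + exp (- (\<theta> * y)))"
      using int' by simp
    show "exp (- (\<theta> * max 0 x)) \<le> indicat_real {..y} x + exp (- (\<theta> * y))" for x
      using ge[of x] assms(1) by (cases "x \<le> y") (auto intro: add_increasing2)
  qed
  also have "\<dots> = stay n y + exp (- (\<theta> * y))"
    using int' by (simp add: stay_eq_wmax[OF assms(2)] A.prob_space)
  finally show "laplace \<theta> n \<le> stay n y + exp (- (\<theta> * y))" .
  have "(\<integral>x. exp (- (\<theta> * y)) * indicat_real {..y} x \<partial>wmax n) \<le> laplace \<theta> n"
    unfolding laplace_def
    by (rule integral_mono[OF integrable_mult_right[OF int'] int])
      (use le in \<open>auto simp: indicator_def\<close>)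
  then show "exp (- (\<theta> * y)) * stay n y \<le> laplace \<theta> n"
    by (simp add: stay_eq_wmax[OF assms(2)])
qed

lemma spitzer_recursion_laplace:
  "0 \<le> \<theta> \<Longrightarrow> spitzer_recursion (laplace \<theta>) (\<lambda>k. (transfer F (\<lambda>_. 1) ^^ k) (\<lambda>x. exp (- (\<theta> * max 0 x))) 0)"
  using spitzer_recursion[OF multiplicative_weight_exp, of \<theta>]
  by (simp add: laplace_def[abs_def])

text \<open>The recursion for the indicator of \<open>{..0}\<close>, started at
  \<open>k0 = 1\<close>; the second factor \<open>p\<close> is the bound for
  \<open>stay 1 0\<close>, which is the first coefficient. For \<open>p\<close> close to 1 the decay
  in \<open>n\<close> is as slow as desired.\<close>

lemma stay_zero_lower_bound:
  assumes c: "\<And>k. 1 \<le> k \<Longrightarrow> k \<le> n \<Longrightarrow> p \<le> (transfer F (\<lambda>_. 1) ^^ k) (indicat_real {..0}) 0"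
    and p: "0 \<le> p" "p \<le> 1" and n: "1 \<le> n"
  shows "p\<^sup>2 * (1 / real n) powr (1 - p) \<le> stay n 0"
proof -
  let ?c = "\<lambda>k. (transfer F (\<lambda>_. 1) ^^ k) (indicat_real {..0}) 0"
  have *: "(\<lambda>x. indicat_real {..0::real} (max 0 x)) = indicat_real {..0}"
    by (auto simp: indicator_def)
  interpret S: spitzer_recursion "\<lambda>n. stay n 0" ?c
    using spitzer_recursion[OF multiplicative_weight_indicator]
    by (simp add: stay_eq_wmax *)
  have "p \<le> stay 1 0"
    using c[of 1] n S.rec[of 1] S.a0 by simp
  then have "p * (1 / real n) powr (1 - p) * p \<le> p * (1 / real n) powr (1 - p) * stay 1 0"
    using p by (intro mult_left_mono) auto
  also have "\<dots> \<le> stay n 0"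
    using S.lower_bound[of n p 1] c p n by simp
  finally show ?thesis by (simp add: power2_eq_square mult_ac)
qed

section \<open>Descents of walks whose downward steps are bounded\<close>

lemma step_law_uminus: "step_law (distr F borel uminus)"
proof -
  interpret D: prob_space "distr F borel uminus"
    by (rule prob_space_distr) simp
  show ?thesis by unfold_locales simp
qed

lemma transfer_uminus:
  assumes "w \<in> test_functions" "g \<in> test_functions"
  shows "transfer (distr F borel uminus) w g s = transfer F (\<lambda>x. w (- x)) (\<lambda>x. g (- x)) (- s)"
proof -
  note [measurable] = test_functionsD(1)[OF assms(1)] test_functionsD(1)[OF assms(2)]
  show ?thesis unfolding transfer_def by (subst integral_distr) (auto simp: algebra_simps)
qed

lemma transfer_pow_uminus:
  assumes "w \<in> test_functions" "g \<in> test_functions"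
  shows "(transfer (distr F borel uminus) w ^^ n) g s
    = (transfer F (\<lambda>x. w (- x)) ^^ n) (\<lambda>x. g (- x)) (- s)"
proof (induction n arbitrary: s)
  case (Suc n)
  interpret D: step_law "distr F borel uminus" by (rule step_law_uminus)
  show ?case
    using transfer_uminus[OF assms(1) D.transfer_pow_test[OF assms]] Suc by simp
qed simp

text \<open>\<open>descend c n s\<close> is the probability that the walk started at \<open>s\<close> becomes negative within
  \<open>n\<close> steps if it is killed at the first step below \<open>-c\<close>. Such a walk overshoots a level by at
  most \<open>c\<close>, so that descending by \<open>j * c\<close> takes \<open>j\<close> independent successful descents.\<close>

primrec descend :: "real \<Rightarrow> nat \<Rightarrow> real \<Rightarrow> real" where
  "descend c 0 s = indicat_real {..<0} s"
| "descend c (Suc n) s = (if s < 0 then 1 else \<integral>u. indicat_real {-c..} u * descend c n (s + u) \<partial>F)"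

lemma descend_test: "descend c n \<in> test_functions"
  and descend_int: "integrable F (\<lambda>u. indicat_real {-c..} u * descend c n (s + u))"
proof -
  show t: "descend c n \<in> test_functions" for n
  proof (induction n)
    case (Suc n)
    note [measurable] = test_functionsD(1)[OF Suc]
    have "0 \<le> (\<integral>u. indicat_real {-c..} u * descend c n (s + u) \<partial>F)"
      "(\<integral>u. indicat_real {-c..} u * descend c n (s + u) \<partial>F) \<le> 1" for s
      by (rule integral_unit_bounded; auto intro!: mult_le_one test_functionsD[OF Suc] simp: indicator_def)+
    moreover have "(\<lambda>s. if s < 0 then 1 else \<integral>u. indicat_real {-c..} u * descend c n (s + u) \<partial>F)
        \<in> borel_measurable borel"
      by measurable
    ultimately show ?case by (auto simp: test_functions_def)
  next
    case 0
    have "descend c 0 = indicat_real {..<0}" by (rule ext) simp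
    then show ?case by simp
  qed
  show "integrable F (\<lambda>u. indicat_real {-c..} u * descend c n (s + u))"
    using integrable_test_function[OF mult_test_functions[OF indicator_test_functions shift_test_functions[OF t]]]
    by simp
qed

lemma descend_antimono: "s \<le> t \<Longrightarrow> descend c n t \<le> descend c n s"
proof (induction n arbitrary: s t)
  case (Suc n)
  show ?case
  proof (cases "s < 0")
    case True
    then show ?thesis
      using test_functionsD(3)[OF descend_test, of c "Suc n" t] by simp
  next
    case False
    then show ?thesis
      using Suc by (auto intro!: integral_mono descend_int mult_left_mono simp del: Bochner_Integration.integral_mult_right)
  qed
qed (auto simp: indicator_def)

text \<open>When the killed walk from \<open>s\<close> first turns negative, it is at
  \<open>- c\<close> or above; the walk shifted by \<open>b + c\<close> is then still at
  \<open>b\<close> or above and has to descend from there. Starting points in \<open>[-c, 0)\<close>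
  are included for the sake of the induction.\<close>

lemma descend_add:
  assumes "0 \<le> b" "0 \<le> c" "- c \<le> s"
  shows "descend c n (s + b + c) \<le> descend c n s * descend c n b"
  using assms(3)
proof (induction n arbitrary: s)
  case 0
  then show ?case using assms by (auto simp: indicator_def)
next
  case (Suc n)
  show ?case
  proof (cases "s < 0")
    case True
    then show ?thesis
      using descend_antimono[of b "s + b + c" c "Suc n"] Suc.prems by simp
  next
    case False
    \<comment> \<open>The second descent has less time left; granting it the full time only
      increases its probability.\<close>
    have mono: "descend c n b \<le> descend c (Suc n) b"
    proof -
      have "descend c m x \<le> descend c (Suc m) x" for m x
      proof (induction m arbitrary: x)
        case 0
        then show ?case
          using test_functionsD(2)[OF descend_test, of c "Suc 0" x] by (auto simp: indicator_def)
      next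
        case (Suc m)
        have "(\<integral>u. indicat_real {-c..} u * descend c m (x + u) \<partial>F)
            \<le> (\<integral>u. indicat_real {-c..} u * descend c (Suc m) (x + u) \<partial>F)"
          by (intro integral_mono descend_int mult_left_mono Suc) auto
        then show ?case by (simp only: descend.simps(2) split: if_splits) auto
      qed
      then show ?thesis .
    qed
    have "(\<integral>u. indicat_real {-c..} u * descend c n (s + b + c + u) \<partial>F)
        \<le> (\<integral>u. indicat_real {-c..} u * descend c n (s + u) * descend c (Suc n) b \<partial>F)"
    proof (intro integral_mono descend_int integrable_mult_left)
      fix u
      show "indicat_real {-c..} u * descend c n (s + b + c + u)
          \<le> indicat_real {-c..} u * descend c n (s + u) * descend c (Suc n) b"
      proof (cases "- c \<le> u")
        case True
        then have "descend c n (s + u + b + c) \<le> descend c n (s + u) * descend c n b"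
          using False by (intro Suc.IH) auto
        also have "\<dots> \<le> descend c n (s + u) * descend c (Suc n) b"
          by (intro mult_left_mono mono test_functionsD[OF descend_test])
        finally show ?thesis using True by (simp add: ac_simps)
      qed simp
    qed
    then show ?thesis
      using False assms by simp
  qed
qed

lemma descend_power:
  assumes "0 \<le> c"
  shows "descend c n (real j * c) \<le> descend c n 0 ^ j"
proof (induction j)
  case 0
  then show ?case using test_functionsD(3)[OF descend_test] by simp
next
  case (Suc j)
  have "descend c n (0 + real j * c + c) \<le> descend c n 0 * descend c n (real j * c)"
    using assms by (intro descend_add) auto
  also have "\<dots> \<le> descend c n 0 * descend c n 0 ^ j"
    by (intro mult_left_mono Suc test_functionsD[OF descend_test])
  finally show ?case by (simp add: algebra_simps)
qed

text \<open>Union bound: unless one of the \<open>n\<close> steps lies below \<open>- c\<close>, the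
  killing has no effect.\<close>

lemma transfer_negative_le_descend:
  "(transfer F (\<lambda>_. 1) ^^ n) (indicat_real {..<0}) s \<le> descend c n s + real n * prob {..<-c}"
proof (induction n arbitrary: s)
  case (Suc n)
  let ?T = "(transfer F (\<lambda>_. 1) ^^ n) (indicat_real {..<0})"
  have T: "?T \<in> test_functions" by (rule transfer_pow_test) auto
  show ?case
  proof (cases "s < 0")
    case True
    have "(transfer F (\<lambda>_. 1) ^^ Suc n) (indicat_real {..<0}) s \<le> 1"
      by (rule test_functionsD(3)[OF transfer_pow_test]) auto
    then show ?thesis using True by (simp add: add_increasing2)
  next
    case False
    have int: "integrable F (indicat_real {..<-c})"
      by (rule integrable_test_function) simp
    have "(transfer F (\<lambda>_. 1) ^^ Suc n) (indicat_real {..<0}) s = (\<integral>u. ?T (s + u) \<partial>F)"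
      by (simp add: transfer_def[of F "\<lambda>_. 1"])
    also have "\<dots> \<le> (\<integral>u. indicat_real {-c..} u * descend c n (s + u) + (real n * prob {..<-c} + indicat_real {..<-c} u) \<partial>F)"
    proof (rule integral_mono)
      show "integrable F (\<lambda>u. ?T (s + u))"
        by (rule integrable_test(2)[OF const_test_functions[of 1] T]) auto
      show "?T (s + u) \<le> indicat_real {-c..} u * descend c n (s + u) + (real n * prob {..<-c} + indicat_real {..<-c} u)" for u
        using Suc[of "s + u"] test_functionsD(3)[OF T, of "s + u"]
        by (cases "u < - c") (simp_all add: add_increasing)
    qed (use int descend_int in auto)
    also have "\<dots> = descend c (Suc n) s + (real n * prob {..<-c} + prob {..<-c})"
      using int descend_int False by simp
    finally show ?thesis by (simp add: algebra_simps)
  qed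
qed simp

lemma descend_le_not_stay:
  assumes "0 \<le> s"
  shows "descend c n s \<le> 1 - (transfer F (indicat_real {0..}) ^^ n) (\<lambda>_. 1) s"
  using assms
proof (induction n arbitrary: s)
  case (Suc n)
  let ?A = "(transfer F (indicat_real {0..}) ^^ n) (\<lambda>_. 1)"
  have A: "?A \<in> test_functions" by (rule transfer_pow_test) auto
  have int: "integrable F (\<lambda>u. indicat_real {0..} (s + u) * ?A (s + u))"
    by (rule integrable_test) (auto intro: A)
  have "descend c (Suc n) s \<le> (\<integral>u. 1 - indicat_real {0..} (s + u) * ?A (s + u) \<partial>F)"
    using Suc.prems
  proof (simp, intro integral_mono descend_int)
    show "integrable F (\<lambda>u. 1 - indicat_real {0..} (s + u) * ?A (s + u))"
      using int by auto
    show "indicat_real {-c..} u * descend c n (s + u) \<le> 1 - indicat_real {0..} (s + u) * ?A (s + u)" for u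
    proof (cases "0 \<le> s + u")
      case True
      then show ?thesis
        using Suc.IH[OF True] test_functionsD(2,3)[OF descend_test, of c n "s + u"] test_functionsD(3)[OF A, of "s + u"]
        by (cases "- c \<le> u") simp_all
    next
      case False
      then show ?thesis by (auto simp: indicator_def intro: test_functionsD[OF descend_test])
    qed
  qed
  also have "\<dots> = 1 - transfer F (indicat_real {0..}) ?A s"
    using int by (simp add: transfer_def)
  finally show ?case by simp
qed (auto simp: indicator_def)

text \<open>A fall by more than \<open>j * c\<close> takes \<open>j\<close> descents unless some
  step is below \<open>- c\<close>. A descent fails if the walk stays nonnegative for all
  \<open>n\<close> steps, which for the negated walk is the event bounded in
  \<open>stay_zero_lower_bound\<close>.\<close>

lemma descent_bound:
  assumes nn: "\<And>k. 1 \<le> k \<Longrightarrow> k \<le> n \<Longrightarrow> p \<le> (transfer F (\<lambda>_. 1) ^^ k) (indicat_real {0..}) 0"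
    and p: "0 \<le> p" "p \<le> 1" and n: "1 \<le> n" and c: "0 \<le> c"
  shows "(transfer F (\<lambda>_. 1) ^^ n) (indicat_real {..<0}) (real j * c)
    \<le> (1 - p\<^sup>2 * (1 / real n) powr (1 - p)) ^ j + real n * prob {..<-c}"
proof -
  interpret R: step_law "distr F borel uminus" by (rule step_law_uminus)
  have i: "(\<lambda>x. indicat_real {..0} (- x)) = indicat_real {0::real..}"
    by (rule ext) (simp add: indicator_def)
  have "p\<^sup>2 * (1 / real n) powr (1 - p) \<le> R.stay n 0"
    using nn p n by (intro R.stay_zero_lower_bound) (simp_all add: transfer_pow_uminus i)
  also have "R.stay n 0 = (transfer F (indicat_real {0..}) ^^ n) (\<lambda>_. 1) 0"
    by (simp add: R.stay_def transfer_pow_uminus i)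
  finally have "descend c n 0 \<le> 1 - p\<^sup>2 * (1 / real n) powr (1 - p)"
    using descend_le_not_stay[of 0 c n] by simp
  then have "descend c n 0 ^ j \<le> (1 - p\<^sup>2 * (1 / real n) powr (1 - p)) ^ j"
    by (intro power_mono test_functionsD[OF descend_test])
  then show ?thesis
    using descend_power[OF c, of n j] transfer_negative_le_descend[of n "real j * c" c] by linarith
qed

end

section \<open>Levy processes on a grid\<close>

context step_law
begin

lemma transfer_scale: "transfer F w (\<lambda>s. k * g s) s = k * transfer F w g s"
  by (simp add: transfer_def mult.left_commute)

lemma transfer_pow_scale: "(transfer F w ^^ n) (\<lambda>s. k * g s) s = k * (transfer F w ^^ n) g s"
proof (induction n arbitrary: s)
  case (Suc n)
  then have "(transfer F w ^^ n) (\<lambda>s. k * g s) = (\<lambda>s. k * (transfer F w ^^ n) g s)"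
    by blast
  then show ?case by (simp add: transfer_scale)
qed simp

text \<open>Stay below \<open>x\<close> for \<open>i\<close> steps, be at \<open>- y\<close> or
  lower then, and reach at most \<open>x\<close> afterwards. Harris decouples the first two
  requirements. The last factor is taken over \<open>n\<close> steps and for a rise by
  \<open>y\<close> only, which makes it smaller and independent of \<open>i\<close> and
  \<open>x\<close>.\<close>

lemma stay_concat:
  assumes "i \<le> n" "0 \<le> x" "0 \<le> y"
  shows "stay i x * (transfer F (\<lambda>_. 1) ^^ i) (indicat_real {..-y}) 0 * stay n y \<le> stay n x"
proof -
  let ?w = "indicat_real {..x}"
  define g where "g = (transfer F ?w ^^ (n - i)) (\<lambda>_. 1)"
  have g: "g \<in> test_functions" "antimono g"
    unfolding g_def by (auto intro!: transfer_pow_test transfer_pow_antimono)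
  have "stay n y \<le> stay (n - i) y" by (rule stay_antimono) simp
  also have "\<dots> \<le> stay (n - i) (x + y)" using assms by (intro stay_mono) auto
  also have "\<dots> = g (- y)"
    using assms by (simp add: g_def transfer_pow_eq_wmax stay_eq_wmax)
  finally have K: "stay n y \<le> g (- y)" .
  have le: "stay n y * indicat_real {..-y} s \<le> g s" for s
    using order_trans[OF K antimonoD[OF g(2)], of s] test_functionsD(2)[OF g(1), of s]
    by (cases "s \<le> - y") auto
  have t: "(\<lambda>s. stay n y * indicat_real {..-y} s) \<in> test_functions"
    using stay_nonneg stay_le1 by (auto intro!: mult_test_functions)
  have "stay n y * (stay i x * (transfer F (\<lambda>_. 1) ^^ i) (indicat_real {..-y}) 0)
      \<le> stay n y * (transfer F ?w ^^ i) (indicat_real {..-y}) 0"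
    unfolding stay_def[of i] by (intro mult_left_mono harris_inequality stay_nonneg) auto
  also have "\<dots> = (transfer F ?w ^^ i) (\<lambda>s. stay n y * indicat_real {..-y} s) 0"
    by (simp add: transfer_pow_scale)
  also have "\<dots> \<le> (transfer F ?w ^^ i) g 0"
    by (rule transfer_pow_mono) (auto intro: t g le)
  also have "\<dots> = stay n x"
    using assms by (simp add: stay_def g_def flip: funpow_add[unfolded comp_def, THEN fun_cong] del: funpow.simps)
  finally show ?thesis by (simp add: mult_ac)
qed

text \<open>The walk is cut into \<open>j\<close> blocks of \<open>i\<close> steps. By Harris each
  block may be required to end at or below 0, so that the next one starts no higher than the
  first.\<close>

lemma stay_power:
  assumes "0 \<le> y"
  shows "(stay i y * (transfer F (\<lambda>_. 1) ^^ i) (indicat_real {..0}) 0) ^ j \<le> stay (i * j) y"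
proof -
  let ?w = "indicat_real {..y}"
  define \<kappa> where "\<kappa> = stay i y * (transfer F (\<lambda>_. 1) ^^ i) (indicat_real {..0}) 0"
  have T: "(transfer F (\<lambda>_. 1) ^^ i) (indicat_real {..0}) \<in> test_functions"
    by (rule transfer_pow_test) auto
  have \<kappa>: "0 \<le> \<kappa>" "\<kappa> \<le> 1"
    using stay_nonneg[of i y] stay_le1[of i y] test_functionsD(2,3)[OF T, of 0]
    by (auto simp: \<kappa>_def intro!: mult_le_one)
  have "\<kappa> ^ j \<le> (transfer F ?w ^^ (i * j)) (\<lambda>_. 1) s" if "s \<le> 0" for s
    using that
  proof (induction j arbitrary: s)
    case (Suc j)
    let ?g = "(transfer F ?w ^^ (i * j)) (\<lambda>_. 1)"
    have g: "?g \<in> test_functions" by (rule transfer_pow_test) auto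
    have "\<kappa> \<le> (transfer F ?w ^^ i) (indicat_real {..0}) 0"
      unfolding \<kappa>_def stay_def by (rule harris_inequality) auto
    also have "\<dots> \<le> (transfer F ?w ^^ i) (indicat_real {..0}) s"
      using Suc.prems by (intro antimonoD[OF transfer_pow_antimono]) auto
    finally have "\<kappa> ^ j * \<kappa> \<le> \<kappa> ^ j * (transfer F ?w ^^ i) (indicat_real {..0}) s"
      using \<kappa> by (intro mult_left_mono) auto
    also have "\<dots> = (transfer F ?w ^^ i) (\<lambda>s. \<kappa> ^ j * indicat_real {..0} s) s"
      by (simp add: transfer_pow_scale)
    also have "\<dots> \<le> (transfer F ?w ^^ i) ?g s"
    proof (rule transfer_pow_mono)
      show "(\<lambda>s. \<kappa> ^ j * indicat_real {..0} s) \<in> test_functions"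
        using \<kappa> by (auto intro!: mult_test_functions simp: power_le_one)
      show "\<kappa> ^ j * indicat_real {..0} r \<le> ?g r" for r
        using Suc.IH[of r] test_functionsD(2)[OF g, of r] by (cases "r \<le> 0") auto
    qed (auto intro: g)
    also have "\<dots> = (transfer F ?w ^^ (i * Suc j)) (\<lambda>_. 1) s"
      by (simp add: funpow_add)
    finally show ?case by (simp add: mult.commute)
  qed simp
  from this[of 0] show ?thesis by (simp add: stay_def \<kappa>_def)
qed

lemma stay_ottaviani:
  assumes "\<And>j. j \<le> n \<Longrightarrow> b \<le> (transfer F (\<lambda>_. 1) ^^ j) (indicat_real {-x..}) 0" "0 \<le> b"
  shows "b * (1 - stay n (2 * x)) \<le> (transfer F (\<lambda>_. 1) ^^ n) (indicat_real {x<..}) 0"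
  unfolding stay_def by (rule ottaviani_inequality[where n = n]) (use assms in auto)

end

context levy_process
begin

definition law :: "real \<Rightarrow> real measure" where "law t = distr M borel (X t)"

lemma step_law: "0 \<le> t \<Longrightarrow> step_law (law t)"
proof -
  assume t: "0 \<le> t"
  interpret D: prob_space "law t"
    unfolding law_def by (rule prob_space_distr[OF measurable_X[OF t]])
  show ?thesis by unfold_locales (simp add: law_def)
qed

lemma measurable_X_borel [measurable (raw)]: "0 \<le> t \<Longrightarrow> X t \<in> borel_measurable M"
  by (rule measurable_X)

text \<open>Bridge between the process and the operators: on the grid of mesh \<open>h\<close> the
  process is a walk with step law \<open>law h\<close>. The induction integrates out the last
  increment, which is independent of the vector of all earlier ones.\<close>

lemma expectation_eq_transfer:
  assumes h: "0 \<le> h" and w: "w \<in> test_functions" and g: "g \<in> test_functions"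
  shows "expectation (\<lambda>\<omega>. (\<Prod>k=1..n. w (X (real k * h) \<omega>)) * g (X (real n * h) \<omega>))
    = (transfer (law h) w ^^ n) g 0"
proof -
  interpret F: step_law "law h" by (rule step_law[OF h])
  define \<xi> where "\<xi> i \<omega> = X (real (Suc i) * h) \<omega> - X (real i * h) \<omega>" for i \<omega>
  define S where "S k \<omega> = (\<Sum>i<k. \<xi> i \<omega>)" for k \<omega>
  have \<xi>m [measurable]: "\<xi> i \<in> borel_measurable M" for i
    unfolding \<xi>_def[abs_def] using h by (intro borel_measurable_diff measurable_X) auto
  have [measurable]: "S k \<in> borel_measurable M" for k
    unfolding S_def[abs_def] by measurable
  have [measurable]: "X (real k * h) \<in> borel_measurable M" for k
    using h by (intro measurable_X) auto
  note [measurable] = test_functionsD(1)[OF w]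
  have ind: "indep_vars (\<lambda>_. borel) \<xi> {..<n}" for n
    unfolding \<xi>_def[abs_def]
    using indep_increments[of "\<lambda>i. real i * h" n] h by (auto simp: mult_right_mono)
  have \<xi>_law: "distr M borel (\<xi> i) = law h" for i
    unfolding \<xi>_def[abs_def] law_def
    using stationary_increments[of "real i * h" "real (Suc i) * h"] h
    by (simp add: algebra_simps)
  have S: "expectation (\<lambda>\<omega>. (\<Prod>k=1..n. w (S k \<omega>)) * g (S n \<omega>)) = (transfer (law h) w ^^ n) g 0"
    if "g \<in> test_functions" for g
    using that
  proof (induction n arbitrary: g)
    case 0
    then show ?case by (simp add: S_def prob_space)
  next
    case (Suc n)
    note [measurable] = test_functionsD(1)[OF Suc.prems]
    let ?P = "\<Pi>\<^sub>M i\<in>{..<n}. (borel :: real measure)"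
    define V where "V \<omega> = (\<lambda>i\<in>{..<n}. \<xi> i \<omega>)" for \<omega>
    define A where "A v = (\<Prod>k=1..n. w (\<Sum>i<k. v i))" for v :: "nat \<Rightarrow> real"
    define B where "B v = (\<Sum>i<n. v i)" for v :: "nat \<Rightarrow> real"
    let ?Q = "\<Pi>\<^sub>M i\<in>{n}. (borel :: real measure)"
    define W where "W \<omega> = (\<lambda>i\<in>{n}. \<xi> i \<omega>)" for \<omega>
    have [measurable]: "V \<in> measurable M ?P" "W \<in> measurable M ?Q"
      unfolding V_def[abs_def] W_def[abs_def] by measurable
    have Bm [measurable]: "B \<in> borel_measurable ?P"
      unfolding B_def[abs_def] by measurable
    have Am [measurable]: "A \<in> borel_measurable ?P"
    proof -
      have "(\<lambda>v. \<Sum>i<k. v i) \<in> borel_measurable ?P" if "k \<le> n" for k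
        using that by (intro borel_measurable_sum) auto
      then show ?thesis
        unfolding A_def[abs_def]
        by (intro borel_measurable_prod measurable_compose[OF _ test_functionsD(1)[OF w]]) auto
    qed
    have A01: "0 \<le> A v" "A v \<le> 1" for v
      unfolding A_def by (auto intro!: prod_nonneg prod_le_1 test_functionsD[OF w])
    have AV: "(\<Prod>k=1..n. w (S k \<omega>)) = A (V \<omega>)" "S n \<omega> = B (V \<omega>)" for \<omega>
      by (auto simp: A_def B_def S_def V_def intro!: prod.cong arg_cong[where f = w] sum.cong)
    \<comment> \<open>Independence is needed between blocks of increments: the vector
      \<open>V\<close> of the first \<open>n\<close> and the last one, which for this purpose is a
      vector \<open>W\<close> indexed by \<open>{n}\<close>.\<close>
    have "indep_var ?P (\<lambda>\<omega>. restrict (\<lambda>i. \<xi> i \<omega>) {..<n}) (\<Pi>\<^sub>M i\<in>{n}. borel) (\<lambda>\<omega>. restrict (\<lambda>i. \<xi> i \<omega>) {n})"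
      by (rule indep_var_restrict[OF ind[of "Suc n"]]) auto
    then have iv: "indep_var ?P V ?Q W"
      by (simp add: V_def[abs_def] W_def[abs_def])
    define D where "D = distr M ?P V"
    define D' where "D' = distr M ?Q W"
    have Dp: "prob_space D" "prob_space D'"
      unfolding D_def D'_def by (rule prob_space_distr, measurable)+
    interpret D: prob_space D by fact
    interpret D': prob_space D' by fact
    interpret P: pair_prob_space D D' ..
    have joint: "distr M (?P \<Otimes>\<^sub>M ?Q) (\<lambda>\<omega>. (V \<omega>, W \<omega>)) = D \<Otimes>\<^sub>M D'"
      using iv unfolding indep_var_distribution_eq D_def D'_def by simp
    have [measurable_cong]: "sets D = sets ?P" "sets D' = sets ?Q" by (simp_all add: D_def D'_def)
    let ?f = "\<lambda>p. A (fst p) * (w (B (fst p) + snd p n) * g (B (fst p) + snd p n))"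
    have fm: "?f \<in> borel_measurable (?P \<Otimes>\<^sub>M ?Q)" by measurable
    have fint: "integrable (D \<Otimes>\<^sub>M D') ?f"
    proof (rule prob_space.integrable_unit_bounded)
      show "prob_space (D \<Otimes>\<^sub>M D')"
        by (rule prob_space_pair[OF Dp])
      show "?f \<in> borel_measurable (D \<Otimes>\<^sub>M D')" by measurable
    qed (auto intro!: mult_nonneg_nonneg mult_le_one A01 test_functionsD[OF w] test_functionsD[OF Suc.prems])
    have inner: "(\<integral>u. w (B v + u n) * g (B v + u n) \<partial>D') = transfer (law h) w g (B v)" for v
    proof -
      have "(\<integral>u. w (B v + u n) * g (B v + u n) \<partial>D') = expectation (\<lambda>\<omega>. w (B v + W \<omega> n) * g (B v + W \<omega> n))"
        unfolding D'_def by (rule integral_distr) measurable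
      also have "\<dots> = expectation (\<lambda>\<omega>. w (B v + \<xi> n \<omega>) * g (B v + \<xi> n \<omega>))"
        by (simp add: W_def)
      also have "\<dots> = (\<integral>u. w (B v + u) * g (B v + u) \<partial>distr M borel (\<xi> n))"
        by (rule integral_distr[symmetric]) measurable
      finally show ?thesis by (simp add: \<xi>_law transfer_def)
    qed
    have T: "transfer (law h) w g \<in> test_functions"
      by (rule F.transfer_test[OF w Suc.prems])
    note [measurable] = test_functionsD(1)[OF T]
    have "expectation (\<lambda>\<omega>. (\<Prod>k=1..Suc n. w (S k \<omega>)) * g (S (Suc n) \<omega>))
        = expectation (\<lambda>\<omega>. ?f (V \<omega>, W \<omega>))"
      by (simp add: AV(2)[symmetric] mult_ac flip: AV(1)) (simp add: S_def W_def add.commute)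
    also have "\<dots> = (\<integral>p. ?f p \<partial>distr M (?P \<Otimes>\<^sub>M ?Q) (\<lambda>\<omega>. (V \<omega>, W \<omega>)))"
      by (rule integral_distr[OF _ fm, symmetric]) measurable
    also have "\<dots> = (\<integral>p. ?f p \<partial>(D \<Otimes>\<^sub>M D'))" by (simp only: joint)
    also have "\<dots> = (\<integral>v. (\<integral>u. ?f (v, u) \<partial>D') \<partial>D)"
      by (rule P.integral_fst'[OF fint, symmetric])
    also have "\<dots> = (\<integral>v. A v * transfer (law h) w g (B v) \<partial>D)"
      by (simp add: inner)
    also have "\<dots> = expectation (\<lambda>\<omega>. A (V \<omega>) * transfer (law h) w g (B (V \<omega>)))"
      unfolding D_def by (rule integral_distr) measurable
    also have "\<dots> = (transfer (law h) w ^^ n) (transfer (law h) w g) 0"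
      using Suc.IH[OF T] by (simp only: AV)
    finally show ?case by (simp only: funpow_Suc_right o_apply)
  qed
  \<comment> \<open>\<open>X 0\<close> vanishes only almost surely, so process and walk agree only
    almost everywhere.\<close>
  have XS: "AE \<omega> in M. \<forall>k. X (real k * h) \<omega> = S k \<omega>"
    using start_zero
  proof (rule eventually_mono)
    fix \<omega> assume 0: "X 0 \<omega> = 0"
    have "S k \<omega> = X (real k * h) \<omega> - X (real 0 * h) \<omega>" for k
      unfolding S_def \<xi>_def by (rule sum_lessThan_telescope)
    then show "\<forall>k. X (real k * h) \<omega> = S k \<omega>" using 0 by simp
  qed
  note [measurable] = test_functionsD(1)[OF g]
  have "expectation (\<lambda>\<omega>. (\<Prod>k=1..n. w (X (real k * h) \<omega>)) * g (X (real n * h) \<omega>))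
      = expectation (\<lambda>\<omega>. (\<Prod>k=1..n. w (S k \<omega>)) * g (S n \<omega>))"
    by (rule integral_cong_AE) (use XS in \<open>auto elim!: eventually_mono\<close>)
  then show ?thesis by (simp only: S[OF g])
qed

lemma transfer_eq_expectation:
  "0 \<le> h \<Longrightarrow> g \<in> test_functions \<Longrightarrow> (transfer (law h) (\<lambda>_. 1) ^^ n) g 0 = expectation (\<lambda>\<omega>. g (X (real n * h) \<omega>))"
  using expectation_eq_transfer[of h "\<lambda>_. 1" g n] by simp

lemma transfer_eq_prob:
  assumes "0 \<le> h" "A \<in> sets borel"
  shows "(transfer (law h) (\<lambda>_. 1) ^^ n) (indicat_real A) 0 = prob {\<omega> \<in> space M. X (real n * h) \<omega> \<in> A}"
proof -
  have [measurable]: "X (real n * h) \<in> borel_measurable M" using assms by (intro measurable_X) auto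
  have "expectation (\<lambda>\<omega>. indicat_real A (X (real n * h) \<omega>)) = expectation (indicat_real {\<omega> \<in> space M. X (real n * h) \<omega> \<in> A})"
    by (rule Bochner_Integration.integral_cong) (auto simp: indicator_def)
  then show ?thesis using assms by (simp add: transfer_eq_expectation)
qed

lemma prob_law:
  assumes "0 \<le> t" "A \<in> sets borel"
  shows "measure (law t) A = prob {\<omega> \<in> space M. X t \<omega> \<in> A}"
  unfolding law_def using assms by (subst measure_distr) (auto intro!: arg_cong[where f = prob])

abbreviation grid_stay :: "real \<Rightarrow> nat \<Rightarrow> real \<Rightarrow> real" where
  "grid_stay h \<equiv> step_law.stay (law h)"

lemma grid_stay_eq_prob:
  assumes "0 \<le> h" "0 \<le> x"
  shows "grid_stay h n x = prob {\<omega> \<in> space M. \<forall>k\<in>{1..n}. X (real k * h) \<omega> \<le> x}"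
proof -
  interpret F: step_law "law h" by (rule step_law) fact
  have [measurable]: "X (real k * h) \<in> borel_measurable M" for k
    using assms by (intro measurable_X) auto
  have "grid_stay h n x = expectation (\<lambda>\<omega>. (\<Prod>k=1..n. indicat_real {..x} (X (real k * h) \<omega>)))"
    using expectation_eq_transfer[of h "indicat_real {..x}" "\<lambda>_. 1" n] assms by (simp add: F.stay_def)
  also have "\<dots> = expectation (indicat_real {\<omega> \<in> space M. \<forall>k\<in>{1..n}. X (real k * h) \<omega> \<le> x})"
    by (rule Bochner_Integration.integral_cong) (auto simp: indicator_def)
  finally show ?thesis by simp
qed

end

section \<open>Cadlag paths and the passage from grids to the supremum\<close>

lemma cadlag_right_eventually:
  assumes "cadlag p" "0 \<le> t" "x < p t"
  obtains d where "0 < d" "\<And>r. t \<le> r \<Longrightarrow> r < t + d \<Longrightarrow> x < p r"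
proof -
  have "((p) \<longlongrightarrow> p t) (at_right t)"
    using assms by (auto simp: cadlag_def continuous_within)
  then have "\<forall>\<^sub>F r in at_right t. x < p r"
    using assms(3) by (auto dest: order_tendstoD)
  then obtain b where b: "t < b" "\<And>r. t < r \<Longrightarrow> r < b \<Longrightarrow> x < p r"
    by (auto simp: eventually_at_right[of t "t + 1"])
  show thesis
    by (rule that[of "b - t"]) (use b assms(3) in \<open>auto simp: le_less\<close>)
qed

text \<open>Right-continuity and left limits bound the path near every point, and
  \<open>{0..1}\<close> is compact. Boundedness is what gives the real-valued \<open>SUP\<close> in
  \<open>running_sup\<close> its meaning.\<close>

lemma cadlag_bounded:
  assumes "cadlag p"
  shows "\<exists>B. \<forall>t\<in>{0..1}. p t \<le> B"
proof -
  have "\<exists>U B. open U \<and> t \<in> U \<and> (\<forall>r\<in>U \<inter> {0..}. p r \<le> B)" if t: "t \<in> {0..1}" for t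
  proof -
    have "(p \<longlongrightarrow> p t) (at_right t)"
      using assms t by (auto simp: cadlag_def continuous_within)
    then have "\<forall>\<^sub>F r in at_right t. p r < p t + 1"
      by (rule order_tendstoD) simp
    then obtain b where b: "t < b" "\<And>r. t < r \<Longrightarrow> r < b \<Longrightarrow> p r < p t + 1"
      by (auto simp: eventually_at_right[of t "t + 1"])
    show ?thesis
    proof (cases "t = 0")
      case True
      have "p r \<le> p t + 1" if "r \<in> {-1<..<b} \<inter> {0..}" for r
        using b(2)[of r] that True by (cases "r = t") auto
      then show ?thesis
        using True b by (intro exI[of _ "{-1<..<b}"] exI[of _ "p t + 1"]) auto
    next
      case False
      then obtain l where "(p \<longlongrightarrow> l) (at_left t)"
        using assms t unfolding cadlag_def by (metis atLeastAtMost_iff less_eq_real_def)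
      then have "\<forall>\<^sub>F r in at_left t. p r < l + 1"
        by (rule order_tendstoD) simp
      then obtain a where a: "a < t" "\<And>r. a < r \<Longrightarrow> r < t \<Longrightarrow> p r < l + 1"
        by (auto simp: eventually_at_left[of "t - 1" t])
      have "p r \<le> max (l + 1) (p t + 1)" if "r \<in> {a<..<b}" for r
        using b(2)[of r] a(2)[of r] that by (cases r t rule: linorder_cases) auto
      then show ?thesis
        using a b by (intro exI[of _ "{a<..<b}"] exI[of _ "max (l + 1) (p t + 1)"]) auto
    qed
  qed
  then obtain U B where UB: "\<And>t. t \<in> {0..1} \<Longrightarrow> open (U t) \<and> t \<in> U t \<and> (\<forall>r\<in>U t \<inter> {0..}. p r \<le> B t)"
    by metis
  obtain C where C: "C \<subseteq> {0..1}" "finite C" "{0..1} \<subseteq> (\<Union>t\<in>C. U t)"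
    by (rule compactE_image[of "{0..1::real}" "{0..1}" U]) (use UB in auto)
  show ?thesis
  proof (intro exI ballI)
    fix r :: real assume r: "r \<in> {0..1}"
    then obtain t where t: "t \<in> C" "r \<in> U t" using C by auto
    then have "p r \<le> B t" using UB[of t] C r by auto
    also have "\<dots> \<le> Max (B ` C)" using C t by (intro Max_ge) auto
    finally show "p r \<le> Max (B ` C)" .
  qed
qed

context levy_process
begin

lemma measurable_grid [measurable]: "X (real k / real N) \<in> borel_measurable M"
  by (rule measurable_X) simp

text \<open>Measurable substitute for the event that the supremum is at most \<open>x\<close>: only
  countably many times occur. They start with \<open>k = 1\<close> to match the positions of the
  walk after its first step.\<close>

definition grid_event :: "real \<Rightarrow> 'a set" where
  "grid_event x = {\<omega> \<in> space M. \<forall>N\<ge>1. \<forall>k\<in>{1..N}. X (real k / real N) \<omega> \<le> x}"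

lemma grid_event_sets: "grid_event x \<in> events"
  unfolding grid_event_def by measurable

text \<open>By right-continuity an excess over \<open>x\<close> before time 1 persists on an
  interval to its right, which meets every sufficiently fine grid. Consecutive grids are not nested,
  so convergence of the events for single grids is not a matter of monotonicity but of this
  argument.\<close>

lemma AE_eventually_grid:
  assumes "0 \<le> x"
  shows "AE \<omega> in M. \<omega> \<notin> grid_event x \<longrightarrow>
    (\<forall>\<^sub>F N in sequentially. \<not> (\<forall>k\<in>{1..N}. X (real k / real N) \<omega> \<le> x))"
    and "AE \<omega> in M. \<omega> \<in> grid_event x \<longleftrightarrow> \<omega> \<in> {\<omega> \<in> space M. running_sup X 1 \<omega> \<le> x}"
proof -
  have main: "\<forall>\<^sub>F N in sequentially. \<not> (\<forall>k\<in>{1..N}. X (real k / real N) \<omega> \<le> x)"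
    if c: "cadlag (\<lambda>t. X t \<omega>)" and s: "0 \<le> s" "s \<le> 1" "x < X s \<omega>" for \<omega> s
  proof (cases "s = 1")
    case True
    show ?thesis
      using eventually_ge_at_top[of 1]
    proof eventually_elim
      case (elim N)
      then show ?case using s True by (auto intro!: bexI[of _ N])
    qed
  next
    case False
    obtain d where d: "0 < d" "\<And>r. s \<le> r \<Longrightarrow> r < s + d \<Longrightarrow> x < X r \<omega>"
      using cadlag_right_eventually[OF c s(1) s(3)] by blast
    \<comment> \<open>Capped by \<open>1 - s\<close>, so that the grid point found does not leave
      \<open>{0..1}\<close>.\<close>
    define d' where "d' = min d (1 - s)"
    have d': "0 < d'" using d s False by (auto simp: d'_def)
    have "\<forall>\<^sub>F N in sequentially. 1 / d' < real N"
      using filterlim_real_sequentially by (auto simp: filterlim_at_top_dense)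
    then show ?thesis
    proof eventually_elim
      case (elim N)
      have N: "0 < real N" using elim d' by (meson less_trans zero_less_divide_1_iff)
      define k where "k = nat \<lfloor>s * real N\<rfloor> + 1"
      have k: "s * real N < real k" "real k \<le> s * real N + 1"
        using s N by (auto simp: k_def) linarith+
      have *: "1 < d' * real N" using elim d' by (simp add: field_simps)
      have ks: "s < real k / real N" using k N by (simp add: field_simps)
      have kd: "real k / real N < s + d'"
      proof -
        have "real k < s * real N + d' * real N" using k * by linarith
        then show ?thesis using N by (simp add: field_simps)
      qed
      then have "real k / real N < 1" by (auto simp: d'_def)
      then have "k \<in> {1..N}" using N by (auto simp: k_def)
      moreover have "x < X (real k / real N) \<omega>"
        using ks kd by (intro d(2)) (auto simp: d'_def)
      ultimately show ?case by force
    qed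
  qed
  show "AE \<omega> in M. \<omega> \<notin> grid_event x \<longrightarrow>
    (\<forall>\<^sub>F N in sequentially. \<not> (\<forall>k\<in>{1..N}. X (real k / real N) \<omega> \<le> x))"
    using cadlag_paths AE_space
  proof eventually_elim
    case (elim \<omega>)
    show ?case
    proof
      assume "\<omega> \<notin> grid_event x"
      then obtain N k where "1 \<le> N" "k \<in> {1..N}" "x < X (real k / real N) \<omega>"
        using elim by (auto simp: grid_event_def not_le)
      then show "\<forall>\<^sub>F N in sequentially. \<not> (\<forall>k\<in>{1..N}. X (real k / real N) \<omega> \<le> x)"
        using elim by (intro main[of \<omega> "real k / real N"]) auto
    qed
  qed
  show "AE \<omega> in M. \<omega> \<in> grid_event x \<longleftrightarrow> \<omega> \<in> {\<omega> \<in> space M. running_sup X 1 \<omega> \<le> x}"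
    using cadlag_paths AE_space
  proof eventually_elim
    case (elim \<omega>)
    show ?case
    proof
      assume *: "\<omega> \<in> grid_event x"
      have "X s \<omega> \<le> x" if "s \<in> {0..1}" for s
      proof (rule ccontr)
        assume "\<not> X s \<omega> \<le> x"
        then have "\<forall>\<^sub>F N in sequentially. \<not> (\<forall>k\<in>{1..N}. X (real k / real N) \<omega> \<le> x)"
          using elim that by (intro main) auto
        then have "\<forall>\<^sub>F N in sequentially. \<not> (\<forall>k\<in>{1..N}. X (real k / real N) \<omega> \<le> x) \<and> N \<ge> 1"
          using eventually_ge_at_top[of 1] by eventually_elim simp
        then show False
          using * by (auto simp: grid_event_def dest!: eventually_happens)
      qed
      then show "\<omega> \<in> {\<omega> \<in> space M. running_sup X 1 \<omega> \<le> x}"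
        using elim by (auto simp: running_sup_def intro!: cSUP_least)
    next
      assume *: "\<omega> \<in> {\<omega> \<in> space M. running_sup X 1 \<omega> \<le> x}"
      have "bdd_above ((\<lambda>s. X s \<omega>) ` {0..1})"
        using cadlag_bounded[of "\<lambda>t. X t \<omega>"] elim by (auto simp: bdd_above_def)
      then have "X s \<omega> \<le> x" if "s \<in> {0..1}" for s
        using * that cSUP_upper[of s "{0..1}" "\<lambda>s. X s \<omega>"] by (auto simp: running_sup_def)
      then show "\<omega> \<in> grid_event x" using * by (auto simp: grid_event_def)
    qed
  qed
qed

text \<open>The supremum event differs from \<open>grid_event x\<close> by a null set, hence lies in
  the completion and has the same measure there.\<close>

lemma prob_running_sup_le_eq:
  assumes "0 \<le> x"
  shows "prob_running_sup_le M X 1 x = prob (grid_event x)"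
proof -
  let ?S = "{\<omega> \<in> space M. running_sup X 1 \<omega> \<le> x}"
  have ae: "AE \<omega> in completion M. \<omega> \<in> grid_event x \<longleftrightarrow> \<omega> \<in> ?S"
    by (rule AE_completion[OF AE_eventually_grid(2)[OF assms]])
  have s: "grid_event x \<in> sets (completion M)" using grid_event_sets by simp
  then have "?S \<in> sets (completion M)"
    by (rule completion.in_sets_AE[OF ae]) auto
  then have "measure (completion M) (grid_event x) = measure (completion M) ?S"
    unfolding measure_def using emeasure_eq_AE[OF ae s] by simp
  then show ?thesis using grid_event_sets by (simp add: prob_running_sup_le_def)
qed

lemma grid_stay_unit:
  assumes "0 \<le> x"
  shows "grid_stay (1 / real N) N x = prob {\<omega> \<in> space M. \<forall>k\<in>{1..N}. X (real k / real N) \<omega> \<le> x}"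
  using grid_stay_eq_prob[of "1 / real N" x N] assms by simp

lemma prob_running_sup_le_grid:
  assumes "0 \<le> x" "1 \<le> N"
  shows "prob_running_sup_le M X 1 x \<le> grid_stay (1 / real N) N x"
  unfolding prob_running_sup_le_eq[OF assms(1)] grid_stay_unit[OF assms(1)]
  by (rule finite_measure_mono) (use assms(2) in \<open>auto simp: grid_event_def\<close>)

lemma prob_running_sup_le_tendsto:
  assumes "0 \<le> x"
  shows "(\<lambda>N. grid_stay (1 / real N) N x) \<longlonglongrightarrow> prob_running_sup_le M X 1 x"
proof -
  let ?E = "\<lambda>N. {\<omega> \<in> space M. \<forall>k\<in>{1..N}. X (real k / real N) \<omega> \<le> x}"
  have "(\<lambda>N. expectation (indicat_real (?E N))) \<longlonglongrightarrow> expectation (indicat_real (grid_event x))"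
  proof (rule integral_dominated_convergence[where w = "\<lambda>_. 1"])
    show "AE \<omega> in M. (\<lambda>N. indicat_real (?E N) \<omega>) \<longlonglongrightarrow> indicat_real (grid_event x) \<omega>"
      using AE_eventually_grid(1)[OF assms] AE_space
    proof eventually_elim
      case (elim \<omega>)
      show ?case
      proof (cases "\<omega> \<in> grid_event x")
        case True
        then have "\<forall>\<^sub>F N in sequentially. indicat_real (?E N) \<omega> = 1"
          using eventually_ge_at_top[of 1] by (auto elim!: eventually_mono simp: grid_event_def)
        then show ?thesis using True by (simp add: tendsto_eventually)
      next
        case False
        then have "\<forall>\<^sub>F N in sequentially. indicat_real (?E N) \<omega> = 0"
          using elim by (auto elim!: eventually_mono simp: indicator_eq_0_iff)
        then show ?thesis using False by (simp add: tendsto_eventually)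
      qed
    qed
  qed (use grid_event_sets in auto)
  then show ?thesis
    using grid_event_sets by (simp add: prob_running_sup_le_eq[OF assms] grid_stay_unit[OF assms])
qed

text \<open>Restricting to the meshes \<open>1 / (m * i)\<close> makes the time \<open>1 / m\<close>
  the \<open>i\<close>-th grid point.\<close>

lemma prob_running_sup_le_ge:
  assumes "0 \<le> x" "1 \<le> m" "\<And>i. i0 \<le> i \<Longrightarrow> b \<le> grid_stay (1 / real (m * i)) (m * i) x"
  shows "b \<le> prob_running_sup_le M X 1 x"
proof (rule LIMSEQ_le_const)
  show "(\<lambda>i. grid_stay (1 / real (m * i)) (m * i) x) \<longlonglongrightarrow> prob_running_sup_le M X 1 x"
    using LIMSEQ_subseq_LIMSEQ[OF prob_running_sup_le_tendsto[OF assms(1)], of "\<lambda>i. m * i"] assms(2)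
    by (simp add: strict_mono_def comp_def)
  show "\<exists>N. \<forall>n\<ge>N. b \<le> grid_stay (1 / real (m * n)) (m * n) x"
    using assms(3) by blast
qed

lemma prob_running_sup_le_mono:
  assumes "0 \<le> x" "x \<le> y"
  shows "prob_running_sup_le M X 1 x \<le> prob_running_sup_le M X 1 y"
  unfolding prob_running_sup_le_eq[OF assms(1)] prob_running_sup_le_eq[OF order_trans[OF assms]]
  by (rule finite_measure_mono[OF _ grid_event_sets]) (use assms(2) in \<open>auto simp: grid_event_def intro: order_trans\<close>)

lemma prob_running_sup_le_nonneg: "0 \<le> prob_running_sup_le M X t x"
  unfolding prob_running_sup_le_def by (rule measure_nonneg)

lemma prob_running_sup_le_le1: "0 \<le> x \<Longrightarrow> prob_running_sup_le M X 1 x \<le> 1"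
  by (simp add: prob_running_sup_le_eq)

section \<open>Behaviour at small times, and the possibility of descending\<close>

lemma stochastic_continuity:
  assumes "0 < \<eta>"
  shows "((\<lambda>t. prob {\<omega> \<in> space M. \<eta> < \<bar>X t \<omega>\<bar>}) \<longlongrightarrow> 0) (at_right 0)"
proof (rule tendsto_at_right_sequentially[of 0 1])
  fix S :: "nat \<Rightarrow> real"
  assume S: "\<And>n. 0 < S n" "\<And>n. S n < 1" "S \<longlonglongrightarrow> 0"
  have [measurable]: "X (S n) \<in> borel_measurable M" for n
    using S(1)[of n] by (intro measurable_X) auto
  have "(\<lambda>n. expectation (indicat_real {\<omega> \<in> space M. \<eta> < \<bar>X (S n) \<omega>\<bar>})) \<longlonglongrightarrow> expectation (\<lambda>_. 0)"
  proof (rule integral_dominated_convergence[where w = "\<lambda>_. 1"])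
    show "AE \<omega> in M. (\<lambda>n. indicat_real {\<omega> \<in> space M. \<eta> < \<bar>X (S n) \<omega>\<bar>} \<omega>) \<longlonglongrightarrow> 0"
      using cadlag_paths start_zero
    proof eventually_elim
      case (elim \<omega>)
      have "((\<lambda>t. X t \<omega>) \<longlongrightarrow> 0) (at_right 0)"
        using elim by (auto simp: cadlag_def continuous_within)
      moreover have "filterlim S (at_right 0) sequentially"
        using S(1,3) less_imp_neq[OF S(1), symmetric] by (auto simp: filterlim_at)
      ultimately have "(\<lambda>n. X (S n) \<omega>) \<longlonglongrightarrow> 0"
        by (rule filterlim_compose)
      then have "\<forall>\<^sub>F n in sequentially. \<bar>X (S n) \<omega>\<bar> < \<eta>"
        using assms by (auto dest!: tendstoD[of _ _ _ \<eta>] simp: dist_real_def)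
      then have "\<forall>\<^sub>F n in sequentially. indicat_real {\<omega> \<in> space M. \<eta> < \<bar>X (S n) \<omega>\<bar>} \<omega> = 0"
        by (auto elim!: eventually_mono)
      then show ?case by (rule tendsto_eventually)
    qed
  qed auto
  then show "(\<lambda>n. prob {\<omega> \<in> space M. \<eta> < \<bar>X (S n) \<omega>\<bar>}) \<longlonglongrightarrow> 0" by simp
qed simp

text \<open>Ottaviani with \<open>b = 3 / 4\<close>: the complementary probability times 3/4 is at
  most 1/4. The bound does not depend on the mesh.\<close>

lemma grid_stay_ge_two_thirds:
  assumes small: "\<And>s. 0 < s \<Longrightarrow> s \<le> T \<Longrightarrow> prob {\<omega> \<in> space M. x < \<bar>X s \<omega>\<bar>} \<le> 1 / 4"
    and "0 < h" "real n * h \<le> T" "0 \<le> x"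
  shows "2 / 3 \<le> grid_stay h n (2 * x)"
proof -
  interpret F: step_law "law h" using assms by (intro step_law) auto
  have m [measurable]: "X (real k * h) \<in> borel_measurable M" for k
    using assms by (intro measurable_X) auto
  have small': "prob {\<omega> \<in> space M. x < \<bar>X (real j * h) \<omega>\<bar>} \<le> 1 / 4" if "j \<le> n" for j
  proof (cases "j = 0")
    case True
    have "AE \<omega> in M. \<not> (x < \<bar>X 0 \<omega>\<bar>)" using start_zero assms by (auto elim!: eventually_mono)
    then have "prob {\<omega> \<in> space M. x < \<bar>X 0 \<omega>\<bar>} = 0"
      by (simp add: measure_def emeasure_eq_0_AE)
    then show ?thesis using True by simp
  next
    case False
    have "real j * h \<le> real n * h" using that assms by (intro mult_right_mono) auto
    then have "real j * h \<le> T" using assms by linarith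
    then show ?thesis using False assms by (intro small) auto
  qed
  have "3/4 * (1 - F.stay n (2 * x)) \<le> (transfer (law h) (\<lambda>_. 1) ^^ n) (indicat_real {x<..}) 0"
  proof (rule F.stay_ottaviani)
    fix j assume j: "j \<le> n"
    have "prob {\<omega> \<in> space M. \<not> (X (real j * h) \<omega> \<in> {-x..})} \<le> prob {\<omega> \<in> space M. x < \<bar>X (real j * h) \<omega>\<bar>}"
      by (rule finite_measure_mono) auto
    then show "3/4 \<le> (transfer (law h) (\<lambda>_. 1) ^^ j) (indicat_real {-x..}) 0"
      using small'[OF j] assms by (subst (asm) prob_neg) (auto simp: transfer_eq_prob)
  qed simp
  also have "\<dots> \<le> prob {\<omega> \<in> space M. x < \<bar>X (real n * h) \<omega>\<bar>}"
    using assms by (subst transfer_eq_prob) (auto intro!: finite_measure_mono)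
  also have "\<dots> \<le> 1 / 4" by (rule small') simp
  finally show ?thesis by simp
qed

text \<open>If an increment over \<open>1 / (m * j)\<close> were negative with probability
  \<open>q > 0\<close>, all \<open>j\<close> of them up to time \<open>1 / m\<close> would be so
  with probability \<open>q ^ j\<close>, making \<open>X (1 / m)\<close> negative. Hence increments
  are nonnegative on all grids refining \<open>1 / m\<close>, and right-continuity extends this to
  all times.\<close>

lemma prob_nonneg_grid_imp_subordinator:
  assumes m: "1 \<le> m" and z: "prob {\<omega> \<in> space M. X (1 / real m) \<omega> < 0} = 0"
  shows "subordinator M X"
proof -
  have m0: "0 < real m" using m by simp
  have fine: "prob {\<omega> \<in> space M. X (1 / real (m * j)) \<omega> < 0} = 0" if j: "1 \<le> j" for j
  proof -
    define h where "h = 1 / real (m * j)"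
    have h: "0 < h" using m j by (simp add: h_def)
    interpret F: step_law "law h" using h by (intro step_law) auto
    have mh: "X h \<in> borel_measurable M" using h by (intro measurable_X) auto
    let ?p = "prob {\<omega> \<in> space M. X h \<omega> < 0}"
    have p: "?p = measure (law h) {..<0}" using h by (simp add: prob_law)
    have pw: "?p ^ Suc i \<le> (transfer (law h) (\<lambda>_. 1) ^^ Suc i) (indicat_real {..<0}) 0" for i
    proof -
      have "?p ^ Suc i \<le> (transfer (law h) (\<lambda>_. 1) ^^ Suc i) (indicat_real {..<0}) s" if "s \<le> 0" for s
        using that
      proof (induction i arbitrary: s)
        case 0
        have "(\<integral>u. indicat_real {..<0} u \<partial>law h) \<le> (\<integral>u. 1 * indicat_real {..<0} (s + u) \<partial>law h)"
        proof (rule integral_mono)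
          show "integrable (law h) (\<lambda>u. 1 * indicat_real {..<0} (s + u))"
            by (rule F.integrable_test) auto
          show "integrable (law h) (indicat_real {..<0})"
            by (rule F.integrable_test_function) auto
          show "indicat_real {..<0} u \<le> 1 * indicat_real {..<0} (s + u)" for u
            using 0 by (auto simp: indicator_def)
        qed
        then show ?case by (simp add: transfer_def p)
      next
        case (Suc i)
        let ?T = "(transfer (law h) (\<lambda>_. 1) ^^ Suc i) (indicat_real {..<0})"
        have T: "?T \<in> test_functions" by (rule F.transfer_pow_test) auto
        have "?p ^ Suc (Suc i) = (\<integral>u. ?p ^ Suc i * indicat_real {..<0} u \<partial>law h)"
          by (simp add: p)
        also have "\<dots> \<le> (\<integral>u. 1 * ?T (s + u) \<partial>law h)"
        proof (rule integral_mono)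
          show "integrable (law h) (\<lambda>u. 1 * ?T (s + u))"
            by (rule F.integrable_test[OF const_test_functions[of 1] T]) auto
          show "integrable (law h) (\<lambda>u. ?p ^ Suc i * indicat_real {..<0} u)"
            by (intro integrable_mult_right F.integrable_test_function) auto
          show "?p ^ Suc i * indicat_real {..<0} u \<le> 1 * ?T (s + u)" for u
            using Suc.IH[of "s + u"] Suc.prems test_functionsD(2)[OF T, of "s + u"]
            by (cases "u < 0") auto
        qed
        also have "\<dots> = transfer (law h) (\<lambda>_. 1) ?T s"
          by (simp only: transfer_def)
        finally show ?case by (simp only: funpow.simps o_apply)
      qed
      from this[of 0] show ?thesis by simp
    qed
    obtain i where i: "j = Suc i" using j by (cases j) auto
    have "?p ^ j \<le> (transfer (law h) (\<lambda>_. 1) ^^ j) (indicat_real {..<0}) 0"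
      unfolding i by (rule pw)
    also have "\<dots> = prob {\<omega> \<in> space M. X (real j * h) \<omega> \<in> {..<0}}"
      using h by (intro transfer_eq_prob) auto
    also have "real j * h = 1 / real m" using m j by (simp add: h_def)
    finally have "?p ^ j \<le> 0" using z by simp
    then have "?p ^ j = 0" by (intro order_antisym zero_le_power measure_nonneg)
    then have "?p = 0" by (simp only: power_eq_0_iff)
    then show ?thesis by (simp add: h_def)
  qed
  have incr: "AE \<omega> in M. X (real k / real (m * j)) \<omega> \<le> X (real (Suc k) / real (m * j)) \<omega>"
    if j: "1 \<le> j" for j k
  proof -
    let ?h = "1 / real (m * j)" and ?s = "real k / real (m * j)" and ?t = "real (Suc k) / real (m * j)"
    have st: "0 \<le> ?s" "?s \<le> ?t" "?t - ?s = ?h"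
      by (auto simp: divide_right_mono diff_divide_distrib[symmetric])
    have [measurable]: "X ?s \<in> borel_measurable M" "X ?t \<in> borel_measurable M" "X ?h \<in> borel_measurable M"
      by (intro measurable_X; simp)+
    have "prob {\<omega> \<in> space M. X ?t \<omega> - X ?s \<omega> < 0} = measure (distr M borel (\<lambda>\<omega>. X ?t \<omega> - X ?s \<omega>)) {..<0}"
      by (subst measure_distr) (auto intro!: arg_cong[where f = prob])
    also have "\<dots> = measure (distr M borel (X ?h)) {..<0}"
      using stationary_increments[OF st(1,2)] st(3) by simp
    also have "\<dots> = prob {\<omega> \<in> space M. X ?h \<omega> < 0}"
      by (subst measure_distr) (auto intro!: arg_cong[where f = prob])
    also have "\<dots> = 0" by (rule fine[OF j])
    finally have "AE \<omega> in M. \<not> X ?t \<omega> - X ?s \<omega> < 0"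
      by (subst (asm) prob_eq_0) auto
    then show ?thesis by eventually_elim simp
  qed
  have "AE \<omega> in M. \<forall>j k. 1 \<le> j \<longrightarrow> X (real k / real (m * j)) \<omega> \<le> X (real (Suc k) / real (m * j)) \<omega>"
    using incr by (auto simp: AE_all_countable)
  then have "AE \<omega> in M. mono_on {0..} (\<lambda>t. X t \<omega>)"
    using cadlag_paths
  proof eventually_elim
    case (elim \<omega>)
    have grid: "X (real k / real (m * j)) \<omega> \<le> X (real l / real (m * j)) \<omega>" if "1 \<le> j" "k \<le> l" for j k l
      using that(2) by (induction l rule: dec_induct) (use elim(1) that(1) in \<open>auto intro: order_trans\<close>)
    show ?case
    proof (rule mono_onI, rule ccontr)
      fix s t :: real assume st: "s \<in> {0..}" "t \<in> {0..}" "s \<le> t" and n: "\<not> X s \<omega> \<le> X t \<omega>"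
      then have lt: "s < t" by (cases "s = t") auto
      define y where "y = (X s \<omega> + X t \<omega>) / 2"
      have y: "X t \<omega> < y" "y < X s \<omega>" using n by (auto simp: y_def)
      obtain d where d: "0 < d" "\<And>r. s \<le> r \<Longrightarrow> r < s + d \<Longrightarrow> y < X r \<omega>"
        using cadlag_right_eventually[OF elim(2) _ y(2)] st by auto
      have "((\<lambda>t. X t \<omega>) \<longlongrightarrow> X t \<omega>) (at_right t)"
        using elim st by (auto simp: cadlag_def continuous_within)
      then have "\<forall>\<^sub>F r in at_right t. X r \<omega> < y"
        using y by (auto dest: order_tendstoD)
      then obtain b where b: "t < b" "\<And>r. t < r \<Longrightarrow> r < b \<Longrightarrow> X r \<omega> < y"
        by (auto simp: eventually_at_right[of t "t + 1"])
      \<comment> \<open>Within \<open>e\<close> to the right of \<open>s\<close> the path is above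
        the midpoint \<open>y\<close>, to the right of \<open>t\<close> it is below; a grid finer
        than \<open>e\<close> has points in both intervals.\<close>
      define e where "e = Min {d, t - s, b - t}"
      have e: "0 < e" "e \<le> d" "e \<le> t - s" "e \<le> b - t" using d b lt by (auto simp: e_def)
      obtain j where j: "1 / e < real j" using reals_Archimedean2 by blast
      have j0: "0 < real j" using j e by (meson less_trans zero_less_divide_1_iff)
      let ?N = "real (m * j)"
      have "real j \<le> ?N" using mult_right_mono[of 1 "real m" "real j"] m by simp
      then have N: "0 < ?N" "1 < e * ?N"
        using j e j0 by (auto simp: field_simps intro: less_le_trans)
      define k l where "k = nat \<lfloor>s * ?N\<rfloor> + 1" and "l = nat \<lfloor>t * ?N\<rfloor> + 1"
      have k: "s * ?N < real k" "real k \<le> s * ?N + 1" and l: "t * ?N < real l" "real l \<le> t * ?N + 1"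
        using st N(1) by (auto simp: k_def l_def) linarith+
      have kN: "s < real k / ?N" "real k / ?N < s + e"
        and lN: "t < real l / ?N" "real l / ?N < t + e"
        using k l N by (auto simp: field_simps)
      have "s * ?N \<le> t * ?N" using lt N(1) by (intro mult_right_mono) auto
      then have "k \<le> l" unfolding k_def l_def by (intro add_right_mono nat_mono floor_mono)
      then have "X (real k / ?N) \<omega> \<le> X (real l / ?N) \<omega>" using j0 by (intro grid) auto
      moreover have "y < X (real k / ?N) \<omega>" using kN e by (intro d(2)) auto
      moreover have "X (real l / ?N) \<omega> < y" using lN e by (intro b(2)) auto
      ultimately show False by simp
    qed
  qed
  then show ?thesis
    unfolding subordinator_def using levy_process_axioms by auto
qed

text \<open>\<open>stay_concat\<close> at the grid index of the time \<open>1 / m\<close>, in the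
  limit of fine meshes; \<open>b\<close> has to serve for all of these meshes.\<close>

lemma prob_running_sup_le_three_term:
  assumes m: "1 \<le> m" and xy: "0 \<le> x" "0 \<le> y"
    and b: "\<And>i. i0 \<le> i \<Longrightarrow> 1 \<le> i \<Longrightarrow> b \<le> grid_stay (1 / real (m * i)) i x" and "0 \<le> b"
  shows "b * prob {\<omega> \<in> space M. X (1 / real m) \<omega> \<le> - y} * prob_running_sup_le M X 1 y
    \<le> prob_running_sup_le M X 1 x"
proof (rule prob_running_sup_le_ge[OF xy(1) m, of "max i0 1"])
  fix i assume i: "max i0 1 \<le> i"
  let ?h = "1 / real (m * i)"
  interpret F: step_law "law ?h" by (intro step_law) auto
  have e: "(transfer (law ?h) (\<lambda>_. 1) ^^ i) (indicat_real {..-y}) 0 = prob {\<omega> \<in> space M. X (1 / real m) \<omega> \<le> - y}"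
    using i by (subst transfer_eq_prob) auto
  have "b * prob {\<omega> \<in> space M. X (1 / real m) \<omega> \<le> - y} * prob_running_sup_le M X 1 y
    \<le> F.stay i x * prob {\<omega> \<in> space M. X (1 / real m) \<omega> \<le> - y} * F.stay (m * i) y"
    using i m xy assms(5) by (intro mult_mono b prob_running_sup_le_grid mult_nonneg_nonneg F.stay_nonneg)
      (auto simp: prob_running_sup_le_eq)
  also have "\<dots> \<le> F.stay (m * i) x"
    using F.stay_concat[OF _ xy, of i "m * i", unfolded e] m by simp
  finally show "b * prob {\<omega> \<in> space M. X (1 / real m) \<omega> \<le> - y} * prob_running_sup_le M X 1 y
    \<le> grid_stay ?h (m * i) x" .
qed

text \<open>\<open>stay_power\<close> with \<open>m\<close> blocks of length \<open>1 / m\<close>,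
  chosen so short that a rise by \<open>y\<close> is unlikely; each block ends at or below 0 with
  positive probability because \<open>X\<close> is not a subordinator.\<close>

lemma prob_running_sup_le_pos:
  assumes ns: "\<not> subordinator M X" and y: "0 < y"
  shows "0 < prob_running_sup_le M X 1 y"
proof -
  have "\<forall>\<^sub>F t in at_right 0. prob {\<omega> \<in> space M. y / 2 < \<bar>X t \<omega>\<bar>} < 1 / 4"
    by (rule order_tendstoD(2)[OF stochastic_continuity]) (use y in auto)
  then obtain T where T: "0 < T" "\<And>t. 0 < t \<Longrightarrow> t < T \<Longrightarrow> prob {\<omega> \<in> space M. y / 2 < \<bar>X t \<omega>\<bar>} < 1 / 4"
    by (auto simp: eventually_at_right[of 0 1])
  obtain m where m: "1 / T < real m" using reals_Archimedean2 by blast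
  have m0: "0 < real m" using m T by (meson less_trans zero_less_divide_1_iff)
  have mT: "1 / real m < T" using m T m0 by (simp add: field_simps)
  define q where "q = prob {\<omega> \<in> space M. X (1 / real m) \<omega> \<le> 0}"
  have [measurable]: "X (1 / real m) \<in> borel_measurable M" by (rule measurable_X) simp
  have "0 < prob {\<omega> \<in> space M. X (1 / real m) \<omega> < 0}"
    using prob_nonneg_grid_imp_subordinator[of m] ns m0
    by (metis One_nat_def Suc_leI less_eq_real_def measure_nonneg of_nat_0_less_iff)
  also have "\<dots> \<le> q" unfolding q_def by (rule finite_measure_mono) auto
  finally have q: "0 < q" .
  have "(2 / 3 * q) ^ m \<le> prob_running_sup_le M X 1 y"
  proof (rule prob_running_sup_le_ge[of y m 1])
    fix i :: nat assume i: "1 \<le> i"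
    let ?h = "1 / real (m * i)"
    interpret F: step_law "law ?h" by (intro step_law) auto
    have e: "(transfer (law ?h) (\<lambda>_. 1) ^^ i) (indicat_real {..0}) 0 = q"
      using i by (subst transfer_eq_prob) (auto simp: q_def)
    have "2 / 3 \<le> F.stay i (2 * (y / 2))"
      using i m0 y mT by (intro grid_stay_ge_two_thirds[of "1 / real m"] less_imp_le[OF T(2)]) auto
    then have "(2 / 3 * q) ^ m \<le> (F.stay i y * q) ^ m"
      using q by (intro power_mono mult_right_mono) auto
    also have "\<dots> \<le> F.stay (i * m) y"
      using F.stay_power[of y i m, unfolded e] y by simp
    finally show "(2 / 3 * q) ^ m \<le> grid_stay ?h (m * i) y" by (simp add: mult.commute)
  qed (use y m0 in auto)
  moreover have "0 < (2 / 3 * q) ^ m" using q by simp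
  ultimately show ?thesis by linarith
qed

end

section \<open>Small-time attraction\<close>

text \<open>Skorohod's representation realises the convergence pointwise; a sample whose limit lies
  in the open set \<open>S\<close> is eventually in \<open>S\<close>.\<close>

lemma portmanteau_open:
  assumes "\<And>n. real_distribution (\<mu> n)" "real_distribution \<nu>" "weak_conv_m \<mu> \<nu>"
    and S: "open S" and r: "r < measure \<nu> S"
  shows "\<forall>\<^sub>F n in sequentially. r < measure (\<mu> n) S"
proof -
  obtain \<Omega> :: "real measure" and Z Z' where p: "prob_space \<Omega>"
    and Zm [measurable]: "\<And>n. Z n \<in> borel_measurable \<Omega>" and Z: "\<And>n. distr \<Omega> borel (Z n) = \<mu> n"
    and Zm' [measurable]: "Z' \<in> borel_measurable \<Omega>" and Z': "distr \<Omega> borel Z' = \<nu>"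
    and conv: "\<And>x. x \<in> space \<Omega> \<Longrightarrow> (\<lambda>n. Z n x) \<longlonglongrightarrow> Z' x"
    using Skorohod[OF assms(1-3)] by force
  interpret prob_space \<Omega> by fact
  have [measurable]: "S \<in> sets borel" using S by simp
  let ?B = "\<lambda>n. {x \<in> space \<Omega>. Z' x \<in> S \<and> Z n x \<notin> S}"
  have "(\<lambda>n. expectation (indicat_real (?B n))) \<longlonglongrightarrow> expectation (\<lambda>_. 0)"
  proof (rule integral_dominated_convergence[where w = "\<lambda>_. 1"])
    show "AE x in \<Omega>. (\<lambda>n. indicat_real (?B n) x) \<longlonglongrightarrow> 0"
    proof (rule AE_I2)
      fix x assume x: "x \<in> space \<Omega>"
      show "(\<lambda>n. indicat_real (?B n) x) \<longlonglongrightarrow> 0"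
      proof (cases "Z' x \<in> S")
        case True
        then have "\<forall>\<^sub>F n in sequentially. Z n x \<in> S"
          using conv[OF x] S by (rule topological_tendstoD[rotated 2])
        then have "\<forall>\<^sub>F n in sequentially. indicat_real (?B n) x = 0"
          by (auto elim!: eventually_mono)
        then show ?thesis by (rule tendsto_eventually)
      qed simp
    qed
  qed auto
  then have lim: "(\<lambda>n. prob (?B n)) \<longlonglongrightarrow> 0" by simp
  have eq: "measure \<nu> S = prob {x \<in> space \<Omega>. Z' x \<in> S}" "measure (\<mu> n) S = prob {x \<in> space \<Omega>. Z n x \<in> S}" for n
    by (auto simp: Z[symmetric] Z'[symmetric] measure_distr intro!: arg_cong[where f = prob])
  have "\<forall>\<^sub>F n in sequentially. prob (?B n) < measure \<nu> S - r"
    using order_tendstoD(2)[OF lim, of "measure \<nu> S - r"] r by simp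
  then show ?thesis
  proof eventually_elim
    case (elim n)
    have "measure \<nu> S \<le> prob ({x \<in> space \<Omega>. Z n x \<in> S} \<union> ?B n)"
      unfolding eq by (rule finite_measure_mono) auto
    also have "\<dots> \<le> measure (\<mu> n) S + prob (?B n)"
      unfolding eq by (rule measure_Un_le) auto
    finally show ?case using elim by simp
  qed
qed

lemma (in prob_space) real_distribution_distr_real:
  "f \<in> borel_measurable M \<Longrightarrow> real_distribution (distr M borel f)"
  by (simp add: real_distribution_def real_distribution_axioms_def prob_space_distr)

definition law_tendsto :: "'a measure \<Rightarrow> (real \<Rightarrow> 'a \<Rightarrow> real) \<Rightarrow> real measure \<Rightarrow> bool" where
  "law_tendsto M Z \<nu> \<longleftrightarrow> (\<forall>e. (\<forall>n. 0 < e n) \<longrightarrow> e \<longlonglongrightarrow> 0 \<longrightarrow>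
     weak_conv_m (\<lambda>n. distr M borel (Z (e n))) \<nu>)"

lemma (in prob_space) law_tendsto_open:
  assumes "law_tendsto M Z \<nu>" "real_distribution \<nu>" "\<And>t. 0 < t \<Longrightarrow> Z t \<in> borel_measurable M"
    and "open S" "r < measure \<nu> S"
  shows "\<forall>\<^sub>F t in at_right 0. r < prob {\<omega> \<in> space M. Z t \<omega> \<in> S}"
proof (rule sequentially_imp_eventually_at_right[of 0 1])
  fix e :: "nat \<Rightarrow> real" assume e: "\<And>n. 0 < e n" "e \<longlonglongrightarrow> 0"
  have "\<forall>\<^sub>F n in sequentially. r < measure (distr M borel (Z (e n))) S"
    by (rule portmanteau_open[OF _ assms(2) _ assms(4,5)])
      (use assms(1,3) e in \<open>auto simp: law_tendsto_def intro!: real_distribution_distr_real\<close>)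
  moreover have "measure (distr M borel (Z (e n))) S = prob {\<omega> \<in> space M. Z (e n) \<omega> \<in> S}" for n
    using assms(3)[OF e(1)] assms(4) by (subst measure_distr) (auto intro!: arg_cong[where f = prob])
  ultimately show "\<forall>\<^sub>F n in sequentially. r < prob {\<omega> \<in> space M. Z (e n) \<omega> \<in> S}" by simp
qed simp

lemma (in prob_space) law_tendsto_closed:
  assumes "law_tendsto M Z \<nu>" "real_distribution \<nu>" "\<And>t. 0 < t \<Longrightarrow> Z t \<in> borel_measurable M"
    and "closed S" "measure \<nu> S < r"
  shows "\<forall>\<^sub>F t in at_right 0. prob {\<omega> \<in> space M. Z t \<omega> \<in> S} < r"
proof -
  interpret \<nu>: real_distribution \<nu> by fact
  have S: "S \<in> sets borel" using assms(4) by simp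
  have "1 - r < measure \<nu> (- S)"
    using \<nu>.prob_compl[of S] S assms(5) by (simp add: Compl_eq_Diff_UNIV)
  then have "\<forall>\<^sub>F t in at_right 0. 1 - r < prob {\<omega> \<in> space M. Z t \<omega> \<in> - S}"
    using assms(1-4) by (intro law_tendsto_open) auto
  then show ?thesis
    using eventually_at_right_less[of 0]
  proof eventually_elim
    case (elim t)
    have [measurable]: "Z t \<in> borel_measurable M" "S \<in> sets borel" using assms(3)[OF elim(2)] S by auto
    show ?case using elim(1) prob_neg[of "\<lambda>\<omega>. Z t \<omega> \<in> S"] by simp
  qed
qed

section \<open>Characteristic functions of increments, and atoms at zero\<close>

context levy_process
begin

lemma increment_char:
  assumes "0 \<le> s" "0 \<le> t"
  shows "char (distr M borel (\<lambda>\<omega>. X (s + t) \<omega> / b)) u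
    = char (distr M borel (\<lambda>\<omega>. X s \<omega> / b)) u * char (distr M borel (\<lambda>\<omega>. X t \<omega> / b)) u"
proof -
  define T where "T i = (if i = 0 then 0 else if i = 1 then s else s + t)" for i :: nat
  have [measurable]: "X 0 \<in> borel_measurable M" "X s \<in> borel_measurable M" "X t \<in> borel_measurable M"
    "X (s + t) \<in> borel_measurable M"
    using assms by (auto intro!: measurable_X)
  have "indep_vars (\<lambda>_. borel) (\<lambda>i \<omega>. X (T (Suc i)) \<omega> - X (T i) \<omega>) {..<2}"
    by (rule indep_increments) (use assms in \<open>auto simp: T_def\<close>)
  then have iv: "indep_vars (\<lambda>_. borel) (\<lambda>i \<omega>. (X (T (Suc i)) \<omega> - X (T i) \<omega>) / b) {..<2}"
    by (rule indep_vars_compose2[where Y = "\<lambda>_ x. x / b"]) auto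
  have "char (distr M borel (\<lambda>\<omega>. \<Sum>i<2. (X (T (Suc i)) \<omega> - X (T i) \<omega>) / b)) u
      = (\<Prod>i<2. char (distr M borel (\<lambda>\<omega>. (X (T (Suc i)) \<omega> - X (T i) \<omega>) / b)) u)"
    by (rule char_distr_sum) (fact iv)
  moreover have "(\<Sum>i<2. (X (T (Suc i)) \<omega> - X (T i) \<omega>) / b) = (X (s + t) \<omega> - X 0 \<omega>) / b" for \<omega>
    by (simp add: T_def numeral_2_eq_2 diff_divide_distrib)
  moreover have "distr M borel (\<lambda>\<omega>. (X (s + t) \<omega> - X 0 \<omega>) / b) = distr M borel (\<lambda>\<omega>. X (s + t) \<omega> / b)"
    by (rule distr_cong_AE) (use start_zero in \<open>auto elim!: eventually_mono\<close>)
  moreover have "distr M borel (\<lambda>\<omega>. (X s \<omega> - X 0 \<omega>) / b) = distr M borel (\<lambda>\<omega>. X s \<omega> / b)"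
    by (rule distr_cong_AE) (use start_zero in \<open>auto elim!: eventually_mono\<close>)
  moreover have "distr M borel (\<lambda>\<omega>. (X (s + t) \<omega> - X s \<omega>) / b) = distr M borel (\<lambda>\<omega>. X t \<omega> / b)"
  proof -
    have "distr (distr M borel (\<lambda>\<omega>. X (s + t) \<omega> - X s \<omega>)) borel (\<lambda>x. x / b) = distr (distr M borel (X t)) borel (\<lambda>x. x / b)"
      using stationary_increments[of s "s + t"] assms by simp
    then show ?thesis by (simp add: distr_distr comp_def)
  qed
  ultimately show ?thesis by (simp add: T_def numeral_2_eq_2)
qed

text \<open>The events \<open>X\<^sub>1 = 0\<close> and \<open>X\<^bsub>1+1/n\<^esub> = 0\<close> are independent, hence \<open>X\<^sub>1 \<noteq> 0\<close> and \<open>X\<^bsub>1+1/n\<^esub> = 0\<close> hold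
  together with probability \<open>q (1 - q)\<close>. By right-continuity this probability tends to \<open>0\<close>.\<close>

lemma zero_one_if_constant_atom:
  assumes q: "\<And>t. 0 < t \<Longrightarrow> prob {\<omega> \<in> space M. X t \<omega> = 0} = q"
  shows "q = 0 \<or> q = 1"
proof -
  have m [measurable]: "X t \<in> borel_measurable M" if "0 \<le> t" for t
    using that by (rule measurable_X)
  define t where "t n = 1 + 1 / real (Suc n)" for n
  have t: "1 < t n" for n by (simp add: t_def)
  have [measurable]: "X 1 \<in> borel_measurable M" "X (t n) \<in> borel_measurable M" for n
    using t[of n] by (auto intro!: m)
  let ?E = "\<lambda>n. {\<omega> \<in> space M. X 1 \<omega> \<noteq> 0 \<and> X (t n) \<omega> = 0}"
  have "(\<lambda>n. expectation (indicat_real (?E n))) \<longlonglongrightarrow> expectation (\<lambda>_. 0)"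
  proof (rule integral_dominated_convergence[where w = "\<lambda>_. 1"])
    show "AE \<omega> in M. (\<lambda>n. indicat_real (?E n) \<omega>) \<longlonglongrightarrow> 0"
      using cadlag_paths
    proof eventually_elim
      case (elim \<omega>)
      show ?case
      proof (cases "X 1 \<omega> = 0")
        case False
        have "((\<lambda>t. X t \<omega>) \<longlongrightarrow> X 1 \<omega>) (at_right 1)"
          using elim by (auto simp: cadlag_def continuous_within)
        moreover have "filterlim t (at_right 1) sequentially"
        proof -
          have "t \<longlonglongrightarrow> 1 + 0"
            unfolding t_def[abs_def] by (intro tendsto_add tendsto_const LIMSEQ_Suc[OF lim_inverse_n'])
          then show ?thesis using t less_imp_neq[OF t, symmetric] by (auto simp: filterlim_at)
        qed
        ultimately have "(\<lambda>n. X (t n) \<omega>) \<longlonglongrightarrow> X 1 \<omega>" by (rule filterlim_compose)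
        then have "\<forall>\<^sub>F n in sequentially. X (t n) \<omega> \<noteq> 0"
          using False by (rule tendsto_imp_eventually_ne)
        then have "\<forall>\<^sub>F n in sequentially. indicat_real (?E n) \<omega> = 0"
          by (auto elim!: eventually_mono)
        then show ?thesis by (rule tendsto_eventually)
      qed simp
    qed
  qed auto
  then have lim: "(\<lambda>n. prob (?E n)) \<longlonglongrightarrow> 0" by simp
  have "prob (?E n) = q - q * q" for n
  proof -
    define T where "T i = (if i = 0 then 0 else if i = 1 then 1 else t n)" for i :: nat
    have iv: "indep_vars (\<lambda>_. borel) (\<lambda>i \<omega>. X (T (Suc i)) \<omega> - X (T i) \<omega>) {..<2}"
      by (rule indep_increments) (use t[of n] in \<open>auto simp: T_def\<close>)
    have "prob (\<Inter>i\<in>{0,1}. (\<lambda>\<omega>. X (T (Suc i)) \<omega> - X (T i) \<omega>) -` {0} \<inter> space M)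
        = (\<Prod>i\<in>{0,1}. prob ((\<lambda>\<omega>. X (T (Suc i)) \<omega> - X (T i) \<omega>) -` {0} \<inter> space M))"
      by (rule indep_varsD[OF iv]) auto
    then have "prob (((\<lambda>\<omega>. X 1 \<omega> - X 0 \<omega>) -` {0} \<inter> space M) \<inter> ((\<lambda>\<omega>. X (t n) \<omega> - X 1 \<omega>) -` {0} \<inter> space M))
        = prob ((\<lambda>\<omega>. X 1 \<omega> - X 0 \<omega>) -` {0} \<inter> space M) * prob ((\<lambda>\<omega>. X (t n) \<omega> - X 1 \<omega>) -` {0} \<inter> space M)"
      by (simp add: T_def)
    moreover have "prob (((\<lambda>\<omega>. X 1 \<omega> - X 0 \<omega>) -` {0} \<inter> space M) \<inter> ((\<lambda>\<omega>. X (t n) \<omega> - X 1 \<omega>) -` {0} \<inter> space M))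
        = prob {\<omega> \<in> space M. X 1 \<omega> = 0 \<and> X (t n) \<omega> = 0}"
      by (rule finite_measure_eq_AE) (use start_zero in \<open>auto elim!: eventually_mono\<close>)
    moreover have "prob ((\<lambda>\<omega>. X 1 \<omega> - X 0 \<omega>) -` {0} \<inter> space M) = prob {\<omega> \<in> space M. X 1 \<omega> = 0}"
      by (rule finite_measure_eq_AE) (use start_zero in \<open>auto elim!: eventually_mono\<close>)
    moreover have "prob ((\<lambda>\<omega>. X (t n) \<omega> - X 1 \<omega>) -` {0} \<inter> space M) = q"
    proof -
      have "prob ((\<lambda>\<omega>. X (t n) \<omega> - X 1 \<omega>) -` {0} \<inter> space M) = measure (distr M borel (\<lambda>\<omega>. X (t n) \<omega> - X 1 \<omega>)) {0}"
        by (rule measure_distr[symmetric]) auto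
      also have "\<dots> = measure (distr M borel (X (t n - 1))) {0}"
        using stationary_increments[of 1 "t n"] t[of n] by simp
      also have "\<dots> = prob {\<omega> \<in> space M. X (t n - 1) \<omega> = 0}"
        using t[of n] by (subst measure_distr) (auto intro!: arg_cong[where f = prob] m)
      finally show ?thesis using q[of "t n - 1"] t[of n] by simp
    qed
    ultimately have both: "prob {\<omega> \<in> space M. X 1 \<omega> = 0 \<and> X (t n) \<omega> = 0} = q * q"
      using q[of 1] by simp
    have "prob {\<omega> \<in> space M. X (t n) \<omega> = 0} = prob ({\<omega> \<in> space M. X 1 \<omega> = 0 \<and> X (t n) \<omega> = 0} \<union> ?E n)"
      by (rule arg_cong[where f = prob]) auto
    also have "\<dots> = prob {\<omega> \<in> space M. X 1 \<omega> = 0 \<and> X (t n) \<omega> = 0} + prob (?E n)"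
      by (rule finite_measure_Union) auto
    finally show ?thesis using both q[of "t n"] t[of n] by simp
  qed
  then have "q - q * q = 0" using lim by (simp add: LIMSEQ_const_iff)
  then show ?thesis by (simp add: algebra_simps)
qed

end

lemma self_similar_marginal:
  assumes "levy_process N Y" "self_similar N Y H" "0 < c"
  shows "distr N borel (Y c) = distr N borel (\<lambda>\<omega>. c powr H * Y 1 \<omega>)"
proof -
  interpret levy_process N Y by fact
  let ?P = "\<Pi>\<^sub>M t\<in>{0::real..}. (borel :: real measure)"
  have m [measurable]: "Y t \<in> borel_measurable N" if "0 \<le> t" for t using that by (rule measurable_X)
  have 1: "(\<lambda>\<omega>. \<lambda>t\<in>{0..}. Y (c * t) \<omega>) \<in> measurable N ?P"
    by (rule measurable_restrict) (use assms(3) in \<open>auto intro!: m\<close>)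
  have 2: "(\<lambda>\<omega>. \<lambda>t\<in>{0..}. c powr H * Y t \<omega>) \<in> measurable N ?P"
    by (rule measurable_restrict) (auto intro!: borel_measurable_times m)
  have p: "(\<lambda>f. f 1) \<in> measurable ?P borel"
    by (rule measurable_component_singleton) simp
  have "distr (distr N ?P (\<lambda>\<omega>. \<lambda>t\<in>{0..}. Y (c * t) \<omega>)) borel (\<lambda>f. f 1)
      = distr (distr N ?P (\<lambda>\<omega>. \<lambda>t\<in>{0..}. c powr H * Y t \<omega>)) borel (\<lambda>f. f 1)"
    using assms(2,3) by (simp add: self_similar_def)
  then show ?thesis
    by (simp add: distr_distr[OF p 1] distr_distr[OF p 2] comp_def)
qed

section \<open>The attracted process and its limit\<close>

locale attracted_levy_process = levy_process M X for M :: "'a measure" and X +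
  fixes a :: "real \<Rightarrow> real" and N :: "'b measure" and Y :: "real \<Rightarrow> 'b \<Rightarrow> real" and \<alpha> \<rho> :: real
  assumes a_pos: "\<And>t. 0 < t \<Longrightarrow> 0 < a t"
    and limit_levy: "levy_process N Y"
    and nonzero: "\<not> (AE \<omega> in N. Y 1 \<omega> = 0)"
    and conv: "law_tendsto M (\<lambda>t \<omega>. X t \<omega> / a t) (distr N borel (Y 1))"
    and \<alpha>_pos: "0 < \<alpha>"
    and self_sim: "self_similar N Y (1 / \<alpha>)"
    and \<rho>: "\<rho> = measure N {\<omega> \<in> space N. 0 < Y 1 \<omega>}"
begin

sublocale L: levy_process N Y by (rule limit_levy)

abbreviation \<nu> :: "real measure" where "\<nu> \<equiv> distr N borel (Y 1)"

lemma Y1_measurable [measurable]: "Y 1 \<in> borel_measurable N"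
  by (rule L.measurable_X) simp

lemma \<nu>_distribution: "real_distribution \<nu>"
  by (rule L.real_distribution_distr_real) measurable

lemma \<nu>_eq: "A \<in> sets borel \<Longrightarrow> measure \<nu> A = L.prob {\<omega> \<in> space N. Y 1 \<omega> \<in> A}"
  by (subst measure_distr) (auto intro!: arg_cong[where f = L.prob])

text \<open>Self-similarity makes the mass at 0 the same for all times \<open>t > 0\<close>; the
  zero-one law and the assumption that the limit is non-zero leave only the value 0. Thus the
  negative half-line has mass \<open>1 - \<rho>\<close>.\<close>

lemma limit_no_atom: "L.prob {\<omega> \<in> space N. Y 1 \<omega> = 0} = 0"
proof -
  let ?q = "L.prob {\<omega> \<in> space N. Y 1 \<omega> = 0}"
  have "L.prob {\<omega> \<in> space N. Y t \<omega> = 0} = ?q" if t: "0 < t" for t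
  proof -
    have [measurable]: "Y t \<in> borel_measurable N" using t by (intro L.measurable_X) simp
    have "L.prob {\<omega> \<in> space N. Y t \<omega> = 0} = measure (distr N borel (Y t)) {0}"
      by (subst measure_distr) (auto intro!: arg_cong[where f = L.prob])
    also have "\<dots> = measure (distr N borel (\<lambda>\<omega>. t powr (1 / \<alpha>) * Y 1 \<omega>)) {0}"
      using self_similar_marginal[OF limit_levy self_sim t] by simp
    also have "\<dots> = ?q"
      using t by (subst measure_distr) (auto intro!: arg_cong[where f = L.prob])
    finally show ?thesis .
  qed
  then have "?q = 0 \<or> ?q = 1" by (rule L.zero_one_if_constant_atom)
  moreover have "?q \<noteq> 1"
    using nonzero L.AE_prob_1[of "{\<omega> \<in> space N. Y 1 \<omega> = 0}"] by auto
  ultimately show ?thesis by blast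
qed

lemma prob_scaled_open:
  assumes "open S" "r < L.prob {\<omega> \<in> space N. Y 1 \<omega> \<in> S}"
  shows "\<forall>\<^sub>F t in at_right 0. r < prob {\<omega> \<in> space M. X t \<omega> / a t \<in> S}"
  using assms by (intro law_tendsto_open[OF conv \<nu>_distribution]) (auto simp: \<nu>_eq)

lemma prob_scaled_closed:
  assumes "closed S" "L.prob {\<omega> \<in> space N. Y 1 \<omega> \<in> S} < r"
  shows "\<forall>\<^sub>F t in at_right 0. prob {\<omega> \<in> space M. X t \<omega> / a t \<in> S} < r"
  using assms by (intro law_tendsto_closed[OF conv \<nu>_distribution]) (auto simp: \<nu>_eq)

text \<open>Independent stationary increments square the characteristic function: that of
  \<open>X (2 * t) / a t\<close> tends to the square of that of \<open>Y 1\<close>, which belongs to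
  \<open>Y 2\<close>, and self-similarity identifies the law of \<open>Y 2\<close>.\<close>

lemma doubled_conv:
  "law_tendsto M (\<lambda>t \<omega>. X (2 * t) \<omega> / a t) (distr N borel (\<lambda>\<omega>. 2 powr (1 / \<alpha>) * Y 1 \<omega>))"
  unfolding law_tendsto_def
proof safe
  fix e :: "nat \<Rightarrow> real" assume e: "\<forall>n. 0 < e n" "e \<longlonglongrightarrow> 0"
  have [measurable]: "Y 2 \<in> borel_measurable N" by (rule L.measurable_X) simp
  show "weak_conv_m (\<lambda>n. distr M borel (\<lambda>\<omega>. X (2 * e n) \<omega> / a (e n))) (distr N borel (\<lambda>\<omega>. 2 powr (1 / \<alpha>) * Y 1 \<omega>))"
  proof (rule levy_continuity)
    have m: "X (e n) \<in> borel_measurable M" "X (2 * e n) \<in> borel_measurable M" for n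
      using e(1) by (intro measurable_X, simp add: less_imp_le)+
    show "real_distribution (distr M borel (\<lambda>\<omega>. X (2 * e n) \<omega> / a (e n)))" for n
      using m by (intro real_distribution_distr_real) simp
    show "real_distribution (distr N borel (\<lambda>\<omega>. 2 powr (1 / \<alpha>) * Y 1 \<omega>))"
      by (intro L.real_distribution_distr_real) simp
    fix u
    have "(\<lambda>n. char (distr M borel (\<lambda>\<omega>. X (e n) \<omega> / a (e n))) u) \<longlonglongrightarrow> char \<nu> u"
      using conv e m by (intro levy_continuity1 \<nu>_distribution real_distribution_distr_real) (auto simp: law_tendsto_def)
    then have "(\<lambda>n. char (distr M borel (\<lambda>\<omega>. X (e n) \<omega> / a (e n))) u * char (distr M borel (\<lambda>\<omega>. X (e n) \<omega> / a (e n))) u)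
      \<longlonglongrightarrow> char \<nu> u * char \<nu> u"
      by (intro tendsto_mult)
    moreover have "char (distr M borel (\<lambda>\<omega>. X (2 * e n) \<omega> / a (e n))) u
        = char (distr M borel (\<lambda>\<omega>. X (e n) \<omega> / a (e n))) u * char (distr M borel (\<lambda>\<omega>. X (e n) \<omega> / a (e n))) u" for n
      using increment_char[of "e n" "e n" "a (e n)" u] e(1) by (simp add: less_imp_le)
    moreover have "char (distr N borel (\<lambda>\<omega>. 2 powr (1 / \<alpha>) * Y 1 \<omega>)) u = char \<nu> u * char \<nu> u"
      using L.increment_char[of 1 1 1 u] self_similar_marginal[OF limit_levy self_sim, of 2] by simp
    ultimately show "(\<lambda>n. char (distr M borel (\<lambda>\<omega>. X (2 * e n) \<omega> / a (e n))) u)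
      \<longlonglongrightarrow> char (distr N borel (\<lambda>\<omega>. 2 powr (1 / \<alpha>) * Y 1 \<omega>)) u" by simp
  qed
qed

end

lemma (in prob_space) prob_tendsto:
  fixes A :: "nat \<Rightarrow> 'a set"
  assumes "\<And>n. A n \<in> events" "B \<in> events"
    and "\<And>\<omega>. \<omega> \<in> space M \<Longrightarrow> \<forall>\<^sub>F n in sequentially. \<omega> \<in> A n \<longleftrightarrow> \<omega> \<in> B"
  shows "(\<lambda>n. prob (A n)) \<longlonglongrightarrow> prob B"
proof -
  have "(\<lambda>n. expectation (indicat_real (A n))) \<longlonglongrightarrow> expectation (indicat_real B)"
  proof (rule integral_dominated_convergence[where w = "\<lambda>_. 1"])
    show "AE \<omega> in M. (\<lambda>n. indicat_real (A n) \<omega>) \<longlonglongrightarrow> indicat_real B \<omega>"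
    proof (rule AE_I2)
      fix \<omega> assume "\<omega> \<in> space M"
      then have "\<forall>\<^sub>F n in sequentially. indicat_real (A n) \<omega> = indicat_real B \<omega>"
        by (rule eventually_mono[OF assms(3)]) (auto simp: indicator_def)
      then show "(\<lambda>n. indicat_real (A n) \<omega>) \<longlonglongrightarrow> indicat_real B \<omega>"
        by (rule tendsto_eventually)
    qed
  qed (use assms in auto)
  then show ?thesis using assms(1,2) by simp
qed

lemma (in prob_space) prob_pos_tendsto:
  assumes [measurable]: "Z \<in> borel_measurable M"
  shows "(\<lambda>n. prob {\<omega> \<in> space M. 1 / real (Suc n) < Z \<omega>}) \<longlonglongrightarrow> prob {\<omega> \<in> space M. 0 < Z \<omega>}"
proof (rule prob_tendsto)
  fix \<omega> assume "\<omega> \<in> space M"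
  show "\<forall>\<^sub>F n in sequentially. \<omega> \<in> {\<omega> \<in> space M. 1 / real (Suc n) < Z \<omega>} \<longleftrightarrow> \<omega> \<in> {\<omega> \<in> space M. 0 < Z \<omega>}"
  proof (cases "0 < Z \<omega>")
    case True
    then have "\<forall>\<^sub>F n in sequentially. 1 / real (Suc n) < Z \<omega>"
      using order_tendstoD(2)[OF LIMSEQ_Suc[OF lim_inverse_n'], of "Z \<omega>"] by simp
    then show ?thesis using True by (auto elim!: eventually_mono)
  next
    case False
    have "\<not> 1 / real (Suc n) < Z \<omega>" for n
      using False by (meson less_trans of_nat_0_less_iff zero_less_Suc zero_less_divide_1_iff)
    then show ?thesis using False by simp
  qed
qed auto

lemma closed_abs_ge: "closed {x::real. K \<le> \<bar>x\<bar>}"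
  by (intro closed_Collect_le continuous_intros)

lemma open_abs_gt: "open {x::real. K < \<bar>x\<bar>}"
  by (intro open_Collect_less continuous_intros)

text \<open>Repeated doubling brings each \<open>t\<close> into \<open>{\<tau>/2..\<tau>}\<close>.
  This is how power bounds for \<open>a\<close> are obtained from its ratios at the factor 2
  alone.\<close>

lemma doubling_induct:
  assumes "0 < \<tau>" and step: "\<And>t. 0 < t \<Longrightarrow> 2 * t \<le> \<tau> \<Longrightarrow> P (2 * t) \<Longrightarrow> P t"
    and base: "\<And>t. t \<in> {\<tau>/2..\<tau>} \<Longrightarrow> P t"
    and t: "0 < t" "t \<le> (\<tau> :: real)"
  shows "P t"
proof -
  have "P t" if "\<tau> / 2 ^ (Suc k) \<le> t" "0 < t" "t \<le> \<tau>" for k t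
    using that
  proof (induction k arbitrary: t)
    case 0
    show ?case by (rule base) (use 0 in auto)
  next
    case (Suc k)
    show ?case
    proof (cases "2 * t \<le> \<tau>")
      case True
      have "P (2 * t)" by (rule Suc.IH) (use True Suc.prems in \<open>auto simp: field_simps\<close>)
      then show ?thesis by (rule step[OF Suc.prems(2) True])
    next
      case False
      show ?thesis by (rule base) (use False Suc.prems in auto)
    qed
  qed
  moreover obtain k where "\<tau> / t < 2 ^ k" using real_arch_pow[of 2 "\<tau> / t"] by auto
  then have "\<tau> / 2 ^ (Suc k) \<le> t" using t assms(1) by (simp add: field_simps)
  ultimately show ?thesis using t by blast
qed

lemma powr_eventually_less:
  assumes "\<beta> < \<gamma>" "0 < k"
  shows "\<forall>\<^sub>F t in at_right 0. t powr \<gamma> < k * t powr (\<beta> :: real)"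
proof -
  have "((\<lambda>t. t powr (\<gamma> - \<beta>)) \<longlongrightarrow> 0) (at_right 0)"
    using assms(1) by (intro tendsto_zero_powrI[of "\<lambda>t. t"]) (auto intro: tendsto_ident_at simp: eventually_at_filter)
  then have "\<forall>\<^sub>F t in at_right 0. t powr (\<gamma> - \<beta>) < k" using assms(2) by (rule order_tendstoD)
  then show ?thesis using eventually_at_right_less[of 0]
    by eventually_elim (simp add: powr_diff field_simps)
qed

lemma eventually_at_right_scale:
  assumes "\<forall>\<^sub>F t in at_right 0. P t" "0 < (k::real)"
  shows "\<forall>\<^sub>F t in at_right 0. P (k * t)"
proof -
  obtain b where b: "0 < b" "\<And>t. 0 < t \<Longrightarrow> t < b \<Longrightarrow> P t"
    using assms(1) by (auto simp: eventually_at_right[of 0 1])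
  then show ?thesis
    using assms(2) by (auto simp: eventually_at_right[of 0 1] field_simps intro!: exI[of _ "b / k"])
qed

context levy_process
begin

lemma prob_increment:
  assumes "0 \<le> s" "0 \<le> t" "0 < \<eta>"
  shows "prob {\<omega> \<in> space M. \<eta> < \<bar>X s \<omega> - X t \<omega>\<bar>} = prob {\<omega> \<in> space M. \<eta> < \<bar>X \<bar>s - t\<bar> \<omega>\<bar>}"
proof -
  have *: "prob {\<omega> \<in> space M. \<eta> < \<bar>X t \<omega> - X s \<omega>\<bar>} = prob {\<omega> \<in> space M. \<eta> < \<bar>X (t - s) \<omega>\<bar>}"
    if "0 \<le> s" "s \<le> t" for s t
  proof -
    have [measurable]: "X s \<in> borel_measurable M" "X t \<in> borel_measurable M" "X (t - s) \<in> borel_measurable M"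
      using that by (auto intro!: measurable_X)
    have "prob {\<omega> \<in> space M. \<eta> < \<bar>X t \<omega> - X s \<omega>\<bar>} = measure (distr M borel (\<lambda>\<omega>. X t \<omega> - X s \<omega>)) {x. \<eta> < \<bar>x\<bar>}"
      by (subst measure_distr) (auto intro!: arg_cong[where f = prob])
    also have "\<dots> = measure (distr M borel (X (t - s))) {x. \<eta> < \<bar>x\<bar>}"
      using stationary_increments[OF that] by simp
    also have "\<dots> = prob {\<omega> \<in> space M. \<eta> < \<bar>X (t - s) \<omega>\<bar>}"
      by (subst measure_distr) (auto intro!: arg_cong[where f = prob])
    finally show ?thesis .
  qed
  show ?thesis
    using *[of s t] *[of t s] assms by (cases "s \<le> t") (auto simp: abs_minus_commute)
qed

lemma not_subordinator_negative:
  assumes "\<not> subordinator M X" "1 \<le> m"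
  shows "\<exists>b>0. 0 < prob {\<omega> \<in> space M. X (1 / real m) \<omega> < - b}"
proof -
  have [measurable]: "X (1 / real m) \<in> borel_measurable M" by (rule measurable_X) simp
  have "0 < prob {\<omega> \<in> space M. X (1 / real m) \<omega> < 0}"
    using prob_nonneg_grid_imp_subordinator[OF assms(2)] assms(1)
    by (metis less_eq_real_def measure_nonneg)
  then have "\<forall>\<^sub>F n in sequentially. 0 < prob {\<omega> \<in> space M. 1 / real (Suc n) < - X (1 / real m) \<omega>}"
    by (intro order_tendstoD(1)[OF prob_pos_tendsto]) auto
  then obtain n where "0 < prob {\<omega> \<in> space M. 1 / real (Suc n) < - X (1 / real m) \<omega>}"
    by (auto dest!: eventually_happens)
  then have "0 < prob {\<omega> \<in> space M. X (1 / real m) \<omega> < - (1 / real (Suc n))}"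
    by (simp add: less_minus_iff)
  then show ?thesis by (intro exI[of _ "1 / real (Suc n)"]) auto
qed

end

section \<open>Tails of the limit and power bounds for the normalising function\<close>

context attracted_levy_process
begin

lemma limit_tail_tendsto:
  assumes "1 < \<mu>" "0 < v"
  shows "(\<lambda>k. L.prob {\<omega> \<in> space N. \<mu> ^ k * v < \<bar>Y 1 \<omega>\<bar>}) \<longlonglongrightarrow> 0"
proof -
  have "(\<lambda>k. L.prob {\<omega> \<in> space N. \<mu> ^ k * v < \<bar>Y 1 \<omega>\<bar>}) \<longlonglongrightarrow> L.prob {}"
  proof (rule L.prob_tendsto)
    fix \<omega>
    obtain n where n: "\<bar>Y 1 \<omega>\<bar> / v < \<mu> ^ n" using real_arch_pow[OF assms(1)] by blast
    have "\<forall>\<^sub>F k in sequentially. \<bar>Y 1 \<omega>\<bar> \<le> \<mu> ^ k * v"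
      using eventually_ge_at_top[of n]
    proof eventually_elim
      case (elim k)
      have "\<mu> ^ n \<le> \<mu> ^ k" using elim assms by (intro power_increasing) auto
      then have "\<bar>Y 1 \<omega>\<bar> / v \<le> \<mu> ^ k" using n by linarith
      then show ?case using assms by (simp add: field_simps)
    qed
    then show "\<forall>\<^sub>F k in sequentially. \<omega> \<in> {\<omega> \<in> space N. \<mu> ^ k * v < \<bar>Y 1 \<omega>\<bar>} \<longleftrightarrow> \<omega> \<in> {}"
      by eventually_elim auto
  qed auto
  then show ?thesis by simp
qed

lemma limit_tail_positive: "\<exists>v>0. 0 < L.prob {\<omega> \<in> space N. v < \<bar>Y 1 \<omega>\<bar>}"
proof (rule ccontr)
  assume "\<not> ?thesis"
  then have z: "L.prob {\<omega> \<in> space N. v < \<bar>Y 1 \<omega>\<bar>} = 0" if "0 < v" for v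
    using that by (meson measure_nonneg order_antisym not_le)
  have "AE \<omega> in N. \<forall>n. \<not> 1 / real (Suc n) < \<bar>Y 1 \<omega>\<bar>"
    unfolding AE_all_countable using z by (subst (asm) L.prob_eq_0) auto
  then have "AE \<omega> in N. Y 1 \<omega> = 0"
  proof eventually_elim
    case (elim \<omega>)
    show ?case
    proof (rule ccontr)
      assume "Y 1 \<omega> \<noteq> 0"
      then obtain n where "inverse (real (Suc n)) < \<bar>Y 1 \<omega>\<bar>"
        using reals_Archimedean[of "\<bar>Y 1 \<omega>\<bar>"] by auto
      then show False using elim by (auto simp: inverse_eq_divide)
    qed
  qed
  then show False using nonzero by simp
qed

text \<open>Otherwise the tail would not decrease along \<open>\<mu> ^ k * v\<close> and could not
  tend to 0. The closed event on the left and the open one on the right are those for which weak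
  convergence gives the bounds needed.\<close>

lemma limit_tail_strict:
  assumes "1 < \<kappa>"
  shows "\<exists>v>0. L.prob {\<omega> \<in> space N. \<kappa> * v \<le> \<bar>Y 1 \<omega>\<bar>} < L.prob {\<omega> \<in> space N. v < \<bar>Y 1 \<omega>\<bar>}"
proof (rule ccontr)
  assume "\<not> ?thesis"
  then have le: "L.prob {\<omega> \<in> space N. v < \<bar>Y 1 \<omega>\<bar>} \<le> L.prob {\<omega> \<in> space N. \<kappa> * v \<le> \<bar>Y 1 \<omega>\<bar>}" if "0 < v" for v
    using that by (meson not_le)
  \<comment> \<open>The intermediate factor passes from the closed event back to an open one, so
    that the inequality can be iterated.\<close>
  obtain \<mu> where \<mu>: "1 < \<mu>" "\<mu> < \<kappa>" using dense[OF assms] by blast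
  have step: "L.prob {\<omega> \<in> space N. v < \<bar>Y 1 \<omega>\<bar>} \<le> L.prob {\<omega> \<in> space N. \<mu> * v < \<bar>Y 1 \<omega>\<bar>}" if "0 < v" for v
  proof -
    have "\<mu> * v < \<kappa> * v" using \<mu> that by simp
    then have "L.prob {\<omega> \<in> space N. \<kappa> * v \<le> \<bar>Y 1 \<omega>\<bar>} \<le> L.prob {\<omega> \<in> space N. \<mu> * v < \<bar>Y 1 \<omega>\<bar>}"
      by (intro L.finite_measure_mono) auto
    then show ?thesis using le[OF that] by linarith
  qed
  obtain v where v: "0 < v" "0 < L.prob {\<omega> \<in> space N. v < \<bar>Y 1 \<omega>\<bar>}"
    using limit_tail_positive by blast
  have "L.prob {\<omega> \<in> space N. v < \<bar>Y 1 \<omega>\<bar>} \<le> L.prob {\<omega> \<in> space N. \<mu> ^ k * v < \<bar>Y 1 \<omega>\<bar>}" for k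
  proof (induction k)
    case (Suc k)
    have "0 < \<mu> ^ k * v" using \<mu> v by simp
    from step[OF this] Suc show ?case by (simp add: mult.assoc)
  qed simp
  then have "L.prob {\<omega> \<in> space N. v < \<bar>Y 1 \<omega>\<bar>} \<le> 0"
    by (intro LIMSEQ_le_const[OF limit_tail_tendsto[OF \<mu>(1) v(1)]]) auto
  then show False using v by simp
qed

text \<open>Convergence of types: both \<open>X\<^bsub>2t\<^esub> / a (2t)\<close> and \<open>X\<^bsub>2t\<^esub> / a t\<close> converge in law, and the limits are
  \<open>Y\<^sub>1\<close> and a multiple of it.\<close>

lemma scaling_ratio:
  assumes "1 < \<kappa>"
  shows "\<forall>\<^sub>F t in at_right 0. a (2 * t) < \<kappa> * 2 powr (1 / \<alpha>) * a t \<and> 2 powr (1 / \<alpha>) * a t < \<kappa> * a (2 * t)"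
proof -
  define c where "c = 2 powr (1 / \<alpha>)"
  have c: "0 < c" by (simp add: c_def)
  obtain v where v: "0 < v"
    "L.prob {\<omega> \<in> space N. \<kappa> * v \<le> \<bar>Y 1 \<omega>\<bar>} < L.prob {\<omega> \<in> space N. v < \<bar>Y 1 \<omega>\<bar>}"
    using limit_tail_strict[OF assms] by blast
  \<comment> \<open>If one of the two inequalities failed at a small \<open>t\<close>, an event of
    probability above \<open>r\<close> would be contained in one of probability below
    \<open>r\<close>.\<close>
  then obtain r where r: "L.prob {\<omega> \<in> space N. \<kappa> * v \<le> \<bar>Y 1 \<omega>\<bar>} < r" "r < L.prob {\<omega> \<in> space N. v < \<bar>Y 1 \<omega>\<bar>}"
    using dense by blast
  let ?D = "distr N borel (\<lambda>\<omega>. c * Y 1 \<omega>)"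
  have D: "real_distribution ?D"
    by (rule L.real_distribution_distr_real) simp
  have D1: "measure ?D {x. \<kappa> * c * v \<le> \<bar>x\<bar>} = L.prob {\<omega> \<in> space N. \<kappa> * v \<le> \<bar>Y 1 \<omega>\<bar>}"
    using c by (subst measure_distr) (auto intro!: arg_cong[where f = L.prob] simp: abs_mult closed_abs_ge mult_ac)
  have D2: "measure ?D {x. c * v < \<bar>x\<bar>} = L.prob {\<omega> \<in> space N. v < \<bar>Y 1 \<omega>\<bar>}"
    using c by (subst measure_distr) (auto intro!: arg_cong[where f = L.prob] simp: abs_mult open_abs_gt)
  have m: "(\<lambda>\<omega>. X (2 * t) \<omega> / a t) \<in> borel_measurable M" if "0 < t" for t
    using that measurable_X[of "2 * t"] by auto
  have 1: "\<forall>\<^sub>F t in at_right 0. r < prob {\<omega> \<in> space M. X (2 * t) \<omega> / a (2 * t) \<in> {x. v < \<bar>x\<bar>}}"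
    by (rule eventually_at_right_scale[OF prob_scaled_open[OF open_abs_gt]]) (use r in auto)
  have 2: "\<forall>\<^sub>F t in at_right 0. prob {\<omega> \<in> space M. X (2 * t) \<omega> / a (2 * t) \<in> {x. \<kappa> * v \<le> \<bar>x\<bar>}} < r"
    by (rule eventually_at_right_scale[OF prob_scaled_closed[OF closed_abs_ge]]) (use r in auto)
  have 3: "\<forall>\<^sub>F t in at_right 0. r < prob {\<omega> \<in> space M. X (2 * t) \<omega> / a t \<in> {x. c * v < \<bar>x\<bar>}}"
    by (rule law_tendsto_open[OF doubled_conv[folded c_def] D m open_abs_gt]) (use r D2 in auto)
  have 4: "\<forall>\<^sub>F t in at_right 0. prob {\<omega> \<in> space M. X (2 * t) \<omega> / a t \<in> {x. \<kappa> * c * v \<le> \<bar>x\<bar>}} < r"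
    by (rule law_tendsto_closed[OF doubled_conv[folded c_def] D m closed_abs_ge]) (use r D1 in auto)
  show ?thesis
    using 1 2 3 4 eventually_at_right_less[of 0] unfolding c_def[symmetric]
  proof eventually_elim
    case (elim t)
    have a: "0 < a t" "0 < a (2 * t)" using elim(5) by (auto intro!: a_pos)
    have [measurable]: "X (2 * t) \<in> borel_measurable M" using elim(5) by (intro measurable_X) simp
    show ?case
    proof (intro conjI; rule ccontr)
      assume "\<not> a (2 * t) < \<kappa> * c * a t"
      then have le: "\<kappa> * c * a t \<le> a (2 * t)" by simp
      have "\<kappa> * c * v \<le> \<bar>x / a t\<bar>" if "v < \<bar>x / a (2 * t)\<bar>" for x
      proof -
        have "\<kappa> * c * a t * v \<le> a (2 * t) * v" using le v by (intro mult_right_mono) auto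
        also have "\<dots> \<le> \<bar>x\<bar>" using that a by (simp add: field_simps abs_divide)
        finally show ?thesis using a by (simp add: field_simps abs_divide)
      qed
      then have "prob {\<omega> \<in> space M. X (2 * t) \<omega> / a (2 * t) \<in> {x. v < \<bar>x\<bar>}}
          \<le> prob {\<omega> \<in> space M. X (2 * t) \<omega> / a t \<in> {x. \<kappa> * c * v \<le> \<bar>x\<bar>}}"
        by (intro finite_measure_mono) auto
      then show False using elim by linarith
    next
      assume "\<not> c * a t < \<kappa> * a (2 * t)"
      then have le: "\<kappa> * a (2 * t) \<le> c * a t" by simp
      have "\<kappa> * v \<le> \<bar>x / a (2 * t)\<bar>" if "c * v < \<bar>x / a t\<bar>" for x
      proof -
        have "\<kappa> * a (2 * t) * v \<le> c * a t * v" using le v by (intro mult_right_mono) auto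
        also have "\<dots> \<le> \<bar>x\<bar>" using that a by (simp add: field_simps abs_divide)
        finally show ?thesis using a by (simp add: field_simps abs_divide)
      qed
      then have "prob {\<omega> \<in> space M. X (2 * t) \<omega> / a t \<in> {x. c * v < \<bar>x\<bar>}}
          \<le> prob {\<omega> \<in> space M. X (2 * t) \<omega> / a (2 * t) \<in> {x. \<kappa> * v \<le> \<bar>x\<bar>}}"
        by (intro finite_measure_mono) auto
      then show False using elim by linarith
    qed
  qed
qed

lemma limit_tail_small:
  assumes "0 < \<epsilon>"
  shows "\<exists>K>0. L.prob {\<omega> \<in> space N. K \<le> \<bar>Y 1 \<omega>\<bar>} < \<epsilon>"
proof -
  have "\<forall>\<^sub>F k in sequentially. L.prob {\<omega> \<in> space N. 2 ^ k * 1 < \<bar>Y 1 \<omega>\<bar>} < \<epsilon>"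
    using limit_tail_tendsto[of 2 1] assms by (auto dest: order_tendstoD)
  then obtain k where k: "L.prob {\<omega> \<in> space N. 2 ^ k < \<bar>Y 1 \<omega>\<bar>} < \<epsilon>"
    by (auto dest!: eventually_happens)
  have "L.prob {\<omega> \<in> space N. 2 ^ k + 1 \<le> \<bar>Y 1 \<omega>\<bar>} \<le> L.prob {\<omega> \<in> space N. 2 ^ k < \<bar>Y 1 \<omega>\<bar>}"
    by (rule L.finite_measure_mono) auto
  then show ?thesis using k by (intro exI[of _ "2 ^ k + 1"]) (auto intro: add_pos_pos)
qed

text \<open>The absolute value of \<open>X t\<close> exceeds \<open>v * a t\<close> with a
  probability bounded away from 0, whereas it tends to 0 in probability.\<close>

lemma scaling_bounded:
  "\<exists>C>0. \<forall>\<^sub>F t in at_right 0. a t \<le> C"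
proof -
  obtain v where v: "0 < v" "0 < L.prob {\<omega> \<in> space N. v < \<bar>Y 1 \<omega>\<bar>}"
    using limit_tail_positive by blast
  then obtain k where k: "0 < k" "k < L.prob {\<omega> \<in> space N. v < \<bar>Y 1 \<omega>\<bar>}" using dense by blast
  have "\<forall>\<^sub>F t in at_right 0. k < prob {\<omega> \<in> space M. X t \<omega> / a t \<in> {x. v < \<bar>x\<bar>}}"
    by (rule prob_scaled_open[OF open_abs_gt]) (use k in auto)
  moreover have "\<forall>\<^sub>F t in at_right 0. prob {\<omega> \<in> space M. 1 < \<bar>X t \<omega>\<bar>} < k"
    by (rule order_tendstoD(2)[OF stochastic_continuity]) (use k in auto)
  ultimately have "\<forall>\<^sub>F t in at_right 0. a t \<le> 1 / v"
    using eventually_at_right_less[of 0]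
  proof eventually_elim
    case (elim t)
    have a: "0 < a t" using elim by (simp add: a_pos)
    have [measurable]: "X t \<in> borel_measurable M" using elim by (intro measurable_X) simp
    show ?case
    proof (rule ccontr)
      assume "\<not> a t \<le> 1 / v"
      then have *: "1 < v * a t" using v by (simp add: field_simps)
      have "1 < \<bar>x\<bar>" if "v < \<bar>x / a t\<bar>" for x
      proof -
        have "v * a t < \<bar>x\<bar>" using that a by (simp add: field_simps abs_divide)
        then show ?thesis using * by linarith
      qed
      then have "prob {\<omega> \<in> space M. X t \<omega> / a t \<in> {x. v < \<bar>x\<bar>}} \<le> prob {\<omega> \<in> space M. 1 < \<bar>X t \<omega>\<bar>}"
        by (intro finite_measure_mono) auto
      then show False using elim by linarith
    qed
  qed
  then show ?thesis using v by (intro exI[of _ "1 / v"]) auto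
qed

text \<open>The function \<open>a\<close> is arbitrary away from \<open>0\<close>. Where it were too small, \<open>X\<^sub>T\<close> would be
  concentrated near \<open>0\<close>, hence so would a limit point in time.\<close>

lemma scaling_bounded_below:
  "\<exists>\<tau>0>0. \<forall>\<tau>. 0 < \<tau> \<longrightarrow> \<tau> < \<tau>0 \<longrightarrow> (\<exists>b>0. \<forall>t\<in>{\<tau>/2..\<tau>}. b \<le> a t)"
proof -
  obtain K where K: "0 < K" "L.prob {\<omega> \<in> space N. K \<le> \<bar>Y 1 \<omega>\<bar>} < 1 / 8"
    using limit_tail_small[of "1/8"] by auto
  have "\<forall>\<^sub>F t in at_right 0. prob {\<omega> \<in> space M. X t \<omega> / a t \<in> {x. K \<le> \<bar>x\<bar>}} < 1 / 8"
    by (rule prob_scaled_closed[OF closed_abs_ge]) (use K in auto)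
  moreover have "\<forall>\<^sub>F t in at_right 0. prob {\<omega> \<in> space M. X t \<omega> / a t \<in> {0}} < 1 / 2"
    by (rule prob_scaled_closed) (use limit_no_atom in auto)
  ultimately have "\<forall>\<^sub>F t in at_right 0. prob {\<omega> \<in> space M. X t \<omega> / a t \<in> {x. K \<le> \<bar>x\<bar>}} < 1 / 8
      \<and> prob {\<omega> \<in> space M. X t \<omega> / a t \<in> {0}} < 1 / 2"
    by (rule eventually_conj)
  then obtain \<tau>0 where \<tau>0: "0 < \<tau>0"
    and big: "\<And>t. 0 < t \<Longrightarrow> t < \<tau>0 \<Longrightarrow> prob {\<omega> \<in> space M. X t \<omega> / a t \<in> {x. K \<le> \<bar>x\<bar>}} < 1 / 8"
    and zero: "\<And>t. 0 < t \<Longrightarrow> t < \<tau>0 \<Longrightarrow> prob {\<omega> \<in> space M. X t \<omega> / a t \<in> {0}} < 1 / 2"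
    by (auto simp: eventually_at_right[of 0 1])
  have "\<exists>b>0. \<forall>t\<in>{\<tau>/2..\<tau>}. b \<le> a t" if \<tau>: "0 < \<tau>" "\<tau> < \<tau>0" for \<tau>
  proof (rule ccontr)
    assume "\<not> ?thesis"
    then have "\<forall>n. \<exists>t\<in>{\<tau>/2..\<tau>}. a t < 1 / real (Suc n)"
      by (metis not_le of_nat_0_less_iff zero_less_Suc zero_less_divide_1_iff)
    then obtain T where T: "\<And>n. T n \<in> {\<tau>/2..\<tau>}" "\<And>n. a (T n) < 1 / real (Suc n)" by metis
    obtain T' r where r: "T' \<in> {\<tau>/2..\<tau>}" "strict_mono r" "(T \<circ> r) \<longlonglongrightarrow> T'"
      using compact_imp_seq_compact[OF compact_Icc[of "\<tau>/2" \<tau>]] T(1) unfolding seq_compact_def by metis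
    have T'0: "0 < T'" "T' < \<tau>0" using r \<tau> by auto
    have [measurable]: "X T' \<in> borel_measurable M" "X (T n) \<in> borel_measurable M" for n
      using T(1)[of n] r(1) \<tau> by (auto intro!: measurable_X)
    \<comment> \<open>\<open>X T'\<close> is compared with \<open>X (T (r n))\<close>, which is
      small because \<open>a (T (r n))\<close> is; each of the two deviations has probability at
      most 1/8. Letting \<eta> tend to 0, \<open>X T'\<close> would vanish with probability at least
      3/4, against the bound 1/2.\<close>
    have small: "prob {\<omega> \<in> space M. \<eta> < \<bar>X T' \<omega>\<bar>} \<le> 1 / 4" if \<eta>: "0 < \<eta>" for \<eta>
    proof -
      have "\<forall>\<^sub>F t in at_right 0. prob {\<omega> \<in> space M. \<eta> / 2 < \<bar>X t \<omega>\<bar>} < 1 / 8"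
        by (rule order_tendstoD(2)[OF stochastic_continuity]) (use \<eta> in auto)
      then obtain d where d: "0 < d" "\<And>t. 0 < t \<Longrightarrow> t < d \<Longrightarrow> prob {\<omega> \<in> space M. \<eta> / 2 < \<bar>X t \<omega>\<bar>} < 1 / 8"
        by (auto simp: eventually_at_right[of 0 1])
      have "\<forall>\<^sub>F n in sequentially. dist ((T \<circ> r) n) T' < d"
        using r(3) d(1) by (rule tendstoD)
      moreover have "\<forall>\<^sub>F n in sequentially. 1 / real (Suc n) < \<eta> / (2 * K)"
        using order_tendstoD(2)[OF LIMSEQ_Suc[OF lim_inverse_n'], of "\<eta> / (2 * K)"] \<eta> K(1) by simp
      ultimately have "\<forall>\<^sub>F n in sequentially. dist ((T \<circ> r) n) T' < d \<and> 1 / real (Suc n) < \<eta> / (2 * K)"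
        by (rule eventually_conj)
      then obtain n where n: "\<bar>T (r n) - T'\<bar> < d" "1 / real (Suc n) < \<eta> / (2 * K)"
        by (auto dest!: eventually_happens simp: dist_real_def)
      have "a (T (r n)) < 1 / real (Suc (r n))" by (rule T)
      also have "\<dots> \<le> 1 / real (Suc n)"
        using seq_suble[OF r(2), of n] by (intro divide_left_mono) auto
      also have "\<dots> < \<eta> / (2 * K)" by (rule n)
      finally have aT: "K * a (T (r n)) < \<eta> / 2" using K by (simp add: field_simps)
      have Tn: "0 < T (r n)" "T (r n) < \<tau>0" using T(1)[of "r n"] \<tau> by auto
      have 1: "prob {\<omega> \<in> space M. \<eta> / 2 < \<bar>X (T (r n)) \<omega>\<bar>} \<le> 1 / 8"
      proof -
        have "K \<le> \<bar>x / a (T (r n))\<bar>" if "\<eta> / 2 < \<bar>x\<bar>" for x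
          using that aT a_pos[OF Tn(1)] by (simp add: abs_divide field_simps)
        then have "prob {\<omega> \<in> space M. \<eta> / 2 < \<bar>X (T (r n)) \<omega>\<bar>}
            \<le> prob {\<omega> \<in> space M. X (T (r n)) \<omega> / a (T (r n)) \<in> {x. K \<le> \<bar>x\<bar>}}"
          by (intro finite_measure_mono) auto
        then show ?thesis using big[OF Tn] by linarith
      qed
      have 2: "prob {\<omega> \<in> space M. \<eta> / 2 < \<bar>X T' \<omega> - X (T (r n)) \<omega>\<bar>} \<le> 1 / 8"
      proof (cases "T (r n) = T'")
        case True
        then show ?thesis using \<eta> by simp
      next
        case False
        then show ?thesis
          using prob_increment[of T' "T (r n)" "\<eta> / 2"] \<eta> Tn T'0 n(1) less_imp_le[OF d(2)[of "\<bar>T' - T (r n)\<bar>"]]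
          by (simp add: abs_minus_commute)
      qed
      have tri: "\<eta> / 2 < \<bar>u\<bar> \<or> \<eta> / 2 < \<bar>w - u\<bar>" if "\<eta> < \<bar>w\<bar>" for u w :: real
        using that by arith
      have "prob {\<omega> \<in> space M. \<eta> < \<bar>X T' \<omega>\<bar>} \<le> prob ({\<omega> \<in> space M. \<eta> / 2 < \<bar>X (T (r n)) \<omega>\<bar>}
          \<union> {\<omega> \<in> space M. \<eta> / 2 < \<bar>X T' \<omega> - X (T (r n)) \<omega>\<bar>})"
        by (rule finite_measure_mono) (use tri in blast, measurable)
      also have "\<dots> \<le> 1 / 8 + 1 / 8"
        by (rule order_trans[OF measure_Un_le add_mono[OF 1 2]]) auto
      finally show ?thesis by simp
    qed
    have "(\<lambda>n. prob {\<omega> \<in> space M. 1 / real (Suc n) < \<bar>X T' \<omega>\<bar>}) \<longlonglongrightarrow> prob {\<omega> \<in> space M. X T' \<omega> \<noteq> 0}"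
      using prob_pos_tendsto[of "\<lambda>\<omega>. \<bar>X T' \<omega>\<bar>"] by simp
    then have "prob {\<omega> \<in> space M. X T' \<omega> \<noteq> 0} \<le> 1 / 4"
      by (rule LIMSEQ_le_const2) (use small in auto)
    moreover have "prob {\<omega> \<in> space M. X T' \<omega> = 0} < 1 / 2"
      using zero[OF T'0] a_pos[OF T'0(1)] by simp
    moreover have "prob {\<omega> \<in> space M. \<not> X T' \<omega> = 0} = 1 - prob {\<omega> \<in> space M. X T' \<omega> = 0}"
      by (rule prob_neg) simp
    ultimately show False by simp
  qed
  then show ?thesis using \<tau>0 by blast
qed

text \<open>\<kappa> is chosen such that the ratio bound reads
  \<open>a (2 * t) < 2 powr \<beta> * a t\<close>; iterating it compares \<open>a t\<close> with a
  value on \<open>{\<tau>/2..\<tau>}\<close>. There \<open>a\<close> may be irregular, and its lower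
  bound comes from \<open>scaling_bounded_below\<close>.\<close>

lemma scaling_lower:
  assumes "1 / \<alpha> < \<beta>"
  shows "\<exists>b>0. \<forall>\<^sub>F t in at_right 0. b * t powr \<beta> \<le> a t"
proof -
  define \<kappa> where "\<kappa> = 2 powr (\<beta> - 1 / \<alpha>)"
  have "1 < \<kappa>" unfolding \<kappa>_def by (rule gr_one_powr) (use assms in auto)
  then have "\<forall>\<^sub>F t in at_right 0. a (2 * t) < \<kappa> * 2 powr (1 / \<alpha>) * a t"
    by (auto intro: eventually_mono[OF scaling_ratio])
  moreover have "\<kappa> * 2 powr (1 / \<alpha>) = 2 powr \<beta>" by (simp add: \<kappa>_def flip: powr_add)
  ultimately obtain \<tau>1 where \<tau>1: "0 < \<tau>1" "\<And>t. 0 < t \<Longrightarrow> t < \<tau>1 \<Longrightarrow> a (2 * t) < 2 powr \<beta> * a t"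
    by (auto simp: eventually_at_right[of 0 1])
  obtain \<tau>0 where \<tau>0: "0 < \<tau>0" "\<And>\<tau>. 0 < \<tau> \<Longrightarrow> \<tau> < \<tau>0 \<Longrightarrow> \<exists>b>0. \<forall>t\<in>{\<tau>/2..\<tau>}. b \<le> a t"
    using scaling_bounded_below by blast
  obtain \<tau> where \<tau>: "0 < \<tau>" "\<tau> < min \<tau>0 \<tau>1" using dense[of 0 "min \<tau>0 \<tau>1"] \<tau>0 \<tau>1 by auto
  then obtain b where b: "0 < b" "\<And>t. t \<in> {\<tau>/2..\<tau>} \<Longrightarrow> b \<le> a t" using \<tau>0(2)[of \<tau>] by auto
  have \<beta>: "0 < \<beta>" using assms \<alpha>_pos by (meson less_trans zero_less_divide_1_iff)
  define b' where "b' = b / \<tau> powr \<beta>"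
  have "b' * t powr \<beta> \<le> a t" if "0 < t" "t \<le> \<tau>" for t
  proof (rule doubling_induct[OF \<tau>(1) _ _ that])
    fix t assume t: "0 < t" "2 * t \<le> \<tau>" "b' * (2 * t) powr \<beta> \<le> a (2 * t)"
    have "2 powr \<beta> * (b' * t powr \<beta>) = b' * (2 * t) powr \<beta>"
      by (simp add: powr_mult)
    also have "\<dots> \<le> 2 powr \<beta> * a t" using t \<tau>1(2)[of t] \<tau> by auto
    finally show "b' * t powr \<beta> \<le> a t" by simp
  next
    fix t assume t: "t \<in> {\<tau>/2..\<tau>}"
    have "b' * t powr \<beta> \<le> b' * \<tau> powr \<beta>"
      using t \<tau> b \<beta> by (intro mult_left_mono powr_mono2) (auto simp: b'_def)
    also have "\<dots> = b" using \<tau> by (simp add: b'_def)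
    also have "\<dots> \<le> a t" by (rule b(2)[OF t])
    finally show "b' * t powr \<beta> \<le> a t" .
  qed
  then have "\<forall>\<^sub>F t in at_right 0. b' * t powr \<beta> \<le> a t"
    using \<tau>(1) by (auto simp: eventually_at_right[of 0 1])
  moreover have "0 < b'" using b \<tau> by (simp add: b'_def)
  ultimately show ?thesis by blast
qed

lemma scaling_upper:
  assumes "0 < \<beta>" "\<beta> < 1 / \<alpha>"
  shows "\<exists>C>0. \<forall>\<^sub>F t in at_right 0. a t \<le> C * t powr \<beta>"
proof -
  define \<kappa> where "\<kappa> = 2 powr (1 / \<alpha> - \<beta>)"
  have \<kappa>: "1 < \<kappa>" unfolding \<kappa>_def by (rule gr_one_powr) (use assms in auto)
  have \<kappa>2: "2 powr (1 / \<alpha>) = \<kappa> * 2 powr \<beta>" by (simp add: \<kappa>_def flip: powr_add)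
  have "\<forall>\<^sub>F t in at_right 0. 2 powr \<beta> * a t < a (2 * t)"
    using scaling_ratio[OF \<kappa>] \<kappa> by (auto elim!: eventually_mono simp: \<kappa>2 mult.assoc)
  moreover obtain C where C: "0 < C" "\<forall>\<^sub>F t in at_right 0. a t \<le> C" using scaling_bounded by blast
  ultimately have "\<forall>\<^sub>F t in at_right 0. 2 powr \<beta> * a t < a (2 * t) \<and> a t \<le> C"
    by (intro eventually_conj)
  then obtain \<tau>1 where \<tau>1: "0 < \<tau>1" "\<And>t. 0 < t \<Longrightarrow> t < \<tau>1 \<Longrightarrow> 2 powr \<beta> * a t < a (2 * t) \<and> a t \<le> C"
    by (auto simp: eventually_at_right[of 0 1])
  define \<tau> where "\<tau> = \<tau>1 / 2"
  have \<tau>: "0 < \<tau>" "\<tau> < \<tau>1" using \<tau>1(1) by (auto simp: \<tau>_def)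
  define C' where "C' = C / (\<tau> / 2) powr \<beta>"
  have "a t \<le> C' * t powr \<beta>" if "0 < t" "t \<le> \<tau>" for t
  proof (rule doubling_induct[OF \<tau>(1) _ _ that])
    fix t assume t: "0 < t" "2 * t \<le> \<tau>" "a (2 * t) \<le> C' * (2 * t) powr \<beta>"
    have "2 powr \<beta> * a t \<le> a (2 * t)" using t \<tau>1(2)[of t] \<tau> by auto
    also have "\<dots> \<le> 2 powr \<beta> * (C' * t powr \<beta>)" using t(3) by (simp add: powr_mult mult_ac)
    finally show "a t \<le> C' * t powr \<beta>" by simp
  next
    fix t assume t: "t \<in> {\<tau>/2..\<tau>}"
    have "a t \<le> C" using \<tau>1(2)[of t] t \<tau> by auto
    also have "C = C' * (\<tau> / 2) powr \<beta>" using \<tau> by (simp add: C'_def)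
    also have "\<dots> \<le> C' * t powr \<beta>"
      using t \<tau> C assms by (intro mult_left_mono powr_mono2) (auto simp: C'_def)
    finally show "a t \<le> C' * t powr \<beta>" .
  qed
  then have "\<forall>\<^sub>F t in at_right 0. a t \<le> C' * t powr \<beta>"
    using \<tau>(1) by (auto simp: eventually_at_right[of 0 1])
  moreover have "0 < C'" using C \<tau> by (simp add: C'_def)
  ultimately show ?thesis by blast
qed

text \<open>For \<gamma> > 1/\<alpha> the level \<open>t powr \<gamma>\<close> is of smaller order
  than \<open>a t\<close>. This lemma, \<open>prob_abs_exceed_power\<close> and
  \<open>prob_negative\<close> are all that is used of the convergence later on.\<close>

lemma prob_exceed_power:
  assumes "1 / \<alpha> < \<gamma>" "r < \<rho>"
  shows "\<forall>\<^sub>F t in at_right 0. r < prob {\<omega> \<in> space M. t powr \<gamma> < X t \<omega>}"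
proof -
  have "\<forall>\<^sub>F n in sequentially. r < L.prob {\<omega> \<in> space N. 1 / real (Suc n) < Y 1 \<omega>}"
    by (rule order_tendstoD(1)[OF L.prob_pos_tendsto]) (use assms \<rho> in auto)
  then obtain n where n: "r < L.prob {\<omega> \<in> space N. 1 / real (Suc n) < Y 1 \<omega>}"
    by (auto dest!: eventually_happens)
  define \<eta> where "\<eta> = 1 / real (Suc n)"
  have \<eta>: "0 < \<eta>" by (simp add: \<eta>_def)
  obtain \<beta> where \<beta>: "1 / \<alpha> < \<beta>" "\<beta> < \<gamma>" using dense[OF assms(1)] by blast
  obtain b where b: "0 < b" "\<forall>\<^sub>F t in at_right 0. b * t powr \<beta> \<le> a t" using scaling_lower[OF \<beta>(1)] by blast
  have "\<forall>\<^sub>F t in at_right 0. r < prob {\<omega> \<in> space M. X t \<omega> / a t \<in> {\<eta><..}}"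
    by (rule prob_scaled_open) (use n in \<open>auto simp: \<eta>_def\<close>)
  moreover have "\<forall>\<^sub>F t in at_right 0. t powr \<gamma> < \<eta> * b * t powr \<beta>"
    using \<beta> \<eta> b by (intro powr_eventually_less) auto
  ultimately show ?thesis
    using b(2) eventually_at_right_less[of 0]
  proof eventually_elim
    case (elim t)
    have [measurable]: "X t \<in> borel_measurable M" using elim by (intro measurable_X) simp
    have "\<eta> * (b * t powr \<beta>) \<le> \<eta> * a t" using elim \<eta> by (intro mult_left_mono) auto
    then have le: "t powr \<gamma> < \<eta> * a t" using elim by (simp add: mult.assoc)
    have "prob {\<omega> \<in> space M. X t \<omega> / a t \<in> {\<eta><..}} \<le> prob {\<omega> \<in> space M. t powr \<gamma> < X t \<omega>}"
      using le a_pos[OF elim(4)] by (intro finite_measure_mono) (auto simp: field_simps)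
    then show ?case using elim(1) by linarith
  qed
qed

lemma prob_abs_exceed_power:
  assumes "0 < \<gamma>" "\<gamma> < 1 / \<alpha>" "0 < \<epsilon>"
  shows "\<forall>\<^sub>F t in at_right 0. prob {\<omega> \<in> space M. t powr \<gamma> < \<bar>X t \<omega>\<bar>} < \<epsilon>"
proof -
  obtain K where K: "0 < K" "L.prob {\<omega> \<in> space N. K \<le> \<bar>Y 1 \<omega>\<bar>} < \<epsilon>"
    using limit_tail_small[OF assms(3)] by blast
  obtain \<beta> where \<beta>: "\<gamma> < \<beta>" "\<beta> < 1 / \<alpha>" using dense[OF assms(2)] by blast
  obtain C where C: "0 < C" "\<forall>\<^sub>F t in at_right 0. a t \<le> C * t powr \<beta>"
    using scaling_upper[of \<beta>] \<beta> assms by auto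
  have "\<forall>\<^sub>F t in at_right 0. prob {\<omega> \<in> space M. X t \<omega> / a t \<in> {x. K \<le> \<bar>x\<bar>}} < \<epsilon>"
    by (rule prob_scaled_closed[OF closed_abs_ge]) (use K in auto)
  moreover have "\<forall>\<^sub>F t in at_right 0. t powr \<beta> < 1 / (K * C) * t powr \<gamma>"
    using \<beta> K C by (intro powr_eventually_less) auto
  ultimately show ?thesis
    using C(2) eventually_at_right_less[of 0]
  proof eventually_elim
    case (elim t)
    have [measurable]: "X t \<in> borel_measurable M" using elim by (intro measurable_X) simp
    have "K * a t \<le> K * (C * t powr \<beta>)" using elim K by (intro mult_left_mono) auto
    also have "\<dots> < t powr \<gamma>" using elim(2) K C by (simp add: field_simps)
    finally have "K * a t < t powr \<gamma>" .
    then have "K \<le> \<bar>x / a t\<bar>" if "t powr \<gamma> < \<bar>x\<bar>" for x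
      using that a_pos[OF elim(4)] by (simp add: abs_divide field_simps)
    then have "prob {\<omega> \<in> space M. t powr \<gamma> < \<bar>X t \<omega>\<bar>} \<le> prob {\<omega> \<in> space M. X t \<omega> / a t \<in> {x. K \<le> \<bar>x\<bar>}}"
      by (intro finite_measure_mono) auto
    then show ?case using elim(1) by linarith
  qed
qed

text \<open>The open half-line \<open>{..<0}\<close> is suited to weak convergence, and since the
  limit has no atom at 0 it carries the full mass \<open>1 - \<rho>\<close>.\<close>

lemma prob_negative:
  assumes "r < 1 - \<rho>"
  shows "\<forall>\<^sub>F t in at_right 0. r < prob {\<omega> \<in> space M. X t \<omega> < 0}"
proof -
  have "1 - \<rho> = L.prob {\<omega> \<in> space N. \<not> 0 < Y 1 \<omega>}"
    unfolding \<rho> by (rule L.prob_neg[symmetric]) simp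
  also have "\<dots> \<le> L.prob ({\<omega> \<in> space N. Y 1 \<omega> < 0} \<union> {\<omega> \<in> space N. Y 1 \<omega> = 0})"
    by (rule L.finite_measure_mono) auto
  also have "\<dots> \<le> L.prob {\<omega> \<in> space N. Y 1 \<omega> < 0} + L.prob {\<omega> \<in> space N. Y 1 \<omega> = 0}"
    by (rule measure_Un_le) auto
  finally have "r < L.prob {\<omega> \<in> space N. Y 1 \<omega> < 0}"
    using assms limit_no_atom by simp
  then have "\<forall>\<^sub>F t in at_right 0. r < prob {\<omega> \<in> space M. X t \<omega> / a t \<in> {..<0}}"
    by (intro prob_scaled_open) auto
  then show ?thesis
    using eventually_at_right_less[of 0]
  proof eventually_elim
    case (elim t)
    then show ?case using a_pos[of t] by (simp add: divide_less_0_iff)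
  qed
qed

lemma \<rho>_bounds: "0 \<le> \<rho>" "\<rho> \<le> 1"
  by (simp_all add: \<rho>)

end

section \<open>Regularly varying envelopes\<close>

lemma exp_neg_powr_small:
  assumes "0 < (\<delta>::real)" "0 < \<kappa>"
  shows "((\<lambda>x. exp (- (\<kappa> * x powr - \<delta>)) / x powr E) \<longlongrightarrow> 0) (at_right 0)"
  using assms by real_asymp

text \<open>For \<open>\<phi>\<close> take the infimum of the affine functions \<open>s / (n + 1) + B\<^sub>n\<close> that bound the error
  \<open>\<bar>ln (p x) - r ln x\<bar>\<close> at \<open>s = - ln x\<close>. Being a concave function of sublinear growth, \<open>\<phi>\<close> has
  increments tending to \<open>0\<close>, which is regular variation of \<open>x\<^sup>r exp (\<plusminus>\<phi> (- ln x))\<close>.\<close>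

lemma regularly_varying_envelope:
  fixes p :: "real \<Rightarrow> real"
  assumes mono: "\<And>x y. 0 < x \<Longrightarrow> x \<le> y \<Longrightarrow> p x \<le> p y"
    and pos: "\<And>x. 0 < x \<Longrightarrow> 0 < p x" and le1: "\<And>x. 0 < x \<Longrightarrow> p x \<le> 1"
    and up: "\<And>d. 0 < d \<Longrightarrow> \<forall>\<^sub>F x in at_right 0. p x \<le> x powr (r - d)"
    and lo: "\<And>d. 0 < d \<Longrightarrow> \<forall>\<^sub>F x in at_right 0. x powr (r + d) \<le> p x"
  shows "\<exists>f\<in>regularly_varying_at_0 r. \<exists>g\<in>regularly_varying_at_0 r.
    \<forall>\<^sub>F x in at_right 0. f x \<le> p x \<and> p x \<le> g x"
proof -
  have "\<exists>B\<ge>0. \<forall>x. 0 < x \<longrightarrow> x < 1 \<longrightarrow> \<bar>ln (p x) - r * ln x\<bar> \<le> - ln x / real (Suc n) + B" for n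
  proof -
    define d where "d = 1 / real (Suc n)"
    have d: "0 < d" by (simp add: d_def)
    obtain b0 where b0: "0 < b0" "\<And>x. 0 < x \<Longrightarrow> x < b0 \<Longrightarrow> p x \<le> x powr (r - d) \<and> x powr (r + d) \<le> p x"
      using eventually_conj[OF up[OF d] lo[OF d]] by (auto simp: eventually_at_right[of 0 1])
    define b where "b = min b0 (1 / 2)"
    have b: "0 < b" "b < 1" "b \<le> b0" using b0 by (auto simp: b_def)
    \<comment> \<open>Bound for \<open>x\<close> between \<open>b\<close> and 1, where the eventual
      estimates say nothing: there \<open>p b \<le> p x \<le> 1\<close>, and
      \<open>\<bar>ln x\<bar>\<close> is at most \<open>- ln b\<close>.\<close>
    define B where "B = - ln (p b) + \<bar>r\<bar> * - ln b"
    have lnp: "ln (p x) \<le> 0" if "0 < x" for x using pos[OF that] le1[OF that] by simp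
    have "0 \<le> \<bar>r\<bar> * - ln b" using b by (intro mult_nonneg_nonneg) auto
    then have B: "0 \<le> B" using lnp[OF b(1)] by (simp add: B_def)
    have "\<bar>ln (p x) - r * ln x\<bar> \<le> - ln x / real (Suc n) + B" if x: "0 < x" "x < 1" for x
    proof (cases "x < b")
      case True
      then have px: "p x \<le> x powr (r - d)" "x powr (r + d) \<le> p x" using b0(2)[of x] x b by auto
      have "ln (p x) \<le> ln (x powr (r - d))"
        by (rule ln_mono) (use px pos[OF x(1)] x(1) in auto)
      moreover have "ln (x powr (r + d)) \<le> ln (p x)"
        by (rule ln_mono) (use px pos[OF x(1)] x(1) in auto)
      ultimately have "ln (p x) \<le> (r - d) * ln x" "(r + d) * ln x \<le> ln (p x)"
        using x by (auto simp: ln_powr)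
      then have "\<bar>ln (p x) - r * ln x\<bar> \<le> - (d * ln x)" by (simp add: algebra_simps abs_le_iff)
      then show ?thesis using B by (simp add: d_def)
    next
      case False
      then have "p b \<le> p x" using b by (intro mono) auto
      then have 1: "ln (p b) \<le> ln (p x)" using pos b(1) by (intro ln_mono) auto
      have "ln b \<le> ln x" using False b by (intro ln_mono) auto
      then have "\<bar>r\<bar> * \<bar>ln x\<bar> \<le> \<bar>r\<bar> * - ln b" using x by (intro mult_left_mono) (auto simp: abs_if)
      then have 2: "\<bar>r * ln x\<bar> \<le> \<bar>r\<bar> * - ln b" by (simp add: abs_mult)
      have "\<bar>ln (p x) - r * ln x\<bar> \<le> B" using 1 2 lnp[OF x(1)] by (auto simp: B_def)
      moreover have "0 \<le> - ln x / real (Suc n)" using x by (intro divide_nonneg_nonneg) auto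
      ultimately show ?thesis by linarith
    qed
    then show ?thesis using B by blast
  qed
  then obtain B where B: "\<And>n. 0 \<le> B n"
    "\<And>n x. 0 < x \<Longrightarrow> x < 1 \<Longrightarrow> \<bar>ln (p x) - r * ln x\<bar> \<le> - ln x / real (Suc n) + B n"
    by metis
  \<comment> \<open>\<open>max 0 s\<close> makes \<phi> monotone on the whole line, which also
    yields its measurability.\<close>
  define \<phi> where "\<phi> s = (INF n. max 0 s / real (Suc n) + B n)" for s
  have bdd: "bdd_below (range (\<lambda>n. max 0 s / real (Suc n) + B n))" for s
    by (rule bdd_belowI[of _ 0]) (auto intro!: add_nonneg_nonneg B)
  have \<phi>_le: "\<phi> s \<le> max 0 s / real (Suc n) + B n" for s n
    unfolding \<phi>_def by (rule cINF_lower[OF bdd]) simp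
  have \<phi>_nonneg: "0 \<le> \<phi> s" for s
    unfolding \<phi>_def by (rule cINF_greatest) (auto intro!: add_nonneg_nonneg B)
  have \<phi>_mono: "\<phi> s \<le> \<phi> t" if "s \<le> t" for s t
    unfolding \<phi>_def[of t]
  proof (rule cINF_greatest)
    fix n
    have "max 0 s / real (Suc n) \<le> max 0 t / real (Suc n)" using that by (intro divide_right_mono) auto
    then show "\<phi> s \<le> max 0 t / real (Suc n) + B n" using \<phi>_le[of s n] by linarith
  qed simp
  \<comment> \<open>The form in which concavity is used: \<open>\<phi> s / s\<close> is
    decreasing.\<close>
  have \<phi>_ratio: "s / t * \<phi> t \<le> \<phi> s" if "0 < s" "s \<le> t" for s t
    unfolding \<phi>_def[of s]
  proof (rule cINF_greatest)
    fix n
    have "s / t * \<phi> t \<le> s / t * (max 0 t / real (Suc n) + B n)"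
      using that by (intro mult_left_mono \<phi>_le) auto
    also have "\<dots> = s / real (Suc n) + s / t * B n"
      using that by (simp add: distrib_left)
    also have "s / t * B n \<le> 1 * B n" using that B by (intro mult_right_mono) auto
    finally show "s / t * \<phi> t \<le> max 0 s / real (Suc n) + B n" using that by simp
  qed simp
  have \<phi>_sublinear: "((\<lambda>s. \<phi> s / s) \<longlongrightarrow> 0) at_top"
  proof (rule tendstoI)
    fix e :: real assume e: "0 < e"
    obtain n where n: "1 / real (Suc n) < e / 2"
      using reals_Archimedean[of "e / 2"] e by (auto simp: inverse_eq_divide)
    have "\<forall>\<^sub>F s in at_top. 2 * B n / e < s \<and> 0 < s"
      by (intro eventually_conj eventually_gt_at_top)
    then show "\<forall>\<^sub>F s in at_top. dist (\<phi> s / s) 0 < e"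
    proof eventually_elim
      case (elim s)
      have "\<phi> s \<le> s * (1 / real (Suc n)) + B n" using \<phi>_le[of s n] elim by simp
      moreover have "s * (1 / real (Suc n)) < s * (e / 2)" using n elim by (intro mult_strict_left_mono) auto
      moreover have "B n < s * (e / 2)" using elim e by (simp add: field_simps)
      moreover have "s * (e / 2) + s * (e / 2) = s * e" by simp
      ultimately have "\<phi> s < s * e" by linarith
      then have "\<phi> s / s < e" using elim by (simp add: field_simps)
      then show ?case using \<phi>_nonneg[of s] elim by (simp add: dist_real_def)
    qed
  qed
  have \<phi>_incr: "((\<lambda>s. \<phi> (s + k) - \<phi> s) \<longlongrightarrow> 0) at_top" for k
  proof (rule Lim_null_comparison)
    show "((\<lambda>s. \<bar>k\<bar> * (\<phi> (s + k) / (s + k) + \<phi> s / s)) \<longlongrightarrow> 0) at_top"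
    proof -
      have "filterlim (\<lambda>s. s + k) at_top at_top"
        by real_asymp
      then have "((\<lambda>s. \<phi> (s + k) / (s + k)) \<longlongrightarrow> 0) at_top"
        by (rule filterlim_compose[OF \<phi>_sublinear])
      from tendsto_mult_left[OF tendsto_add[OF this \<phi>_sublinear], of "\<bar>k\<bar>"] show ?thesis by simp
    qed
    \<comment> \<open>The increment is at most \<open>t - s\<close> times
      \<open>\<phi> t / t\<close>, and the latter tends to 0 by sublinearity.\<close>
    have bnd: "\<bar>\<phi> t - \<phi> s\<bar> \<le> (t - s) * (\<phi> t / t)" if "0 < s" "s \<le> t" for s t
    proof -
      have "\<phi> t - \<phi> s \<le> \<phi> t - s / t * \<phi> t" using \<phi>_ratio[OF that] by simp
      also have "\<dots> = (t - s) * (\<phi> t / t)" using that by (simp add: field_simps)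
      finally show ?thesis using \<phi>_mono[OF that(2)] by simp
    qed
    have "\<forall>\<^sub>F s in at_top. 0 < s \<and> - k < s" by (intro eventually_conj eventually_gt_at_top)
    then show "\<forall>\<^sub>F s in at_top. norm (\<phi> (s + k) - \<phi> s) \<le> \<bar>k\<bar> * (\<phi> (s + k) / (s + k) + \<phi> s / s)"
    proof eventually_elim
      case (elim s)
      have nn: "0 \<le> \<bar>k\<bar> * (\<phi> (s + k) / (s + k))" "0 \<le> \<bar>k\<bar> * (\<phi> s / s)"
        using elim \<phi>_nonneg by (auto intro!: mult_nonneg_nonneg divide_nonneg_nonneg)
      show ?case
        using bnd[of s "s + k"] bnd[of "s + k" s] elim nn
        by (cases "0 \<le> k") (auto simp: distrib_left abs_minus_commute)
    qed
  qed
  have lnlim: "filterlim (\<lambda>x. - ln x) at_top (at_right (0::real))" by real_asymp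
  \<comment> \<open>The two envelopes are \<open>\<sigma> = 1\<close> and
    \<open>\<sigma> = -1\<close>. As \<open>ln (c * x) = ln x + ln c\<close>, slow variation of the
    exponential factor is the vanishing of the increments of \<phi>.\<close>
  define G where "G \<sigma> x = x powr r * exp (\<sigma> * \<phi> (- ln x))" for \<sigma> x :: real
  have [measurable]: "\<phi> \<in> borel_measurable borel"
    by (rule borel_measurable_mono) (auto simp: mono_def \<phi>_mono)
  have RV: "G \<sigma> \<in> regularly_varying_at_0 r" for \<sigma>
    unfolding regularly_varying_at_0_def
  proof (intro CollectI conjI allI impI exI[of _ 1])
    show "G \<sigma> \<in> borel_measurable (restrict_space borel {0<..<1})"
      unfolding G_def[abs_def] by (intro measurable_restrict_space1) measurable
    show "\<forall>x\<in>{0<..<1}. 0 < G \<sigma> x" by (auto simp: G_def)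
    fix c :: real assume c: "0 < c"
    have "((\<lambda>x. \<phi> (- ln x + - ln c) - \<phi> (- ln x)) \<longlongrightarrow> 0) (at_right 0)"
      by (rule filterlim_compose[OF \<phi>_incr lnlim])
    then have "((\<lambda>x. c powr r * exp (\<sigma> * (\<phi> (- ln x + - ln c) - \<phi> (- ln x)))) \<longlongrightarrow> c powr r * exp (\<sigma> * 0)) (at_right 0)"
      by (intro tendsto_intros)
    then have "((\<lambda>x. c powr r * exp (\<sigma> * (\<phi> (- ln x + - ln c) - \<phi> (- ln x)))) \<longlongrightarrow> c powr r) (at_right 0)"
      by simp
    then show "((\<lambda>x. G \<sigma> (c * x) / G \<sigma> x) \<longlongrightarrow> c powr r) (at_right 0)"
    proof (rule Lim_transform_eventually)
      show "\<forall>\<^sub>F x in at_right 0. c powr r * exp (\<sigma> * (\<phi> (- ln x + - ln c) - \<phi> (- ln x))) = G \<sigma> (c * x) / G \<sigma> x"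
        using eventually_at_right_less[of 0]
      proof eventually_elim
        case (elim x)
        have "- ln (c * x) = - ln x + - ln c" using elim c by (simp add: ln_mult)
        then show ?case
          using elim c by (simp add: G_def powr_mult right_diff_distrib exp_diff)
      qed
    qed
  qed simp
  have "\<forall>\<^sub>F x in at_right 0. 0 < x \<and> x < (1::real)"
    by (auto simp: eventually_at_right[of 0 1] intro: exI[of _ 1])
  then have "\<forall>\<^sub>F x in at_right 0. G (-1) x \<le> p x \<and> p x \<le> G 1 x"
  proof eventually_elim
    case (elim x)
    have "\<bar>ln (p x) - r * ln x\<bar> \<le> \<phi> (- ln x)"
      unfolding \<phi>_def using B(2)[of x] elim by (intro cINF_greatest) auto
    then have "exp (r * ln x - \<phi> (- ln x)) \<le> exp (ln (p x))" "exp (ln (p x)) \<le> exp (r * ln x + \<phi> (- ln x))"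
      by (auto simp: abs_le_iff)
    then show ?case
      using elim pos[of x] by (simp add: G_def powr_def exp_add exp_diff exp_minus divide_inverse)
  qed
  then show ?thesis using RV by blast
qed

section \<open>The exponent of the distribution of the supremum\<close>

context step_law
begin

lemma transfer_pow_shift:
  "(transfer F (\<lambda>_. 1) ^^ n) g (s + r) = (transfer F (\<lambda>_. 1) ^^ n) (\<lambda>x. g (x + r)) s"
proof (induction n arbitrary: s)
  case (Suc n)
  have "(transfer F (\<lambda>_. 1) ^^ n) g (s + r + u) = (transfer F (\<lambda>_. 1) ^^ n) (\<lambda>x. g (x + r)) (s + u)" for u
    using Suc[of "s + u"] by (simp add: ac_simps)
  then show ?case
    by (simp, subst (1 2) transfer_def, simp)
qed simp

text \<open>A walk with nonnegative steps stays below \<open>x\<close> only if every single step is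
  at most \<open>x\<close>.\<close>

lemma stay_le_power:
  assumes "prob {..<0} = 0"
  shows "stay n x \<le> prob {..x} ^ n"
proof -
  have AE: "AE u in F. 0 \<le> u"
    using assms by (subst (asm) prob_eq_0) (auto elim!: eventually_mono simp: not_less)
  have "(transfer F (indicat_real {..x}) ^^ n) (\<lambda>_. 1) s \<le> prob {..x} ^ n" if "0 \<le> s" for s
    using that
  proof (induction n arbitrary: s)
    case (Suc n)
    let ?g = "(transfer F (indicat_real {..x}) ^^ n) (\<lambda>_. 1)"
    have g: "?g \<in> test_functions" by (rule transfer_pow_test) auto
    have "(transfer F (indicat_real {..x}) ^^ Suc n) (\<lambda>_. 1) s = (\<integral>u. indicat_real {..x} (s + u) * ?g (s + u) \<partial>F)"
      by (simp, subst transfer_def, simp)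
    also have "\<dots> \<le> (\<integral>u. indicat_real {..x} u * prob {..x} ^ n \<partial>F)"
    proof (rule integral_mono_AE)
      show "integrable F (\<lambda>u. indicat_real {..x} (s + u) * ?g (s + u))"
        by (rule integrable_test) (auto intro: g)
      show "integrable F (\<lambda>u. indicat_real {..x} u * prob {..x} ^ n)"
        by (intro integrable_mult_left integrable_test_function) auto
      show "AE u in F. indicat_real {..x} (s + u) * ?g (s + u) \<le> indicat_real {..x} u * prob {..x} ^ n"
        using AE
      proof eventually_elim
        case (elim u)
        show ?case
        proof (cases "s + u \<le> x")
          case True
          then have "u \<le> x" using Suc.prems by simp
          then show ?thesis using True elim Suc.prems Suc.IH[of "s + u"] by simp
        qed simp
      qed
    qed
    finally show ?case by (simp add: mult.commute)
  qed simp
  then show ?thesis by (simp add: stay_def)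
qed

end

lemma eventually_at_right_0_obtain:
  assumes "\<forall>\<^sub>F t in at_right 0. P (t :: real)"
  obtains \<tau> where "0 < \<tau>" "\<And>t. 0 < t \<Longrightarrow> t \<le> \<tau> \<Longrightarrow> P t"
proof -
  obtain b where b: "0 < b" "\<And>t. 0 < t \<Longrightarrow> t < b \<Longrightarrow> P t"
    using assms by (auto simp: eventually_at_right[of 0 1])
  then show thesis by (intro that[of "b / 2"]) auto
qed

lemma obtain_inverse_nat_le:
  assumes "0 < (\<tau> :: real)"
  obtains m :: nat where "1 \<le> m" "1 / real m \<le> \<tau>"
proof -
  obtain m where m: "inverse (real (Suc m)) < \<tau>" using reals_Archimedean[OF assms] by blast
  show thesis by (rule that[of "Suc m"]) (use m in \<open>auto simp: inverse_eq_divide\<close>)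
qed

lemma eventually_unit_interval: "\<forall>\<^sub>F x in at_right 0. 0 < x \<and> x < (1::real)"
  by (auto simp: eventually_at_right[of 0 1] intro: exI[of _ 1])

lemma nat_ceiling_bounds:
  "0 \<le> (x::real) \<Longrightarrow> x \<le> real (nat \<lceil>x\<rceil>)" "0 \<le> x \<Longrightarrow> real (nat \<lceil>x\<rceil>) \<le> x + 1"
  by linarith+

lemma nat_floor_bounds:
  "0 \<le> (x::real) \<Longrightarrow> real (nat \<lfloor>x\<rfloor>) \<le> x" "0 \<le> x \<Longrightarrow> x - 1 \<le> real (nat \<lfloor>x\<rfloor>)"
  by linarith+

section \<open>Upper bound for the probability of a small supremum\<close>

context attracted_levy_process
begin

abbreviation p :: "real \<Rightarrow> real" where "p \<equiv> prob_running_sup_le M X 1"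

text \<open>With \<open>\<theta> = 1 / x\<close>, a value \<open>X t > K * x\<close> makes the
  exponential at most \<delta>, and from the time \<open>t0\<close> on, where
  \<open>t0 powr \<gamma> = K * x\<close>, this has probability above
  \<open>\<rho> - \<delta>\<close>. Thus the coefficients are at most
  \<open>1 - \<rho> + 2 * \<delta>\<close> between \<open>t0\<close> and \<open>1 / m\<close>, and a
  third \<delta> pays for the uncontrolled times before \<open>t0\<close>. The resulting bound in
  \<open>A * t0\<close> no longer contains the mesh.\<close>

lemma upper_bound_core:
  assumes \<gamma>: "1 / \<alpha> < \<gamma>" and \<delta>: "0 < \<delta>" "\<delta> < 1" "3 * \<delta> < \<rho>"
  shows "\<exists>C>0. \<forall>x>0. p x \<le> C * x powr ((\<rho> - 3 * \<delta>) / \<gamma>)"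
proof -
  have \<gamma>0: "0 < \<gamma>" using \<gamma> \<alpha>_pos by (meson less_trans zero_less_divide_1_iff)
  obtain \<tau> where \<tau>: "0 < \<tau>" "\<And>t. 0 < t \<Longrightarrow> t \<le> \<tau> \<Longrightarrow> \<rho> - \<delta> < prob {\<omega> \<in> space M. t powr \<gamma> < X t \<omega>}"
    using eventually_at_right_0_obtain[OF prob_exceed_power[OF \<gamma>, of "\<rho> - \<delta>"]] \<delta> by auto
  obtain m :: nat where m: "1 \<le> m" "1 / real m \<le> \<tau>" using obtain_inverse_nat_le[OF \<tau>(1)] by blast
  define K where "K = ln (1 / \<delta>)"
  have K: "0 < K" "exp (- K) = \<delta>" using \<delta> by (auto simp: K_def ln_div exp_minus)
  define e where "e = \<rho> - 3 * \<delta>"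
  have e: "0 < e" "e \<le> 1" using \<delta> \<rho>_bounds by (auto simp: e_def)
  define A where "A = 2 * real m * (1 + 1 / \<delta>)"
  have A: "0 < A" using m \<delta> by (simp add: A_def add_pos_pos)
  define C where "C = 2 * exp 1 * (A * K powr (1 / \<gamma>)) powr e"
  have C: "0 < C" using A K by (simp add: C_def)
  have "p x \<le> C * x powr ((\<rho> - 3 * \<delta>) / \<gamma>)" if x: "0 < x" for x
  proof -
    define t0 where "t0 = (K * x) powr (1 / \<gamma>)"
    have t0: "0 < t0" "t0 powr \<gamma> = K * x" using K x \<gamma>0 by (auto simp: t0_def powr_powr)
    \<comment> \<open>A mesh so fine that the rounding in \<open>k0\<close> and \<open>n1\<close> is
      dominated by the main term, whence the factor 2 in \<open>A\<close>.\<close>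
    obtain i :: nat where i: "(1 + 1 / \<delta> + 3) / (t0 * real m * (1 + 1 / \<delta>)) < real i"
      using reals_Archimedean2 by blast
    have den: "0 < t0 * real m * (1 + 1 / \<delta>)" using t0 m \<delta> by (simp add: add_pos_pos)
    have "0 < (1 + 1 / \<delta> + 3) / (t0 * real m * (1 + 1 / \<delta>))"
      using den \<delta> by (intro divide_pos_pos) (auto simp: add_pos_pos)
    then have i0: "0 < real i" using i by linarith
    have i': "1 + 1 / \<delta> + 3 \<le> t0 * real m * (1 + 1 / \<delta>) * real i"
      using i den by (simp add: divide_less_eq mult.commute)
    define h where "h = 1 / real (m * i)"
    have h: "0 < h" "real i * h = 1 / real m" using m i0 by (auto simp: h_def)
    interpret F: step_law "law h" using h by (intro step_law) auto
    interpret S: spitzer_recursion "F.laplace (1 / x)"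
      "\<lambda>k. (transfer (law h) (\<lambda>_. 1) ^^ k) (\<lambda>y. exp (- (1 / x * max 0 y))) 0"
      using x by (intro F.spitzer_recursion_laplace) auto
    define k0 where "k0 = nat \<lceil>t0 * real m * real i\<rceil>"
    have k0: "t0 * real m * real i \<le> real k0" "real k0 \<le> t0 * real m * real i + 1"
      unfolding k0_def using t0 by (auto intro!: nat_ceiling_bounds)
    define n1 where "n1 = nat \<lceil>real k0 * (1 + 1 / \<delta>)\<rceil> + 2"
    have n1: "real k0 * (1 + 1 / \<delta>) \<le> real n1" "real n1 \<le> real k0 * (1 + 1 / \<delta>) + 3"
    proof -
      have "0 \<le> real k0 * (1 + 1 / \<delta>)" using \<delta> by simp
      from nat_ceiling_bounds[OF this] show "real k0 * (1 + 1 / \<delta>) \<le> real n1" "real n1 \<le> real k0 * (1 + 1 / \<delta>) + 3"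
        unfolding n1_def of_nat_add of_nat_numeral by linarith+
    qed
    have c: "(transfer (law h) (\<lambda>_. 1) ^^ k) (\<lambda>y. exp (- (1 / x * max 0 y))) 0 \<le> 1 - \<rho> + 2 * \<delta>"
      if k: "k0 \<le> k" "k \<le> i" for k
    proof -
      define t where "t = real k * h"
      have "t0 * real m * real i \<le> real k" using k0(1) k(1) by linarith
      then have t0t: "t0 \<le> t" using m i0 by (simp add: t_def h_def field_simps)
      have "real k * h \<le> real i * h" using k h by (intro mult_right_mono) auto
      then have t: "0 < t" "t \<le> \<tau>" using t0t t0 h m by (auto simp: t_def)
      have [measurable]: "X t \<in> borel_measurable M" using t by (intro measurable_X) auto
      let ?E = "{\<omega> \<in> space M. t powr \<gamma> < X t \<omega>}"
      have E [simp]: "?E \<in> events" by measurable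
      have tp: "K * x \<le> t powr \<gamma>" using powr_mono2[of \<gamma> t0 t] t0 t0t \<gamma>0 by simp
      have "(\<lambda>y. exp (- (1 / x * max 0 y))) \<in> test_functions"
        using multiplicative_weight_exp[of "1 / x"] x by (simp add: multiplicative_weight_def)
      then have "(transfer (law h) (\<lambda>_. 1) ^^ k) (\<lambda>y. exp (- (1 / x * max 0 y))) 0
          = expectation (\<lambda>\<omega>. exp (- (1 / x * max 0 (X t \<omega>))))"
        using h by (simp add: transfer_eq_expectation t_def)
      also have "\<dots> \<le> expectation (\<lambda>\<omega>. (1 - indicat_real ?E \<omega>) + \<delta>)"
      proof (rule integral_mono)
        show "integrable M (\<lambda>\<omega>. exp (- (1 / x * max 0 (X t \<omega>))))"
          using x by (intro integrable_unit_bounded) auto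
        show "integrable M (\<lambda>\<omega>. 1 - indicat_real ?E \<omega> + \<delta>)"
          by (intro Bochner_Integration.integrable_add Bochner_Integration.integrable_diff
              integrable_const integrable_real_indicator E) (simp add: less_top[symmetric])
        fix \<omega> assume "\<omega> \<in> space M"
        show "exp (- (1 / x * max 0 (X t \<omega>))) \<le> 1 - indicat_real ?E \<omega> + \<delta>"
        proof (cases "\<omega> \<in> ?E")
          case True
          then have "K * x \<le> max 0 (X t \<omega>)" using tp by auto
          then have "K \<le> 1 / x * max 0 (X t \<omega>)" using x by (simp add: field_simps)
          then have "exp (- (1 / x * max 0 (X t \<omega>))) \<le> exp (- K)" by simp
          then show ?thesis using True K by simp
        next
          case False
          have "exp (- (1 / x * max 0 (X t \<omega>))) \<le> 1" using x by simp
          moreover have "indicat_real ?E \<omega> = 0" using False by simp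
          ultimately show ?thesis using \<delta> by linarith
        qed
      qed
      also have "\<dots> = 1 - prob ?E + \<delta>"
      proof -
        have "integrable M (indicat_real ?E)" by (rule integrable_real_indicator[OF E]) (simp add: less_top[symmetric])
        then show ?thesis
          using E by (subst Bochner_Integration.integral_add, simp, simp, subst Bochner_Integration.integral_diff)
            (simp_all add: prob_space)
      qed
      finally show ?thesis using \<tau>(2)[OF t] by simp
    qed
    have "F.laplace (1 / x) i \<le> 2 * (real n1 / real i) powr (1 - (1 - \<rho> + 2 * \<delta> + \<delta>))"
      by (rule S.upper_bound[OF c]) (use \<delta> \<rho>_bounds n1 i0 in \<open>auto simp: n1_def\<close>)
    also have "1 - (1 - \<rho> + 2 * \<delta> + \<delta>) = e" by (simp add: e_def)
    also have "real n1 / real i \<le> A * t0"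
    proof -
      have "real k0 * (1 + 1 / \<delta>) \<le> (t0 * real m * real i + 1) * (1 + 1 / \<delta>)"
        using k0(2) \<delta> by (intro mult_right_mono) auto
      then have "real n1 \<le> (t0 * real m * real i + 1) * (1 + 1 / \<delta>) + 3"
        using n1(2) by linarith
      also have "\<dots> = t0 * real m * (1 + 1 / \<delta>) * real i + (1 + 1 / \<delta> + 3)"
        by (simp add: algebra_simps)
      also have "\<dots> \<le> 2 * (t0 * real m * (1 + 1 / \<delta>) * real i)"
        unfolding mult_2 by (rule add_left_mono[OF i'])
      also have "\<dots> = A * t0 * real i" by (simp add: A_def)
      finally show ?thesis using i0 by (simp add: divide_le_eq)
    qed
    then have "2 * (real n1 / real i) powr e \<le> 2 * (A * t0) powr e"
      using e i0 by (intro mult_left_mono powr_mono2) auto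
    finally have L: "F.laplace (1 / x) i \<le> 2 * (A * t0) powr e" .
    \<comment> \<open>Only the first \<open>i\<close> steps count: they end at time
      \<open>1 / m\<close>, up to which the estimates of attraction hold.\<close>
    have "p x \<le> F.stay (m * i) x"
      unfolding h_def using x m i0 by (intro prob_running_sup_le_grid) auto
    also have "\<dots> \<le> F.stay i x" using m by (intro F.stay_antimono) auto
    also have "\<dots> \<le> exp (1 / x * x) * F.laplace (1 / x) i"
      using x by (intro F.stay_le_laplace) auto
    also have "\<dots> \<le> exp 1 * (2 * (A * t0) powr e)"
      using x L by simp
    also have "(A * t0) powr e = (A * K powr (1 / \<gamma>)) powr e * x powr (e / \<gamma>)"
      using A K x by (simp add: t0_def powr_mult powr_powr mult_ac)
    finally show ?thesis by (simp add: C_def e_def mult_ac)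
  qed
  then show ?thesis using C by blast
qed

lemma running_sup_upper_exponent:
  assumes d: "0 < d"
  shows "\<forall>\<^sub>F x in at_right 0. p x \<le> x powr (\<alpha> * \<rho> - d)"
proof (cases "\<alpha> * \<rho> - d \<le> 0")
  case True
  show ?thesis using eventually_unit_interval
  proof eventually_elim
    case (elim x)
    have "1 \<le> x powr (\<alpha> * \<rho> - d)" using elim True powr_mono'[of "\<alpha> * \<rho> - d" 0 x] by simp
    then show ?case using prob_running_sup_le_le1[of x] elim by linarith
  qed
next
  case False
  then have "0 < \<alpha> * \<rho>" using d by linarith
  then have \<rho>0: "0 < \<rho>" using \<alpha>_pos by (simp add: zero_less_mult_iff)
  \<comment> \<open>As \<delta> tends to 0 with \<open>\<gamma> = 1 / \<alpha> + \<delta>\<close>,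
    the exponent of \<open>upper_bound_core\<close> tends to
    \<open>\<alpha> * \<rho>\<close>.\<close>
  have "((\<lambda>\<delta>. (\<rho> - 3 * \<delta>) / (1 / \<alpha> + \<delta>)) \<longlongrightarrow> (\<rho> - 3 * 0) / (1 / \<alpha> + 0)) (at_right 0)"
    by (intro tendsto_intros) (use \<alpha>_pos in auto)
  then have "\<forall>\<^sub>F \<delta> in at_right 0. \<alpha> * \<rho> - d < (\<rho> - 3 * \<delta>) / (1 / \<alpha> + \<delta>)"
    by (rule order_tendstoD) (use d in \<open>simp add: mult.commute\<close>)
  moreover have "\<forall>\<^sub>F \<delta> in at_right 0. \<delta> < min 1 (\<rho> / 3)"
    by (rule order_tendstoD(2)[OF tendsto_ident_at]) (use \<rho>0 in auto)
  ultimately have "\<forall>\<^sub>F \<delta> in at_right 0. \<alpha> * \<rho> - d < (\<rho> - 3 * \<delta>) / (1 / \<alpha> + \<delta>) \<and> \<delta> < min 1 (\<rho> / 3) \<and> 0 < \<delta>"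
    using eventually_at_right_less[of "0::real"] by eventually_elim auto
  then obtain \<delta> where \<delta>: "\<alpha> * \<rho> - d < (\<rho> - 3 * \<delta>) / (1 / \<alpha> + \<delta>)" "\<delta> < 1" "\<delta> < \<rho> / 3" "0 < \<delta>"
    by (auto dest!: eventually_happens)
  obtain C where C: "0 < C" "\<And>x. 0 < x \<Longrightarrow> p x \<le> C * x powr ((\<rho> - 3 * \<delta>) / (1 / \<alpha> + \<delta>))"
    using upper_bound_core[of "1 / \<alpha> + \<delta>" \<delta>] \<delta> by auto
  have "\<forall>\<^sub>F x in at_right 0. x powr ((\<rho> - 3 * \<delta>) / (1 / \<alpha> + \<delta>)) < 1 / C * x powr (\<alpha> * \<rho> - d)"
    by (rule powr_eventually_less) (use \<delta> C in auto)
  then show ?thesis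
    using eventually_at_right_less[of 0]
  proof eventually_elim
    case (elim x)
    have "p x \<le> C * x powr ((\<rho> - 3 * \<delta>) / (1 / \<alpha> + \<delta>))" using C elim by auto
    also have "\<dots> \<le> x powr (\<alpha> * \<rho> - d)" using elim C by (simp add: field_simps)
    finally show ?case .
  qed
qed

section \<open>Lower bound when the limit takes negative values\<close>

text \<open>For \<open>s\<close> up to \<open>(x / 2) powr (1 / \<gamma>)\<close> one has
  \<open>s powr \<gamma> \<le> x / 2\<close>, so the deviation estimate for single times feeds
  Ottaviani's inequality.\<close>

lemma short_time_stay:
  assumes \<gamma>: "0 < \<gamma>" "\<gamma> < 1 / \<alpha>"
  obtains \<tau> where "0 < \<tau>"
    "\<And>x h n. \<lbrakk>0 < x; 0 < h; real n * h \<le> \<tau>; real n * h \<le> (x / 2) powr (1 / \<gamma>)\<rbrakk> \<Longrightarrow> 2 / 3 \<le> grid_stay h n x"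
proof -
  obtain \<tau> where \<tau>: "0 < \<tau>" "\<And>t. 0 < t \<Longrightarrow> t \<le> \<tau> \<Longrightarrow> prob {\<omega> \<in> space M. t powr \<gamma> < \<bar>X t \<omega>\<bar>} < 1 / 4"
    using eventually_at_right_0_obtain[OF prob_abs_exceed_power[OF \<gamma>, of "1 / 4"]] by auto
  have "2 / 3 \<le> grid_stay h n x"
    if x: "0 < x" and h: "0 < h" "real n * h \<le> \<tau>" "real n * h \<le> (x / 2) powr (1 / \<gamma>)" for x h n
  proof -
    have "2 / 3 \<le> grid_stay h n (2 * (x / 2))"
    proof (rule grid_stay_ge_two_thirds[OF _ h(1) order_refl])
      fix s assume s: "0 < s" "s \<le> real n * h"
      have [measurable]: "X s \<in> borel_measurable M" using s by (intro measurable_X) auto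
      have "s powr \<gamma> \<le> ((x / 2) powr (1 / \<gamma>)) powr \<gamma>" using s h \<gamma> by (intro powr_mono2) auto
      then have "s powr \<gamma> \<le> x / 2" using \<gamma> x by (simp add: powr_powr)
      then have "prob {\<omega> \<in> space M. x / 2 < \<bar>X s \<omega>\<bar>} \<le> prob {\<omega> \<in> space M. s powr \<gamma> < \<bar>X s \<omega>\<bar>}"
        by (intro finite_measure_mono) auto
      also have "\<dots> \<le> 1 / 4" using \<tau>(2)[of s] s h by auto
      finally show "prob {\<omega> \<in> space M. x / 2 < \<bar>X s \<omega>\<bar>} \<le> 1 / 4" .
    qed (use x in auto)
    then show ?thesis by simp
  qed
  then show thesis using that \<tau>(1) by blast
qed

text \<open>The recursion is started at time \<open>t0\<close>, until which the walk stays below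
  \<open>z\<close> with probability at least 2/3; up to \<open>1 / m\<close> the transform then
  decays at most with exponent \<open>1 - q = \<rho> + \<delta>\<close>. The rate
  \<open>1 / z\<close> with \<open>z = x powr (1 + \<delta>)\<close> makes the error
  \<open>exp (- (x / z)) = exp (- (x powr - \<delta>))\<close> negligible against
  \<open>x powr E\<close>. The time after \<open>1 / m\<close> costs the constant \<kappa>.\<close>

lemma lower_bound_core:
  assumes ns: "\<not> subordinator M X" and \<gamma>: "0 < \<gamma>" "\<gamma> < 1 / \<alpha>" and \<delta>: "0 < \<delta>" "\<delta> < 1 - \<rho>"
  shows "\<exists>C>0. \<forall>\<^sub>F x in at_right 0. C * x powr ((1 + \<delta>) * (\<rho> + \<delta>) / \<gamma>) \<le> p x"
proof -
  define q where "q = 1 - \<rho> - \<delta>"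
  have q: "0 < q" "q \<le> 1" using \<delta> \<rho>_bounds by (auto simp: q_def)
  obtain \<tau>1 where \<tau>1: "0 < \<tau>1" "\<And>t. 0 < t \<Longrightarrow> t \<le> \<tau>1 \<Longrightarrow> q < prob {\<omega> \<in> space M. X t \<omega> < 0}"
    using eventually_at_right_0_obtain[OF prob_negative[of q]] \<delta> by (auto simp: q_def)
  obtain \<tau>2 where \<tau>2: "0 < \<tau>2"
    "\<And>x h n. \<lbrakk>0 < x; 0 < h; real n * h \<le> \<tau>2; real n * h \<le> (x / 2) powr (1 / \<gamma>)\<rbrakk> \<Longrightarrow> 2 / 3 \<le> grid_stay h n x"
    using short_time_stay[OF \<gamma>] by blast
  obtain m :: nat where m: "1 \<le> m" "1 / real m \<le> min \<tau>1 \<tau>2"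
    using obtain_inverse_nat_le[of "min \<tau>1 \<tau>2"] \<tau>1 \<tau>2 by auto
  have [measurable]: "X (1 / real m) \<in> borel_measurable M" by (rule measurable_X) simp
  \<comment> \<open>Being below \<open>- y\<close> at time \<open>1 / m\<close> leaves the process a
    rise by \<open>y\<close> for the remaining time.\<close>
  obtain y where y: "0 < y" "0 < prob {\<omega> \<in> space M. X (1 / real m) \<omega> < - y}"
    using not_subordinator_negative[OF ns m(1)] by blast
  have "prob {\<omega> \<in> space M. X (1 / real m) \<omega> < - y} \<le> prob {\<omega> \<in> space M. X (1 / real m) \<omega> \<le> - y}"
    by (rule finite_measure_mono) auto
  then have y': "0 < prob {\<omega> \<in> space M. X (1 / real m) \<omega> \<le> - y}" using y by linarith
  define \<kappa> where "\<kappa> = prob {\<omega> \<in> space M. X (1 / real m) \<omega> \<le> - y} * p y"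
  have \<kappa>: "0 < \<kappa>" unfolding \<kappa>_def using y' prob_running_sup_le_pos[OF ns y(1)] by simp
  define E where "E = (1 + \<delta>) * (\<rho> + \<delta>) / \<gamma>"
  define D where "D = q * (real m * (1/2) powr (1 / \<gamma>) / 2) powr (\<rho> + \<delta>) * (exp (- 1) * (2 / 3))"
  have D: "0 < D" using q m by (simp add: D_def)
  have main: "(D * x powr E - exp (- (x powr - \<delta>))) * \<kappa> \<le> p x"
    if x: "0 < x" "x < 1" and xt: "(x powr (1 + \<delta>) / 2) powr (1 / \<gamma>) \<le> 1 / real m"
      and nn: "0 \<le> D * x powr E - exp (- (x powr - \<delta>))" for x
  proof -
    define z where "z = x powr (1 + \<delta>)"
    have z: "0 < z" using x by (simp add: z_def)
    define t0 where "t0 = (z / 2) powr (1 / \<gamma>)"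
    have t0: "0 < t0" "t0 \<le> 1 / real m" using z xt by (auto simp: t0_def z_def)
    have zx: "1 / z * x = x powr - \<delta>" using x by (simp add: z_def powr_add powr_minus field_simps)
    have "(D * x powr E - exp (- (x powr - \<delta>))) * prob {\<omega> \<in> space M. X (1 / real m) \<omega> \<le> - y} * p y \<le> p x"
    proof (rule prob_running_sup_le_three_term[OF m(1) less_imp_le[OF x(1)] less_imp_le[OF y(1)] _ nn])
      \<comment> \<open>For these \<open>i\<close> the product \<open>t0 * m * i\<close> is at least
        2, so that rounding down gives \<open>k0 \<ge> 1\<close> and loses at most half.\<close>
      fix i :: nat assume i: "nat \<lceil>2 / (t0 * real m)\<rceil> \<le> i" "1 \<le> i"
      define h where "h = 1 / real (m * i)"
      have h: "0 < h" "real i * h = 1 / real m" using m i by (auto simp: h_def)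
      have i': "2 \<le> t0 * real m * real i"
      proof -
        have "2 / (t0 * real m) \<le> real i" using i(1) by linarith
        then show ?thesis using t0 m by (simp add: divide_le_eq mult_ac)
      qed
      interpret F: step_law "law h" using h by (intro step_law) auto
      interpret S: spitzer_recursion "F.laplace (1 / z)"
        "\<lambda>k. (transfer (law h) (\<lambda>_. 1) ^^ k) (\<lambda>y. exp (- (1 / z * max 0 y))) 0"
        using z by (intro F.spitzer_recursion_laplace) auto
      have c: "q \<le> (transfer (law h) (\<lambda>_. 1) ^^ k) (\<lambda>y. exp (- (1 / z * max 0 y))) 0"
        if k: "1 \<le> k" "k \<le> i" for k
      proof -
        have "real k * h \<le> real i * h" using k h by (intro mult_right_mono) auto
        then have "q < prob {\<omega> \<in> space M. X (real k * h) \<omega> < 0}"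
          using k h m by (intro \<tau>1(2)) auto
        also have "\<dots> = (transfer (law h) (\<lambda>_. 1) ^^ k) (indicat_real {..<0}) 0"
          using h by (subst transfer_eq_prob) auto
        also have "\<dots> \<le> (transfer (law h) (\<lambda>_. 1) ^^ k) (\<lambda>y. exp (- (1 / z * max 0 y))) 0"
        proof (rule F.transfer_pow_mono)
          show "(\<lambda>y. exp (- (1 / z * max 0 y))) \<in> test_functions"
            using multiplicative_weight_exp[of "1 / z"] z by (simp add: multiplicative_weight_def)
        qed (auto simp: indicator_def)
        finally show ?thesis by simp
      qed
      define k0 where "k0 = nat \<lfloor>t0 * real m * real i\<rfloor>"
      have k0: "real k0 \<le> t0 * real m * real i" "t0 * real m * real i - 1 \<le> real k0"
        unfolding k0_def using t0 by (auto intro!: nat_floor_bounds)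
      have "t0 * real m * real i \<le> 1 * real i"
        using t0 m by (intro mult_right_mono) (auto simp: field_simps)
      then have k0i: "1 \<le> k0" "k0 \<le> i" using k0 i' by linarith+
      have "real k0 * h \<le> t0 * real m * real i * h" using k0 h by (intro mult_right_mono) auto
      also have "\<dots> = t0" using m i by (simp add: h_def)
      finally have k0h: "real k0 * h \<le> t0" .
      have "2 / 3 \<le> F.stay k0 z"
        using z h k0h t0 m by (intro \<tau>2(2)) (auto simp: t0_def)
      then have "exp (- 1) * (2 / 3) \<le> exp (- (1 / z * z)) * F.stay k0 z" using z by simp
      also have "\<dots> \<le> F.laplace (1 / z) k0" using z by (intro F.laplace_ge_stay) auto
      finally have Lk0: "exp (- 1) * (2 / 3) \<le> F.laplace (1 / z) k0" .
      have "t0 * real m / 2 \<le> real k0 / real i"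
        using k0(2) i' i by (simp add: field_simps)
      then have "q * (t0 * real m / 2) powr (\<rho> + \<delta>) * (exp (- 1) * (2 / 3))
          \<le> q * (real k0 / real i) powr (1 - q) * F.laplace (1 / z) k0"
        using Lk0 q t0 \<rho>_bounds \<delta> by (intro mult_mono mult_left_mono) (auto simp: q_def intro!: powr_mono2)
      also have "\<dots> \<le> F.laplace (1 / z) i"
        by (rule S.lower_bound[OF c]) (use q k0i in auto)
      also have "\<dots> \<le> F.stay i x + exp (- (1 / z * x))"
        using z x by (intro F.laplace_le_stay) auto
      finally have "q * (t0 * real m / 2) powr (\<rho> + \<delta>) * (exp (- 1) * (2 / 3)) - exp (- (x powr - \<delta>)) \<le> F.stay i x"
        using zx by simp
      moreover have "t0 = (1/2) powr (1 / \<gamma>) * x powr ((1 + \<delta>) / \<gamma>)"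
        using x by (simp add: t0_def z_def powr_divide powr_powr)
      then have "(t0 * real m / 2) powr (\<rho> + \<delta>) = (real m * (1/2) powr (1 / \<gamma>) / 2) powr (\<rho> + \<delta>) * x powr E"
      proof -
        assume t: "t0 = (1/2) powr (1 / \<gamma>) * x powr ((1 + \<delta>) / \<gamma>)"
        have "t0 * real m / 2 = (real m * (1/2) powr (1 / \<gamma>) / 2) * x powr ((1 + \<delta>) / \<gamma>)"
          by (simp add: t)
        then have "(t0 * real m / 2) powr (\<rho> + \<delta>) = (real m * (1/2) powr (1 / \<gamma>) / 2) powr (\<rho> + \<delta>) * (x powr ((1 + \<delta>) / \<gamma>)) powr (\<rho> + \<delta>)"
          by (simp only: powr_mult)
        then show ?thesis by (simp add: powr_powr E_def)
      qed
      ultimately show "D * x powr E - exp (- (x powr - \<delta>)) \<le> grid_stay (1 / real (m * i)) i x"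
        by (simp add: D_def h_def mult_ac)
    qed
    then show ?thesis by (simp add: \<kappa>_def mult.assoc)
  qed
  have "((\<lambda>x. exp (- (1 * x powr - \<delta>)) / x powr E) \<longlongrightarrow> 0) (at_right 0)"
    by (rule exp_neg_powr_small) (use \<delta> in auto)
  then have 1: "\<forall>\<^sub>F x in at_right 0. exp (- (1 * x powr - \<delta>)) / x powr E < D / 2"
    using D by (intro order_tendstoD) auto
  have "((\<lambda>x. (x powr (1 + \<delta>) / 2) powr (1 / \<gamma>)) \<longlongrightarrow> 0) (at_right 0)"
  proof (rule tendsto_zero_powrI[OF _ tendsto_const])
    show "((\<lambda>x. x powr (1 + \<delta>) / 2) \<longlongrightarrow> 0) (at_right 0)" using \<delta> by real_asymp
  qed (use \<gamma> in auto)
  then have 2: "\<forall>\<^sub>F x in at_right 0. (x powr (1 + \<delta>) / 2) powr (1 / \<gamma>) < 1 / real m"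
    using m by (intro order_tendstoD) auto
  have "\<forall>\<^sub>F x in at_right 0. D / 2 * \<kappa> * x powr E \<le> p x"
    using 1 2 eventually_unit_interval
  proof eventually_elim
    case (elim x)
    have xE: "0 < x powr E" using elim by simp
    have le: "exp (- (x powr - \<delta>)) \<le> D / 2 * x powr E" using elim(1) xE by (simp add: field_simps)
    then have "D / 2 * x powr E \<le> D * x powr E - exp (- (x powr - \<delta>))" by simp
    then have "D / 2 * x powr E * \<kappa> \<le> (D * x powr E - exp (- (x powr - \<delta>))) * \<kappa>"
      using \<kappa> by (intro mult_right_mono) auto
    also have "\<dots> \<le> p x"
      using elim le xE D by (intro main) (auto intro: order_trans[OF le])
    finally show ?case by (simp add: mult_ac)
  qed
  then show ?thesis using D \<kappa> by (intro exI[of _ "D / 2 * \<kappa>"]) (auto simp: E_def)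
qed

section \<open>Lower bound in the case \<rho> = 1\<close>

text \<open>When the limit is positive, a walk with only small downward steps would have to descend in many
  stages, each of which fails with a probability that is not too small; so the downward movement
  of \<open>X\<close> must come from large negative steps.\<close>

lemma large_negative_increments:
  assumes ns: "\<not> subordinator M X" and \<rho>1: "\<rho> = 1" and \<delta>: "0 < \<delta>" "\<delta> < 1"
  shows "\<exists>m\<ge>1. \<exists>c>0. \<forall>\<^sub>F i in sequentially.
    c / real (m * i) \<le> prob {\<omega> \<in> space M. X (1 / real (m * i)) \<omega> \<le> - ((1 / real (m * i)) powr \<delta>)}"
proof -
  \<comment> \<open>By \<open>descent_bound\<close> each descent fails with probability at least of
    order \<open>i powr - (\<delta> / 3)\<close>, whereas a fall by \<open>b\<close> in steps of
    size at most \<open>c = h powr \<delta>\<close> takes a number of descents of order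
    \<open>i powr \<delta>\<close>. The product, of order \<open>i powr (2 * \<delta> / 3)\<close>,
    tends to infinity.\<close>
  define q where "q = 1 - \<delta> / 3"
  have q: "0 < q" "q \<le> 1" using \<delta> by (auto simp: q_def)
  have "1 / \<alpha> < 1 / \<alpha> + 1" by simp
  from prob_exceed_power[OF this, of q]
  obtain \<tau> where \<tau>: "0 < \<tau>" "\<And>t. 0 < t \<Longrightarrow> t \<le> \<tau> \<Longrightarrow> q < prob {\<omega> \<in> space M. t powr (1 / \<alpha> + 1) < X t \<omega>}"
    using \<rho>1 \<delta> by (auto simp: q_def elim: eventually_at_right_0_obtain)
  obtain m :: nat where m: "1 \<le> m" "1 / real m \<le> \<tau>" using obtain_inverse_nat_le[OF \<tau>(1)] by blast
  have [measurable]: "X (1 / real m) \<in> borel_measurable M" by (rule measurable_X) simp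
  obtain b where b: "0 < b" "0 < prob {\<omega> \<in> space M. X (1 / real m) \<omega> < - b}"
    using not_subordinator_negative[OF ns m(1)] by blast
  define w where "w = prob {\<omega> \<in> space M. X (1 / real m) \<omega> < - b}"
  have w: "0 < w" using b by (simp add: w_def)
  have main: "w \<le> exp (- (q\<^sup>2 * (b * real i powr (2 * \<delta> / 3) - 1)))
      + real i * prob {\<omega> \<in> space M. X (1 / real (m * i)) \<omega> \<le> - ((1 / real (m * i)) powr \<delta>)}" if i: "1 \<le> i" for i
  proof -
    define h where "h = 1 / real (m * i)"
    have h: "0 < h" "real i * h = 1 / real m" using m i by (auto simp: h_def)
    interpret F: step_law "law h" using h by (intro step_law) auto
    have [measurable]: "X h \<in> borel_measurable M" using h by (intro measurable_X) auto
    define c where "c = h powr \<delta>"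
    have c: "0 < c" using h by (simp add: c_def)
    \<comment> \<open>Rounded down, so that a fall below \<open>- b\<close> is also one below
      \<open>- (j * c)\<close>.\<close>
    define j where "j = nat \<lfloor>b / c\<rfloor>"
    have j: "real j \<le> b / c" "b / c - 1 \<le> real j"
      unfolding j_def using b c by (auto intro!: nat_floor_bounds)
    have jc: "real j * c \<le> b" using j(1) c by (simp add: field_simps)
    have "w \<le> prob {\<omega> \<in> space M. X (real i * h) \<omega> \<in> {..< - (real j * c)}}"
      unfolding w_def h(2) using jc by (intro finite_measure_mono) auto
    also have "\<dots> = (transfer (law h) (\<lambda>_. 1) ^^ i) (indicat_real {..< - (real j * c)}) 0"
      using h by (subst transfer_eq_prob) auto
    also have "indicat_real {..< - (real j * c)} = (\<lambda>x. indicat_real {..<0} (x + real j * c))"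
      by (rule ext) (auto simp: indicator_def)
    also have "(transfer (law h) (\<lambda>_. 1) ^^ i) \<dots> 0 = (transfer (law h) (\<lambda>_. 1) ^^ i) (indicat_real {..<0}) (real j * c)"
      using F.transfer_pow_shift[of i "indicat_real {..<0}" 0 "real j * c"] by simp
    also have "\<dots> \<le> (1 - q\<^sup>2 * (1 / real i) powr (1 - q)) ^ j + real i * F.prob {..<-c}"
    proof (rule F.descent_bound)
      fix k assume k: "1 \<le> k" "k \<le> i"
      have [measurable]: "X (real k * h) \<in> borel_measurable M" using h by (intro measurable_X) auto
      have "real k * h \<le> real i * h" using k h by (intro mult_right_mono) auto
      then have "q < prob {\<omega> \<in> space M. (real k * h) powr (1 / \<alpha> + 1) < X (real k * h) \<omega>}"
        using k h m by (intro \<tau>(2)) auto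
      also have "\<dots> \<le> prob {\<omega> \<in> space M. X (real k * h) \<omega> \<in> {0..}}"
        by (intro finite_measure_mono) (auto intro: order_trans[OF powr_ge_zero less_imp_le])
      also have "\<dots> = (transfer (law h) (\<lambda>_. 1) ^^ k) (indicat_real {0..}) 0"
        using h by (subst transfer_eq_prob) auto
      finally show "q \<le> (transfer (law h) (\<lambda>_. 1) ^^ k) (indicat_real {0..}) 0" by simp
    qed (use q i c in auto)
    also have "(1 - q\<^sup>2 * (1 / real i) powr (1 - q)) ^ j \<le> exp (- (q\<^sup>2 * (b * real i powr (2 * \<delta> / 3) - 1)))"
    proof -
      define u where "u = q\<^sup>2 * (1 / real i) powr (\<delta> / 3)"
      have "q\<^sup>2 \<le> 1" using q by (simp add: power_le_one)
      moreover have "(1 / real i) powr (\<delta> / 3) \<le> 1" using i \<delta> by (intro powr_le1) auto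
      ultimately have u: "0 \<le> u" "u \<le> 1" unfolding u_def by (auto intro!: mult_le_one)
      have "(1 - u) ^ j \<le> exp (- u) ^ j"
        using u exp_ge_add_one_self[of "- u"] by (intro power_mono) auto
      also have "\<dots> = exp (- (real j * u))" by (simp add: exp_of_nat_mult[symmetric])
      also have "\<dots> \<le> exp (- ((b / c - 1) * u))" using j u by (auto intro: mult_right_mono)
      also have "\<dots> \<le> exp (- (q\<^sup>2 * (b * real i powr (2 * \<delta> / 3) - 1)))"
      proof -
        have "real i powr \<delta> \<le> 1 / c"
        proof -
          have "real i powr \<delta> \<le> real (m * i) powr \<delta>" using m i \<delta> by (intro powr_mono2) auto
          then show ?thesis by (simp add: c_def h_def powr_divide)
        qed
        then have "b * real i powr \<delta> \<le> b / c" using mult_left_mono[of "real i powr \<delta>" "1 / c" b] b by simp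
        moreover have "b * real i powr (2 * \<delta> / 3) - 1 \<le> (b * real i powr \<delta> - 1) * (1 / real i) powr (\<delta> / 3)"
        proof -
          have "real i powr \<delta> * (1 / real i) powr (\<delta> / 3) = real i powr (2 * \<delta> / 3)"
            using i by (simp add: powr_divide powr_diff[symmetric])
          then have "(b * real i powr \<delta> - 1) * (1 / real i) powr (\<delta> / 3) = b * real i powr (2 * \<delta> / 3) - (1 / real i) powr (\<delta> / 3)"
            by (simp add: left_diff_distrib mult.assoc)
          then show ?thesis using \<open>(1 / real i) powr (\<delta> / 3) \<le> 1\<close> by simp
        qed
        ultimately have "b * real i powr (2 * \<delta> / 3) - 1 \<le> (b / c - 1) * (1 / real i) powr (\<delta> / 3)"
          by (meson diff_right_mono mult_right_mono order_trans powr_ge_zero)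
        then have "q\<^sup>2 * (b * real i powr (2 * \<delta> / 3) - 1) \<le> q\<^sup>2 * ((b / c - 1) * (1 / real i) powr (\<delta> / 3))"
          by (rule mult_left_mono) simp
        then have "q\<^sup>2 * (b * real i powr (2 * \<delta> / 3) - 1) \<le> (b / c - 1) * u"
          by (simp add: u_def mult_ac)
        then show ?thesis by simp
      qed
      finally show ?thesis by (simp add: u_def q_def)
    qed
    also have "F.prob {..<-c} \<le> prob {\<omega> \<in> space M. X h \<omega> \<le> - (h powr \<delta>)}"
      using h by (subst prob_law) (auto intro!: finite_measure_mono simp: c_def)
    finally show ?thesis by (simp add: h_def mult_left_mono)
  qed
  \<comment> \<open>The probability that all descents succeed vanishes, so at least half of
    \<open>w\<close> has to come from large negative steps.\<close>
  have "((\<lambda>i. exp (- (q\<^sup>2 * (b * real i powr (2 * \<delta> / 3) - 1)))) \<longlonglongrightarrow> 0)"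
    using \<delta> b q by real_asymp
  then have "\<forall>\<^sub>F i in sequentially. exp (- (q\<^sup>2 * (b * real i powr (2 * \<delta> / 3) - 1))) < w / 2"
    using w by (intro order_tendstoD) auto
  then have "\<forall>\<^sub>F i in sequentially. (w / 2) / real (m * i) \<le> prob {\<omega> \<in> space M. X (1 / real (m * i)) \<omega> \<le> - ((1 / real (m * i)) powr \<delta>)}"
    using eventually_ge_at_top[of 1]
  proof eventually_elim
    case (elim i)
    let ?P = "prob {\<omega> \<in> space M. X (1 / real (m * i)) \<omega> \<le> - ((1 / real (m * i)) powr \<delta>)}"
    have "w / 2 \<le> real i * ?P" using main[OF elim(2)] elim(1) by linarith
    also have "\<dots> \<le> real (m * i) * ?P"
      using mult_right_mono[of 1 "real m" "real i"] m by (intro mult_right_mono) auto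
    finally show ?case using elim m by (simp add: divide_le_eq mult.commute)
  qed
  then show ?thesis using w m(1) by (intro exI[of _ m] conjI exI[of _ "w / 2"]) auto
qed

text \<open>The strategy is played at a time \<open>e\<close> of order
  \<open>t0 = (x / 2) powr (1 / \<gamma>)\<close>: the process stays below \<open>x\<close> until
  \<open>e\<close> with probability 2/3, is then at \<open>- (e powr \<delta>)\<close> or lower with
  probability at least \<open>c * e\<close>, and may rise by \<open>e powr \<delta>\<close>
  afterwards. As \<gamma> exceeds \<open>1 / \<beta>\<close>, \<open>x powr \<beta>\<close> is
  negligible against \<open>t0\<close> and absorbs all constants;
  \<open>\<delta> = \<eta> / \<beta>\<close> turns \<open>(x powr \<beta>) powr \<delta>\<close>
  into \<open>x powr \<eta>\<close>.\<close>

lemma self_improving_step: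
  assumes ns: "\<not> subordinator M X" and \<rho>1: "\<rho> = 1" and \<beta>: "\<alpha> < \<beta>" and \<eta>: "0 < \<eta>" "\<eta> < 1" "\<eta> < \<beta>"
  shows "\<forall>\<^sub>F x in at_right 0. x powr \<beta> * p (x powr \<eta>) \<le> p x"
proof -
  define \<delta> where "\<delta> = \<eta> / \<beta>"
  have \<delta>: "0 < \<delta>" "\<delta> < 1" using \<eta> by (auto simp: \<delta>_def)
  have "1 / \<beta> < 1 / \<alpha>" using \<beta> \<alpha>_pos by (simp add: field_simps)
  then obtain \<gamma> where \<gamma>: "1 / \<beta> < \<gamma>" "\<gamma> < 1 / \<alpha>" using dense by blast
  have \<beta>0: "0 < \<beta>" using \<eta> by simp
  have \<gamma>0: "0 < \<gamma>" using \<gamma> \<beta>0 by (meson less_trans zero_less_divide_1_iff)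
  obtain m c where m: "1 \<le> m" and c: "0 < c"
    and ev: "\<forall>\<^sub>F i in sequentially.
      c / real (m * i) \<le> prob {\<omega> \<in> space M. X (1 / real (m * i)) \<omega> \<le> - ((1 / real (m * i)) powr \<delta>)}"
    using large_negative_increments[OF ns \<rho>1 \<delta>] by blast
  obtain i0 where i0: "\<And>i. i0 \<le> i \<Longrightarrow>
      c / real (m * i) \<le> prob {\<omega> \<in> space M. X (1 / real (m * i)) \<omega> \<le> - ((1 / real (m * i)) powr \<delta>)}"
    using ev by (auto simp: eventually_sequentially)
  obtain \<tau> where \<tau>: "0 < \<tau>"
    "\<And>x h n. \<lbrakk>0 < x; 0 < h; real n * h \<le> \<tau>; real n * h \<le> (x / 2) powr (1 / \<gamma>)\<rbrakk> \<Longrightarrow> 2 / 3 \<le> grid_stay h n x"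
    using short_time_stay[OF \<gamma>0 \<gamma>(2)] by blast
  have main: "c / 3 * t0 * p ((t0 / 2) powr \<delta>) \<le> p x"
    if x: "0 < x" and t0_def: "t0 = (x / 2) powr (1 / \<gamma>)" and t0: "t0 \<le> \<tau>" "t0 * real m \<le> 1" "real i0 \<le> 1 / (t0 * real m)"
    for x t0
  proof -
    have t0p: "0 < t0" using x by (simp add: t0_def)
    \<comment> \<open>Large negative increments are known only for the times
      \<open>1 / (m * i)\<close>; rounding puts \<open>e\<close> between \<open>t0 / 2\<close> and
      \<open>t0\<close>.\<close>
    define i where "i = nat \<lceil>1 / (t0 * real m)\<rceil>"
    have tm: "0 < t0 * real m" "1 \<le> 1 / (t0 * real m)" using t0p m t0 by (auto simp: field_simps)
    have i: "1 / (t0 * real m) \<le> real i" "real i \<le> 1 / (t0 * real m) + 1"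
      unfolding i_def using tm by (auto intro!: nat_ceiling_bounds)
    have ii: "i0 \<le> i" "1 \<le> i" using i t0(3) tm by linarith+
    define e where "e = 1 / real (m * i)"
    have e: "0 < e" using m ii by (simp add: e_def)
    have e1: "e \<le> t0" using i(1) m ii t0p by (simp add: e_def field_simps)
    have "2 / (t0 * real m) = 1 / (t0 * real m) + 1 / (t0 * real m)" by simp
    then have "real i \<le> 2 / (t0 * real m)" using i(2) tm(2) by linarith
    then have e2: "t0 / 2 \<le> e" using m ii t0p by (simp add: e_def field_simps)
    have mi: "1 \<le> m * i" using m ii by (metis mult_le_mono nat_mult_1)
    have "2 / 3 * prob {\<omega> \<in> space M. X (1 / real (m * i)) \<omega> \<le> - (e powr \<delta>)} * p (e powr \<delta>) \<le> p x"
    proof (rule prob_running_sup_le_three_term[OF mi, where ?i0.0 = 1])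
      fix i' :: nat assume i': "1 \<le> i'"
      have "real i' * (1 / real (m * i * i')) = e" using i' m ii by (simp add: e_def)
      then show "2 / 3 \<le> grid_stay (1 / real (m * i * i')) i' x"
        using x e e1 t0 i' m ii by (intro \<tau>(2)) (auto simp: t0_def)
    qed (use x in auto)
    moreover have "c / 3 * t0 * p ((t0 / 2) powr \<delta>)
        \<le> 2 / 3 * prob {\<omega> \<in> space M. X (1 / real (m * i)) \<omega> \<le> - (e powr \<delta>)} * p (e powr \<delta>)"
    proof (rule mult_mono)
      have "c * e \<le> prob {\<omega> \<in> space M. X (1 / real (m * i)) \<omega> \<le> - (e powr \<delta>)}"
        using i0[OF ii(1)] by (simp add: e_def)
      moreover have "c / 3 * t0 \<le> 2 / 3 * (c * e)" using mult_left_mono[OF e2, of c] c by simp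
      ultimately show "c / 3 * t0 \<le> 2 / 3 * prob {\<omega> \<in> space M. X (1 / real (m * i)) \<omega> \<le> - (e powr \<delta>)}"
        by linarith
      show "p ((t0 / 2) powr \<delta>) \<le> p (e powr \<delta>)"
        using e2 t0p \<delta> by (intro prob_running_sup_le_mono powr_mono2) auto
    qed (simp_all add: prob_running_sup_le_nonneg)
    ultimately show ?thesis by linarith
  qed
  have lim: "((\<lambda>x. (x / 2) powr (1 / \<gamma>)) \<longlongrightarrow> 0) (at_right 0)" using \<gamma>0 by real_asymp
  have 1: "\<forall>\<^sub>F x in at_right 0. (x / 2) powr (1 / \<gamma>) < min \<tau> (1 / (real m * (real i0 + 1)))"
    by (rule order_tendstoD(2)[OF lim]) (use \<tau> m in \<open>auto intro!: mult_pos_pos\<close>)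
  have gb: "1 / \<gamma> < \<beta>" using \<gamma> \<gamma>0 \<beta>0 by (simp add: field_simps)
  have 2: "\<forall>\<^sub>F x in at_right 0. x powr \<beta> < c / 3 * (1/2) powr (1 / \<gamma>) * x powr (1 / \<gamma>)"
    by (rule powr_eventually_less) (use gb c in auto)
  have 3: "\<forall>\<^sub>F x in at_right 0. x powr \<beta> < (1/2) powr (1 / \<gamma>) / 2 * x powr (1 / \<gamma>)"
    by (rule powr_eventually_less) (use gb in auto)
  show ?thesis
    using 1 2 3 eventually_at_right_less[of 0]
  proof eventually_elim
    case (elim x)
    define t0 where "t0 = (x / 2) powr (1 / \<gamma>)"
    have t0p: "0 < t0" using elim by (simp add: t0_def)
    have t0e: "t0 = (1/2) powr (1 / \<gamma>) * x powr (1 / \<gamma>)" using elim by (simp add: t0_def powr_divide)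
    have "0 < real m * (real i0 + 1)" using m by (intro mult_pos_pos) auto
    moreover have "t0 < 1 / (real m * (real i0 + 1))" using elim(1) by (simp only: t0_def min_less_iff_conj)
    ultimately have "t0 * (real m * (real i0 + 1)) < 1" by (simp only: pos_less_divide_eq)
    then have tm: "t0 * real m * (real i0 + 1) < 1" by (simp add: mult.assoc)
    have "0 < t0 * real m" using t0p m by simp
    have 4: "t0 * real m \<le> 1" "real i0 \<le> 1 / (t0 * real m)"
    proof -
      have "t0 * real m * 1 \<le> t0 * real m * (real i0 + 1)" using \<open>0 < t0 * real m\<close> by (intro mult_left_mono) auto
      then show "t0 * real m \<le> 1" using tm by linarith
      have "t0 * real m * real i0 \<le> t0 * real m * (real i0 + 1)" using \<open>0 < t0 * real m\<close> by (intro mult_left_mono) auto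
      then show "real i0 \<le> 1 / (t0 * real m)" using tm \<open>0 < t0 * real m\<close> by (simp add: le_divide_eq mult.commute)
    qed
    have "x powr \<beta> \<le> c / 3 * t0" using elim(2) by (simp add: t0e)
    moreover have "p (x powr \<eta>) \<le> p ((t0 / 2) powr \<delta>)"
    proof (rule prob_running_sup_le_mono)
      have "x powr \<eta> = (x powr \<beta>) powr \<delta>" using \<beta>0 by (simp add: powr_powr \<delta>_def)
      also have "\<dots> \<le> (t0 / 2) powr \<delta>" using elim(3) \<delta> by (intro powr_mono2) (auto simp: t0e)
      finally show "x powr \<eta> \<le> (t0 / 2) powr \<delta>" .
    qed simp
    ultimately have "x powr \<beta> * p (x powr \<eta>) \<le> c / 3 * t0 * p ((t0 / 2) powr \<delta>)"
      using c t0p prob_running_sup_le_nonneg by (intro mult_mono) auto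
    also have "\<dots> \<le> p x"
      using elim(1,4) by (intro main[OF _ _ _ 4]) (auto simp: t0_def)
    finally show ?case .
  qed
qed

text \<open>The exponent is the fixed point of \<open>E = \<beta> + \<eta> * E\<close>, so it is
  reproduced by each application of \<open>self_improving_step\<close>. The number of applications
  grows as \<open>x\<close> tends to 0; since each of them comes without a constant factor, nothing
  accumulates and only \<open>p x0\<close> remains.\<close>

lemma lower_bound_positive_limit:
  assumes ns: "\<not> subordinator M X" and \<rho>1: "\<rho> = 1" and \<beta>: "\<alpha> < \<beta>" and \<eta>: "0 < \<eta>" "\<eta> < 1" "\<eta> < \<beta>"
  shows "\<exists>C>0. \<forall>\<^sub>F x in at_right 0. C * x powr (\<beta> / (1 - \<eta>)) \<le> p x"
proof -
  obtain x1 where x1: "0 < x1" "\<And>x. 0 < x \<Longrightarrow> x \<le> x1 \<Longrightarrow> x powr \<beta> * p (x powr \<eta>) \<le> p x"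
    using eventually_at_right_0_obtain[OF self_improving_step[OF assms]] by auto
  define x0 where "x0 = min x1 (1 / 2)"
  have x0: "0 < x0" "x0 < 1" "x0 \<le> x1" using x1 by (auto simp: x0_def)
  have p0: "0 < p x0" by (rule prob_running_sup_le_pos[OF ns x0(1)])
  have \<beta>0: "0 < \<beta>" using \<eta> by simp
  have claim: "p x0 * x powr (\<beta> / (1 - \<eta>)) \<le> p x" if "x0 \<le> x powr (\<eta> ^ k)" "0 < x" "x < 1" for k x
    using that
  proof (induction k arbitrary: x)
    case 0
    then have "p x0 \<le> p x" using x0 by (intro prob_running_sup_le_mono) auto
    moreover have "x powr (\<beta> / (1 - \<eta>)) \<le> 1" using 0 \<beta>0 \<eta> by (intro powr_le1) auto
    then have "p x0 * x powr (\<beta> / (1 - \<eta>)) \<le> p x0 * 1" using p0 by (intro mult_left_mono) auto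
    ultimately show ?case by linarith
  next
    case (Suc k)
    show ?case
    proof (cases "x0 \<le> x")
      case True
      then have "p x0 \<le> p x" using x0 by (intro prob_running_sup_le_mono) auto
      moreover have "x powr (\<beta> / (1 - \<eta>)) \<le> 1" using Suc.prems \<beta>0 \<eta> by (intro powr_le1) auto
      then have "p x0 * x powr (\<beta> / (1 - \<eta>)) \<le> p x0 * 1" using p0 by (intro mult_left_mono) auto
      ultimately show ?thesis by linarith
    next
      case False
      have "p x0 * (x powr \<eta>) powr (\<beta> / (1 - \<eta>)) \<le> p (x powr \<eta>)"
        using Suc.prems \<eta> powr_less_mono2[of \<eta> x 1] by (intro Suc.IH) (auto simp: powr_powr)
      then have "x powr \<beta> * (p x0 * (x powr \<eta>) powr (\<beta> / (1 - \<eta>))) \<le> x powr \<beta> * p (x powr \<eta>)"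
        by (intro mult_left_mono) auto
      also have "\<dots> \<le> p x" using False Suc.prems x0 by (intro x1(2)) auto
      also have "x powr \<beta> * (p x0 * (x powr \<eta>) powr (\<beta> / (1 - \<eta>))) = p x0 * x powr (\<beta> + \<eta> * (\<beta> / (1 - \<eta>)))"
        by (simp add: powr_powr powr_add)
      also have "\<beta> + \<eta> * (\<beta> / (1 - \<eta>)) = \<beta> / (1 - \<eta>)" using \<eta> by (simp add: field_simps)
      finally show ?thesis .
    qed
  qed
  have "\<exists>k. x0 \<le> x powr (\<eta> ^ k)" if x: "0 < x" for x
  proof -
    have "(\<lambda>k. x powr (\<eta> ^ k)) \<longlonglongrightarrow> x powr 0"
      using \<eta> x by (intro tendsto_powr tendsto_const LIMSEQ_realpow_zero) auto
    then have "\<forall>\<^sub>F k in sequentially. x0 < x powr (\<eta> ^ k)"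
      using x x0 by (intro order_tendstoD) auto
    then show ?thesis by (auto dest!: eventually_happens intro: less_imp_le)
  qed
  then have "\<forall>\<^sub>F x in at_right 0. p x0 * x powr (\<beta> / (1 - \<eta>)) \<le> p x"
    using claim by (intro eventually_mono[OF eventually_unit_interval]) blast
  then show ?thesis using p0 by blast
qed

text \<open>In both cases the exponents available tend to \<open>\<alpha> * \<rho>\<close> as
  \<delta> tends to 0, and the room left below \<open>\<alpha> * \<rho> + d\<close> absorbs the
  constant \<open>C\<close>.\<close>

lemma running_sup_lower_exponent:
  assumes ns: "\<not> subordinator M X" and d: "0 < d"
  shows "\<forall>\<^sub>F x in at_right 0. x powr (\<alpha> * \<rho> + d) \<le> p x"
proof -
  have "\<exists>E C. E < \<alpha> * \<rho> + d \<and> 0 < C \<and> (\<forall>\<^sub>F x in at_right 0. C * x powr E \<le> p x)"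
  proof (cases "\<rho> = 1")
    case True
    have "((\<lambda>\<delta>. (\<alpha> + \<delta>) / (1 - \<delta>)) \<longlongrightarrow> (\<alpha> + 0) / (1 - 0)) (at_right 0)"
      by (intro tendsto_intros) auto
    then have "\<forall>\<^sub>F \<delta> in at_right 0. (\<alpha> + \<delta>) / (1 - \<delta>) < \<alpha> * \<rho> + d"
      by (rule order_tendstoD) (use d True in simp)
    moreover have "\<forall>\<^sub>F \<delta> in at_right 0. \<delta> < (1::real)"
      by (rule order_tendstoD(2)[OF tendsto_ident_at]) auto
    ultimately have "\<forall>\<^sub>F \<delta> in at_right 0. (\<alpha> + \<delta>) / (1 - \<delta>) < \<alpha> * \<rho> + d \<and> \<delta> < 1 \<and> 0 < \<delta>"
      using eventually_at_right_less[of "0::real"] by eventually_elim auto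
    then obtain \<delta> where \<delta>: "(\<alpha> + \<delta>) / (1 - \<delta>) < \<alpha> * \<rho> + d" "\<delta> < 1" "0 < \<delta>"
      by (auto dest!: eventually_happens)
    then show ?thesis
      using lower_bound_positive_limit[OF ns True, of "\<alpha> + \<delta>" \<delta>] \<alpha>_pos by auto
  next
    case False
    then have \<rho>1: "\<rho> < 1" using \<rho>_bounds by simp
    have "((\<lambda>\<delta>. (1 + \<delta>) * (\<rho> + \<delta>) / (1 / \<alpha> - \<delta>)) \<longlongrightarrow> (1 + 0) * (\<rho> + 0) / (1 / \<alpha> - 0)) (at_right 0)"
      by (intro tendsto_intros) (use \<alpha>_pos in auto)
    then have "\<forall>\<^sub>F \<delta> in at_right 0. (1 + \<delta>) * (\<rho> + \<delta>) / (1 / \<alpha> - \<delta>) < \<alpha> * \<rho> + d"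
      by (rule order_tendstoD) (use d in \<open>simp add: mult.commute\<close>)
    moreover have "\<forall>\<^sub>F \<delta> in at_right 0. \<delta> < min (1 - \<rho>) (1 / \<alpha>)"
      by (rule order_tendstoD(2)[OF tendsto_ident_at]) (use \<rho>1 \<alpha>_pos in auto)
    ultimately have "\<forall>\<^sub>F \<delta> in at_right 0. (1 + \<delta>) * (\<rho> + \<delta>) / (1 / \<alpha> - \<delta>) < \<alpha> * \<rho> + d \<and> \<delta> < min (1 - \<rho>) (1 / \<alpha>) \<and> 0 < \<delta>"
      using eventually_at_right_less[of "0::real"] by eventually_elim auto
    then obtain \<delta> where \<delta>: "(1 + \<delta>) * (\<rho> + \<delta>) / (1 / \<alpha> - \<delta>) < \<alpha> * \<rho> + d" "\<delta> < 1 - \<rho>" "\<delta> < 1 / \<alpha>" "0 < \<delta>"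
      by (auto dest!: eventually_happens)
    then show ?thesis
      using lower_bound_core[OF ns, of "1 / \<alpha> - \<delta>" \<delta>] by auto
  qed
  then obtain E C where EC: "E < \<alpha> * \<rho> + d" "0 < C" "\<forall>\<^sub>F x in at_right 0. C * x powr E \<le> p x" by blast
  have "\<forall>\<^sub>F x in at_right 0. x powr (\<alpha> * \<rho> + d) < C * x powr E"
    by (rule powr_eventually_less) (use EC in auto)
  with EC(3) show ?thesis by eventually_elim simp
qed

text \<open>A subordinator is never negative, hence \<rho> = 1, and for large \<open>n\<close> an
  increment over time \<open>1 / n\<close> exceeds \<open>(1 / n) powr \<gamma>\<close> with
  probability above 1/2. If that level is at least \<open>x\<close>, a supremum at most
  \<open>x\<close> forces \<open>n\<close> independent increments to be at most \<open>x\<close>,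
  which has probability at most \<open>(1 / 2) ^ n\<close>, with \<open>n\<close> of order
  \<open>x powr - (1 / \<gamma>)\<close>.\<close>

lemma subordinator_small:
  assumes sub: "subordinator M X"
  shows "p \<in> o[at_right 0](\<lambda>x. x powr k)"
proof -
  have nn: "prob {\<omega> \<in> space M. X t \<omega> < 0} = 0" if t: "0 \<le> t" for t
  proof -
    have [measurable]: "X t \<in> borel_measurable M" using t by (rule measurable_X)
    have "AE \<omega> in M. mono_on {0..} (\<lambda>t. X t \<omega>)" using sub by (simp add: subordinator_def)
    then have "AE \<omega> in M. \<not> X t \<omega> < 0"
      using start_zero
    proof eventually_elim
      case (elim \<omega>)
      then have "X 0 \<omega> \<le> X t \<omega>" using mono_onD[of "{0..}" "\<lambda>t. X t \<omega>" 0 t] t by simp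
      then show ?case using elim by simp
    qed
    then show ?thesis by (subst prob_eq_0) auto
  qed
  have \<rho>1: "\<rho> = 1"
  proof (rule ccontr)
    assume "\<rho> \<noteq> 1"
    then have "\<forall>\<^sub>F t in at_right 0. 0 < prob {\<omega> \<in> space M. X t \<omega> < 0} \<and> 0 < t"
      using \<rho>_bounds by (intro eventually_conj prob_negative eventually_at_right_less) auto
    then show False using nn by (auto dest!: eventually_happens)
  qed
  define \<gamma> where "\<gamma> = 1 / \<alpha> + 1"
  have \<gamma>: "1 / \<alpha> < \<gamma>" "0 < \<gamma>" using \<alpha>_pos by (auto simp: \<gamma>_def add_pos_pos)
  obtain \<tau> where \<tau>: "0 < \<tau>" "\<And>t. 0 < t \<Longrightarrow> t \<le> \<tau> \<Longrightarrow> 1 / 2 < prob {\<omega> \<in> space M. t powr \<gamma> < X t \<omega>}"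
    using eventually_at_right_0_obtain[OF prob_exceed_power[OF \<gamma>(1), of "1 / 2"]] \<rho>1 by auto
  have bound: "p x \<le> 2 * exp (- (ln 2 * x powr - (1 / \<gamma>)))" if x: "0 < x" "x < 1" "x powr - (1 / \<gamma>) \<ge> 1 / \<tau> + 1" for x
  proof -
    \<comment> \<open>The largest \<open>n\<close> with
      \<open>x \<le> (1 / n) powr \<gamma>\<close>; the unit lost by rounding is the factor 2 in the
      bound.\<close>
    define n where "n = nat \<lfloor>x powr - (1 / \<gamma>)\<rfloor>"
    have n: "real n \<le> x powr - (1 / \<gamma>)" "x powr - (1 / \<gamma>) - 1 \<le> real n"
      unfolding n_def by (auto intro!: nat_floor_bounds)
    have "1 / \<tau> \<le> real n" "0 < 1 / \<tau>" using n x \<tau> by auto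
    then have n0: "0 < real n" by linarith
    with \<open>1 / \<tau> \<le> real n\<close> have n1: "1 / real n \<le> \<tau>" using \<tau>(1) by (simp add: field_simps)
    let ?t = "1 / real n"
    interpret F: step_law "law ?t" by (rule step_law) simp
    have [measurable]: "X ?t \<in> borel_measurable M" by (rule measurable_X) simp
    have "x powr (1 / \<gamma>) \<le> ?t" using n(1) n0 x by (simp add: powr_minus field_simps)
    then have "(x powr (1 / \<gamma>)) powr \<gamma> \<le> ?t powr \<gamma>" using \<gamma> by (intro powr_mono2) auto
    then have xt: "x \<le> ?t powr \<gamma>" using \<gamma> x by (simp add: powr_powr)
    have "F.prob {..x} = prob {\<omega> \<in> space M. X ?t \<omega> \<le> x}" by (subst prob_law) auto
    also have "\<dots> \<le> prob {\<omega> \<in> space M. \<not> ?t powr \<gamma> < X ?t \<omega>}"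
      using xt by (intro finite_measure_mono) auto
    also have "\<dots> = 1 - prob {\<omega> \<in> space M. ?t powr \<gamma> < X ?t \<omega>}" by (rule prob_neg) simp
    also have "\<dots> \<le> 1 / 2" using \<tau>(2)[of ?t] n0 n1 by simp
    finally have half: "F.prob {..x} \<le> 1 / 2" .
    have "F.prob {..<0} = 0" using nn[of ?t] by (subst prob_law) auto
    have "p x \<le> F.stay n x" using x n0 by (intro prob_running_sup_le_grid) auto
    also have "\<dots> \<le> F.prob {..x} ^ n" by (rule F.stay_le_power) fact
    also have "\<dots> \<le> (1 / 2) ^ n" by (rule power_mono[OF half]) simp
    also have "\<dots> = exp (- (ln 2 * real n))"
      by (simp add: power_one_over exp_minus exp_of_nat2_mult inverse_eq_divide)
    also have "\<dots> \<le> exp (ln 2 - ln 2 * x powr - (1 / \<gamma>))"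
      using mult_left_mono[OF n(2), of "ln 2"] by (simp add: algebra_simps)
    finally show ?thesis by (simp add: exp_diff exp_minus field_simps)
  qed
  have lim: "((\<lambda>x. exp (- (ln 2 * x powr - (1 / \<gamma>))) / x powr k) \<longlongrightarrow> 0) (at_right 0)"
    by (rule exp_neg_powr_small) (use \<gamma> in auto)
  have "filterlim (\<lambda>x. x powr - (1 / \<gamma>)) at_top (at_right 0)" using \<gamma> by real_asymp
  then have "\<forall>\<^sub>F x in at_right 0. 1 / \<tau> + 1 \<le> x powr - (1 / \<gamma>)"
    by (auto simp: filterlim_at_top)
  show ?thesis
  proof (rule landau_o.smallI)
    fix c :: real assume c: "0 < c"
    have "\<forall>\<^sub>F x in at_right 0. exp (- (ln 2 * x powr - (1 / \<gamma>))) / x powr k < c / 2"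
      by (rule order_tendstoD(2)[OF lim]) (use c in auto)
    then show "\<forall>\<^sub>F x in at_right 0. norm (p x) \<le> c * norm (x powr k)"
      using \<open>\<forall>\<^sub>F x in at_right 0. 1 / \<tau> + 1 \<le> x powr - (1 / \<gamma>)\<close> eventually_unit_interval
    proof eventually_elim
      case (elim x)
      have "p x \<le> 2 * exp (- (ln 2 * x powr - (1 / \<gamma>)))" using elim by (intro bound) auto
      also have "\<dots> \<le> c * x powr k" using elim by (simp add: field_simps)
      finally show ?case using prob_running_sup_le_nonneg[of 1 x] by simp
    qed
  qed
qed

end

theorem proposition5:
  fixes M :: "'a measure" and X :: "real \<Rightarrow> 'a \<Rightarrow> real" and \<alpha> \<rho> :: real
  assumes "levy_process M X"
    and "in_domain_of_attraction_at_0 M X \<alpha> \<rho>"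
  shows "(\<not> subordinator M X \<longrightarrow>
            (\<exists>f \<in> regularly_varying_at_0 (\<alpha> * \<rho>). \<exists>g \<in> regularly_varying_at_0 (\<alpha> * \<rho>).
               \<forall>\<^sub>F x in at_right 0.
                 f x \<le> prob_running_sup_le M X 1 x \<and> prob_running_sup_le M X 1 x \<le> g x)) \<and>
         (subordinator M X \<longrightarrow>
            (\<forall>k::real. k > 0 \<longrightarrow> prob_running_sup_le M X 1 \<in> o[at_right 0](\<lambda>x. x powr k)))"
proof -
  interpret levy_process M X by fact
  obtain a N and Y :: "real \<Rightarrow> (real \<Rightarrow> real) \<Rightarrow> real" where
    a: "\<forall>\<epsilon>>0. a \<epsilon> > 0" and Y: "levy_process N Y" "\<not> (AE \<omega> in N. Y 1 \<omega> = 0)"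
    and conv: "\<forall>e. filterlim e (at_right 0) sequentially \<longrightarrow>
           weak_conv_m (\<lambda>n. distr M borel (\<lambda>\<omega>. X (e n) \<omega> / a (e n))) (distr N borel (Y 1))"
    and \<alpha>: "0 < \<alpha>" "self_similar N Y (1 / \<alpha>)"
    and \<rho>: "\<rho> = measure N {\<omega> \<in> space N. Y 1 \<omega> > 0}"
    using assms(2) unfolding in_domain_of_attraction_at_0_def by blast
  have lim: "law_tendsto M (\<lambda>t \<omega>. X t \<omega> / a t) (distr N borel (Y 1))"
    unfolding law_tendsto_def
  proof safe
    fix e :: "nat \<Rightarrow> real" assume e: "\<forall>n. 0 < e n" "e \<longlonglongrightarrow> 0"
    have "e n \<noteq> 0" for n using e(1) by (metis less_irrefl)
    then have "filterlim e (at_right 0) sequentially"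
      using e by (auto simp: filterlim_at)
    then show "weak_conv_m (\<lambda>n. distr M borel (\<lambda>\<omega>. X (e n) \<omega> / a (e n))) (distr N borel (Y 1))"
      using conv by blast
  qed
  have "attracted_levy_process_axioms M X a N Y \<alpha> \<rho>"
    using a by (intro attracted_levy_process_axioms.intro Y lim \<alpha> \<rho>) simp
  then interpret attracted_levy_process M X a N Y \<alpha> \<rho>
    by (rule attracted_levy_process.intro[OF assms(1)])
  show ?thesis
  proof (intro conjI impI allI)
    assume ns: "\<not> subordinator M X"
    show "\<exists>f \<in> regularly_varying_at_0 (\<alpha> * \<rho>). \<exists>g \<in> regularly_varying_at_0 (\<alpha> * \<rho>).
        \<forall>\<^sub>F x in at_right 0. f x \<le> p x \<and> p x \<le> g x"
    proof (rule regularly_varying_envelope)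
      show "p x \<le> p y" if "0 < x" "x \<le> y" for x y
        using that by (intro prob_running_sup_le_mono) auto
      show "0 < p x" if "0 < x" for x by (rule prob_running_sup_le_pos[OF ns that])
      show "p x \<le> 1" if "0 < x" for x using that by (intro prob_running_sup_le_le1) simp
    qed (rule running_sup_upper_exponent running_sup_lower_exponent[OF ns]; assumption)+
  qed (rule subordinator_small)
qed

end
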